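(* For every partition $\lambda$, $\hat s_\lambda(y\|a)=\delta_{w_\lambda}(1)$.
   Context: $\mathbb{Q}[a]=\mathbb{Q}[a_i\mid i\in\mathbb{Z}]$, $\alpha_i=a_i-a_{i+1}$, $s^a_i$ exchanges $a_i,a_{i+1}$, $A^a_if=(f-s^a_if)/\alpha_i$. $\hat\Lambda(y\|a)$ is the set of formal sums $\sum_\lambda c_\lambda s_\lambda(y)$, $c_\lambda\in\mathbb{Q}[a]$, of Schur functions in $y_0,y_{-1},\dots$. $\Lambda(x\|a)$ is the $\mathbb{Q}[a]$-algebra generated by $p_k(x\|a)=\sum_{i\le0}(x_i^k-a_i^k)$; $f(x/a)$ is the image of a symmetric function $f$ under $p_k\mapsto p_k(x\|a)$. Pairing: $\langle s_\lambda(x/a),s_\mu(y)\rangle=\delta_{\lambda\mu}$, extended $\mathbb{Q}[a]$-bilinearly. Double Schur: with $\gamma_a$ ($a_i\mapsto a_{i+1}$, $p_k(x\|a)\mapsto p_k(x\|a)-a_1^k$), $h_r(x\|a)=\gamma_a^{r-1}h_r(x/a)$, $s_\lambda(x\|a)=\det(\gamma_a^{1-j}h_{\lambda_i-i+j}(x\|a))$. Dual Schur $\hat s_\mu(y\|a)$: $\langle s_\lambda(x\|a),\hat s_\mu(y\|a)\rangle=\delta_{\lambda\mu}$. Operators on $\hat\Lambda(y\|a)$: $\delta_i=A^a_i$ (acting on coefficients) for $i\neq0$, and $\delta_0f=\alpha_0^{-1}(f-\Omega\cdot s^a_0(f))$, $\Omega=\prod_{k\le0}\frac{1-a_0y_k}{1-a_1y_k}$;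 these are conjugates of the $A^a_i$ and satisfy the type A braid relations, so $\delta_w=\delta_{i_1}\cdots\delta_{i_\ell}$ is well defined for any reduced word $w=s_{i_1}\cdots s_{i_\ell}$ of a permutation $w$ of $\mathbb{Z}$ fixing all but finitely many integers. For a partition $\lambda$ (conjugate $\lambda'$), $w_\lambda(i)=i+\lambda_{1-i}$ for $i\le0$ and $w_\lambda(i)=i-\lambda'_i$ for $i>0$. *)

theory Defs
  imports
    "HOL-Library.Poly_Mapping"
    "HOL-Combinatorics.Transposition"
    "Jordan_Normal_Form.Determinant"
begin

section \<open>Formal power series in arbitrarily many variables\<close>

text \<open>All formal sums in infinitely many variables live in the ring of formal power series whose
  monomials are finitely supported exponent vectors.\<close>

typedef ('v, 'c) mps = "UNIV :: (('v \<Rightarrow>\<^sub>0 nat) \<Rightarrow> 'c) set"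
  morphisms coeff_mps Abs_mps ..

setup_lifting type_definition_mps

lemma mps_eqI: "(\<And>m. coeff_mps f m = coeff_mps g m) \<Longrightarrow> f = g"
  by (metis coeff_mps_inject ext)

lemma finite_splits: "finite {(p, q). p + q = (m :: 'v \<Rightarrow>\<^sub>0 nat)}"
proof -
  define B where "B = (\<Sum>i \<in> Poly_Mapping.keys m. Poly_Mapping.lookup m i)"
  have le: "Poly_Mapping.lookup m i \<le> B" for i
  proof (cases "i \<in> Poly_Mapping.keys m")
    case True
    then show ?thesis unfolding B_def by (intro member_le_sum) auto
  next
    case False
    then show ?thesis by (simp add: in_keys_iff)
  qed
  let ?P = "{p. \<exists>q. p + q = m}"
  let ?F = "{f :: 'v \<Rightarrow> nat. \<forall>i. (i \<in> Poly_Mapping.keys m \<longrightarrow> f i \<in> {..B}) \<and>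
    (i \<notin> Poly_Mapping.keys m \<longrightarrow> f i = 0)}"
  have fF: "finite ?F" by (rule finite_set_of_finite_funs) auto
  have sub: "Poly_Mapping.lookup ` ?P \<subseteq> ?F"
  proof
    fix f assume "f \<in> Poly_Mapping.lookup ` ?P"
    then obtain p q where f: "f = Poly_Mapping.lookup p" and s: "p + q = m" by auto
    have *: "f i \<le> Poly_Mapping.lookup m i" for i
      unfolding f s[symmetric] by (simp add: lookup_add)
    have "f i \<le> B" for i using * le by (rule order_trans)
    moreover have "f i = 0" if "i \<notin> Poly_Mapping.keys m" for i
      using *[of i] that by (simp add: in_keys_iff)
    ultimately show "f \<in> ?F" by simp
  qed
  have "finite (Poly_Mapping.lookup ` ?P)" using sub fF by (rule finite_subset)
  then have "finite ?P"
    by (rule finite_imageD) (auto simp: inj_on_def poly_mapping_eqI)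
  then have "finite ((\<lambda>p. (p, m - p)) ` ?P)" by simp
  moreover have "{(p, q). p + q = m} \<subseteq> (\<lambda>p. (p, m - p)) ` ?P"
    by auto
  ultimately show ?thesis by (rule finite_subset[rotated])
qed

instantiation mps :: (type, comm_ring_1) comm_ring_1
begin

lift_definition zero_mps :: "('a, 'b) mps" is "\<lambda>_. 0" .
lift_definition one_mps :: "('a, 'b) mps" is "\<lambda>m. if m = 0 then 1 else 0" .
lift_definition plus_mps :: "('a, 'b) mps \<Rightarrow> ('a, 'b) mps \<Rightarrow> ('a, 'b) mps"
  is "\<lambda>f g m. f m + g m" .
lift_definition uminus_mps :: "('a, 'b) mps \<Rightarrow> ('a, 'b) mps" is "\<lambda>f m. - f m" .
lift_definition minus_mps :: "('a, 'b) mps \<Rightarrow> ('a, 'b) mps \<Rightarrow> ('a, 'b) mps"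
  is "\<lambda>f g m. f m - g m" .
lift_definition times_mps :: "('a, 'b) mps \<Rightarrow> ('a, 'b) mps \<Rightarrow> ('a, 'b) mps"
  is "\<lambda>f g m. \<Sum>(p, q) \<in> {(p, q). p + q = m}. f p * g q" .

instance
proof
  fix a b c :: "('a, 'b) mps"
  show "a + b + c = a + (b + c)" by transfer (auto simp: add.assoc)
  show "a + b = b + a" by transfer (auto simp: add.commute)
  show "0 + a = a" by transfer auto
  show "- a + a = 0" by transfer auto
  show "a - b = a + - b" by transfer auto
  show "(a + b) * c = a * c + b * c"
    by transfer (auto simp: distrib_right sum.distrib case_prod_unfold)
  show "a * b = b * a"
  proof (transfer, rule ext)
    fix f g :: "('a \<Rightarrow>\<^sub>0 nat) \<Rightarrow> 'b" and m
    show "(\<Sum>(p, q)\<in>{(p, q). p + q = m}. f p * g q) = (\<Sum>(p, q)\<in>{(p, q). p + q = m}. g p * f q)"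
      by (rule sum.reindex_bij_witness[of _ prod.swap prod.swap])
         (auto simp: add.commute mult.commute)
  qed
  show "1 * a = a"
  proof (transfer, rule ext)
    fix f :: "('a \<Rightarrow>\<^sub>0 nat) \<Rightarrow> 'b" and m
    have "(\<Sum>(p, q)\<in>{(p, q). p + q = m}. (if p = 0 then 1 else 0) * f q)
        = (\<Sum>(p, q)\<in>{(0 :: 'a \<Rightarrow>\<^sub>0 nat, m)}. (if p = 0 then 1 else 0) * f q)"
      by (rule sum.mono_neutral_right[OF finite_splits]) (auto split: if_splits)
    then show "(\<Sum>(p, q)\<in>{(p, q). p + q = m}. (if p = 0 then 1 else 0) * f q) = f m" by simp
  qed
  show "a * b * c = a * (b * c)"
  proof (transfer, rule ext)
    fix f g h :: "('a \<Rightarrow>\<^sub>0 nat) \<Rightarrow> 'b" and m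
    let ?S = "\<lambda>m. {(p, q). p + q = (m :: 'a \<Rightarrow>\<^sub>0 nat)}"
    have "(\<Sum>(p, q)\<in>?S m. (\<Sum>(r, s)\<in>?S p. f r * g s) * h q)
        = (\<Sum>x\<in>?S m. \<Sum>y\<in>?S (fst x). f (fst y) * g (snd y) * h (snd x))"
      by (simp add: case_prod_unfold sum_distrib_right)
    also have "\<dots> = (\<Sum>(x, y)\<in>Sigma (?S m) (\<lambda>x. ?S (fst x)). f (fst y) * g (snd y) * h (snd x))"
      by (rule sum.Sigma) (auto simp: finite_splits)
    also have "\<dots> = (\<Sum>(x, y)\<in>Sigma (?S m) (\<lambda>x. ?S (snd x)). f (fst x) * (g (fst y) * h (snd y)))"
      by (rule sum.reindex_bij_witness[of _
             "\<lambda>((r, t), (s, q)). ((r + s, q), (r, s))" "\<lambda>((p, q), (r, s)). ((r, s + q), (s, q))"])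
         (auto simp: add.assoc mult.assoc)
    also have "\<dots> = (\<Sum>x\<in>?S m. \<Sum>y\<in>?S (snd x). f (fst x) * (g (fst y) * h (snd y)))"
      by (rule sum.Sigma[symmetric]) (auto simp: finite_splits)
    also have "\<dots> = (\<Sum>(p, q)\<in>?S m. f p * (\<Sum>(r, s)\<in>?S q. g r * h s))"
      by (simp add: case_prod_unfold sum_distrib_left)
    finally show "(\<Sum>(p, q)\<in>?S m. (\<Sum>(r, s)\<in>?S p. f r * g s) * h q)
      = (\<Sum>(p, q)\<in>?S m. f p * (\<Sum>(r, s)\<in>?S q. g r * h s))" .
  qed
  show "(0 :: ('a, 'b) mps) \<noteq> 1"
    by transfer (metis zero_neq_one)
qed

end

definition const_mps :: "'c \<Rightarrow> ('v, 'c :: comm_ring_1) mps" where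
  "const_mps c = Abs_mps (\<lambda>m. if m = 0 then c else 0)"

definition monom_mps :: "('v \<Rightarrow>\<^sub>0 nat) \<Rightarrow> ('v, 'c :: comm_ring_1) mps" where
  "monom_mps m0 = Abs_mps (\<lambda>m. if m = m0 then 1 else 0)"

definition var_mps :: "'v \<Rightarrow> ('v, 'c :: comm_ring_1) mps" where
  "var_mps v = monom_mps (Poly_Mapping.single v 1)"

definition map_mps :: "('c \<Rightarrow> 'd) \<Rightarrow> ('v, 'c) mps \<Rightarrow> ('v, 'd) mps" where
  "map_mps g f = Abs_mps (\<lambda>m. g (coeff_mps f m))"

text \<open>Infinite sums are taken coefficientwise. Below they are only applied to families in which
  every monomial occurs in finitely many members.\<close>

definition formal_sum :: "('i \<Rightarrow> ('v, 'c :: comm_ring_1) mps) \<Rightarrow> 'i set \<Rightarrow> ('v, 'c) mps" where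
  "formal_sum F I =
     Abs_mps (\<lambda>m. \<Sum>i \<in> {i \<in> I. coeff_mps (F i) m \<noteq> 0}. coeff_mps (F i) m)"

text \<open>Infinite products are limits of the finite partial products: each coefficient is the value
  that is eventually attained.\<close>

definition formal_prod :: "('i \<Rightarrow> ('v, 'c :: comm_ring_1) mps) \<Rightarrow> 'i set \<Rightarrow> ('v, 'c) mps" where
  "formal_prod F I = Abs_mps (\<lambda>m. THE c.
     eventually (\<lambda>S. coeff_mps (\<Prod>i\<in>S. F i) m = c) (finite_subsets_at_top I))"

definition inverse_mps :: "('v, 'c :: comm_ring_1) mps \<Rightarrow> ('v, 'c) mps" where
  "inverse_mps f = (THE g. f * g = 1)"

definition poly_eval ::
  "('c \<Rightarrow> 'd) \<Rightarrow> ('v \<Rightarrow> 'd) \<Rightarrow> (('v \<Rightarrow>\<^sub>0 nat) \<Rightarrow>\<^sub>0 'c :: zero) \<Rightarrow> 'd :: comm_ring_1" where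
  "poly_eval h v F = (\<Sum>m \<in> Poly_Mapping.keys F. h (Poly_Mapping.lookup F m) * (\<Prod>i \<in> Poly_Mapping.keys m. v i ^ Poly_Mapping.lookup m i))"


section \<open>The ring \<open>\<rat>[a]\<close> and the divided differences\<close>

type_synonym qa = "(int \<Rightarrow>\<^sub>0 nat) \<Rightarrow>\<^sub>0 rat"

definition const_qa :: "rat \<Rightarrow> qa" where
  "const_qa c = Poly_Mapping.single 0 c"

definition a_var :: "int \<Rightarrow> qa" where
  "a_var i = Poly_Mapping.single (Poly_Mapping.single i 1) 1"

definition alpha :: "int \<Rightarrow> qa" where
  "alpha i = a_var i - a_var (i + 1)"

definition swap_a :: "int \<Rightarrow> qa \<Rightarrow> qa" where
  "swap_a i = poly_eval const_qa (\<lambda>j. a_var (transpose i (i + 1) j))"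

definition divdiff :: "int \<Rightarrow> qa \<Rightarrow> qa" where
  "divdiff i f = (THE q. alpha i * q = f - swap_a i f)"


section \<open>Partitions\<close>

typedef partition = "{ps :: nat list. sorted_wrt (\<ge>) ps \<and> 0 \<notin> set ps}"
  morphisms parts_of Abs_partition
  by (rule exI[of _ "[]"]) simp

definition len :: "partition \<Rightarrow> nat" where
  "len lam = length (parts_of lam)"

text \<open>Parts are numbered from 1, with \<open>part lam i = 0\<close> beyond the length.\<close>

definition part :: "partition \<Rightarrow> nat \<Rightarrow> nat" where
  "part lam i = (if 1 \<le> i \<and> i \<le> len lam then parts_of lam ! (i - 1) else 0)"

definition conj_part :: "partition \<Rightarrow> nat \<Rightarrow> nat" where
  "conj_part lam j = card {i. 1 \<le> i \<and> i \<le> len lam \<and> j \<le> part lam i}"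


section \<open>Symmetric functions in \<open>y\<^sub>0, y\<^sub>-\<^sub>1, \<dots>\<close>\<close>

text \<open>Variables \<open>y\<^sub>k\<close> are indexed by integers; only those with \<open>k \<le> 0\<close> are ever used.\<close>

definition p_y :: "nat \<Rightarrow> (int, rat) mps" where
  "p_y k = formal_sum (\<lambda>i. var_mps i ^ k) {..0}"

definition h_y :: "int \<Rightarrow> (int, rat) mps" where
  "h_y r = formal_sum monom_mps {m. Poly_Mapping.keys m \<subseteq> {..0} \<and> int (\<Sum>i \<in> Poly_Mapping.keys m. Poly_Mapping.lookup m i) = r}"

text \<open>Schur functions by the Jacobi--Trudi determinant \<open>det (h\<^bsub>\<lambda>\<^sub>i-i+j\<^esub>)\<close>, with rows and columns
  numbered from 0, as in the definition of the double Schur functions below.\<close>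

definition schur_y :: "partition \<Rightarrow> (int, rat) mps" where
  "schur_y lam = det (mat (len lam) (len lam)
     (\<lambda>(i, j). h_y (int (part lam (i + 1)) - int i + int j)))"

definition schur_hat :: "partition \<Rightarrow> (int, qa) mps" where
  "schur_hat lam = map_mps const_qa (schur_y lam)"

definition schur_series :: "(partition \<Rightarrow> qa) \<Rightarrow> (int, qa) mps" where
  "schur_series c = formal_sum (\<lambda>lam. const_mps (c lam) * schur_hat lam) UNIV"

definition Lambda_hat :: "(int, qa) mps set" where
  "Lambda_hat = range schur_series"


section \<open>The algebra \<open>\<Lambda>(x\<parallel>a)\<close> and double Schur functions\<close>

datatype xa_var = X int | A int

definition embed_qa :: "qa \<Rightarrow> (xa_var, rat) mps" where
  "embed_qa = poly_eval const_mps (\<lambda>i. var_mps (A i))"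

definition p_xa :: "nat \<Rightarrow> (xa_var, rat) mps" where
  "p_xa k = formal_sum (\<lambda>i. var_mps (X i) ^ k - var_mps (A i) ^ k) {..0}"

inductive_set Lambda_xa :: "(xa_var, rat) mps set" where
  coeff: "embed_qa c \<in> Lambda_xa"
| gen: "k \<ge> 1 \<Longrightarrow> p_xa k \<in> Lambda_xa"
| add: "f \<in> Lambda_xa \<Longrightarrow> g \<in> Lambda_xa \<Longrightarrow> f + g \<in> Lambda_xa"
| mult: "f \<in> Lambda_xa \<Longrightarrow> g \<in> Lambda_xa \<Longrightarrow> f * g \<in> Lambda_xa"

text \<open>The image \<open>f(x/a)\<close> of a symmetric function \<open>f\<close>: write \<open>f\<close> as the unique rational polynomial
  \<open>F\<close> in the power sums and substitute \<open>p\<^sub>k \<mapsto> p\<^sub>k(x\<parallel>a)\<close>. Variable number \<open>n\<close> of \<open>F\<close> stands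
  for \<open>p\<^bsub>n+1\<^esub>\<close>, since \<open>p\<^sub>0\<close> is not a symmetric function.\<close>

definition at_x_over_a :: "(int, rat) mps \<Rightarrow> (xa_var, rat) mps" where
  "at_x_over_a f = poly_eval const_mps (\<lambda>n. p_xa (Suc n))
     (THE F. poly_eval const_mps (\<lambda>n. p_y (Suc n)) F = f)"

text \<open>The substitution \<open>a\<^sub>i \<mapsto> a\<^bsub>i+1\<^esub>\<close>, defined on all series by renaming variables. It sends
  \<open>p\<^sub>k(x\<parallel>a)\<close> to \<open>p\<^sub>k(x\<parallel>a) - a\<^sub>1\<^sup>k\<close>; the lemmas below show that on \<open>\<Lambda>(x\<parallel>a)\<close> it is the only ring
  homomorphism over \<open>\<rat>\<close> with these values on generators.\<close>

fun shift_var :: "xa_var \<Rightarrow> xa_var" where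
  "shift_var (X i) = X i"
| "shift_var (A i) = A (i + 1)"

definition gamma :: "(xa_var, rat) mps \<Rightarrow> (xa_var, rat) mps" where
  "gamma f = Abs_mps (\<lambda>m. coeff_mps f (Poly_Mapping.map_key shift_var m))"

definition gamma_pow :: "int \<Rightarrow> (xa_var, rat) mps \<Rightarrow> (xa_var, rat) mps" where
  "gamma_pow k = (if 0 \<le> k then gamma ^^ nat k else (inv_into UNIV gamma) ^^ nat (- k))"

lemma shift_var_inj: "inj shift_var"
proof (rule injI)
  fix u v assume "shift_var u = shift_var v"
  then show "u = v" by (cases u; cases v) auto
qed

lemma shift_var_surj: "surj shift_var"
proof (rule surjI)
  fix v
  show "shift_var (case v of X i \<Rightarrow> X i | A i \<Rightarrow> A (i - 1)) = v" by (cases v) auto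
qed

lemma coeff_gamma: "coeff_mps (gamma f) m = coeff_mps f (Poly_Mapping.map_key shift_var m)"
  by (simp add: gamma_def Abs_mps_inverse)

lemma lookup_map_shift:
  "Poly_Mapping.lookup (Poly_Mapping.map_key shift_var m) i = Poly_Mapping.lookup m (shift_var i)"
  by (simp add: map_key.rep_eq shift_var_inj)

lemma bij_map_shift: "bij (Poly_Mapping.map_key shift_var :: _ \<Rightarrow> xa_var \<Rightarrow>\<^sub>0 nat)"
proof (rule bijI)
  show "inj (Poly_Mapping.map_key shift_var :: _ \<Rightarrow> xa_var \<Rightarrow>\<^sub>0 nat)"
  proof (rule injI)
    fix m n :: "xa_var \<Rightarrow>\<^sub>0 nat"
    assume e: "Poly_Mapping.map_key shift_var m = Poly_Mapping.map_key shift_var n"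
    show "m = n"
    proof (rule poly_mapping_eqI)
      fix v
      obtain u where "v = shift_var u" using shift_var_surj by (metis surjD)
      then show "Poly_Mapping.lookup m v = Poly_Mapping.lookup n v"
        using e lookup_map_shift by metis
    qed
  qed
  show "surj (Poly_Mapping.map_key shift_var :: _ \<Rightarrow> xa_var \<Rightarrow>\<^sub>0 nat)"
  proof (rule surjI)
    fix m :: "xa_var \<Rightarrow>\<^sub>0 nat"
    have i: "inj (inv_into UNIV shift_var)" using shift_var_surj by (rule surj_imp_inj_inv)
    show "Poly_Mapping.map_key shift_var (Poly_Mapping.map_key (inv_into UNIV shift_var) m) = m"
      by (rule poly_mapping_eqI)
        (simp add: lookup_map_shift map_key.rep_eq i inv_f_f[OF shift_var_inj])
  qed
qed

lemma map_shift_add: "Poly_Mapping.map_key shift_var (m + n) =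
    Poly_Mapping.map_key shift_var m + Poly_Mapping.map_key shift_var n" for m n :: "xa_var \<Rightarrow>\<^sub>0 nat"
  by (rule poly_mapping_eqI) (simp add: lookup_map_shift lookup_add)

lemma map_shift_eq_iff: "Poly_Mapping.map_key shift_var m = Poly_Mapping.map_key shift_var n \<longleftrightarrow> m = n"
  for m n :: "xa_var \<Rightarrow>\<^sub>0 nat"
  using bij_map_shift by (auto simp: bij_def inj_eq)

lemma map_shift_zero: "Poly_Mapping.map_key shift_var (0 :: xa_var \<Rightarrow>\<^sub>0 nat) = 0"
  by (rule poly_mapping_eqI) (simp add: lookup_map_shift)

lemma map_shift_single: "Poly_Mapping.map_key shift_var m = Poly_Mapping.single v k
    \<longleftrightarrow> m = Poly_Mapping.single (shift_var v) k" for m :: "xa_var \<Rightarrow>\<^sub>0 nat"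
proof -
  have "Poly_Mapping.map_key shift_var (Poly_Mapping.single (shift_var v) k) = Poly_Mapping.single v k"
    by (rule poly_mapping_eqI)
      (simp add: lookup_map_shift lookup_single when_def inj_eq[OF shift_var_inj])
  then show ?thesis by (metis map_shift_eq_iff)
qed

lemma gamma_add: "gamma (f + g) = gamma f + gamma g"
  by (rule mps_eqI) (simp add: coeff_gamma plus_mps.rep_eq)

lemma gamma_diff: "gamma (f - g) = gamma f - gamma g"
  by (rule mps_eqI) (simp add: coeff_gamma minus_mps.rep_eq)

lemma gamma_mult: "gamma (f * g) = gamma f * gamma g"
proof (rule mps_eqI)
  fix m
  let ?k = "Poly_Mapping.map_key shift_var :: _ \<Rightarrow> xa_var \<Rightarrow>\<^sub>0 nat"
  have kinv: "?k (inv_into UNIV ?k p) = p" "inv_into UNIV ?k (?k p) = p" for p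
    using bij_map_shift by (auto simp: bij_def surj_f_inv_f)
  have "coeff_mps (gamma (f * g)) m =
      (\<Sum>(p, q)\<in>{(p, q). p + q = ?k m}. coeff_mps f p * coeff_mps g q)"
    by (simp add: coeff_gamma times_mps.rep_eq)
  also have "\<dots> = (\<Sum>(p, q)\<in>{(p, q). p + q = m}. coeff_mps f (?k p) * coeff_mps g (?k q))"
  proof (rule sum.reindex_bij_witness[of _ "map_prod ?k ?k" "map_prod (inv_into UNIV ?k) (inv_into UNIV ?k)"], goal_cases)
    case (2 x)
    then obtain p q where x: "x = (p, q)" "p + q = ?k m" by auto
    have "?k (inv_into UNIV ?k p + inv_into UNIV ?k q) = ?k m" by (simp add: map_shift_add kinv x)
    then show ?case by (simp add: x map_shift_eq_iff)
  next
    case (4 x)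
    then show ?case by (auto simp: map_shift_add)
  qed (auto simp: kinv map_shift_add)
  also have "\<dots> = coeff_mps (gamma f * gamma g) m"
    by (simp add: coeff_gamma times_mps.rep_eq)
  finally show "coeff_mps (gamma (f * g)) m = coeff_mps (gamma f * gamma g) m" .
qed

lemma gamma_const: "gamma (const_mps c) = const_mps c"
proof (rule mps_eqI)
  fix m :: "xa_var \<Rightarrow>\<^sub>0 nat"
  have "Poly_Mapping.map_key shift_var m = 0 \<longleftrightarrow> m = 0"
    using map_shift_eq_iff[of m 0] by (simp add: map_shift_zero)
  then show "coeff_mps (gamma (const_mps c)) m = coeff_mps (const_mps c) m"
    by (simp add: coeff_gamma const_mps_def Abs_mps_inverse)
qed

lemma gamma_one: "gamma 1 = 1"
proof -
  have "(1 :: (xa_var, rat) mps) = const_mps 1"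
    by (rule mps_eqI) (simp add: one_mps.rep_eq const_mps_def Abs_mps_inverse)
  then show ?thesis by (metis gamma_const)
qed

lemma gamma_power: "gamma (f ^ k) = gamma f ^ k"
  by (induction k) (simp_all add: gamma_one gamma_mult)

lemma gamma_var: "gamma (var_mps v) = var_mps (shift_var v)"
  by (rule mps_eqI)
    (simp add: coeff_gamma var_mps_def monom_mps_def Abs_mps_inverse map_shift_single)

lemma bij_gamma: "bij gamma"
proof (rule bijI)
  let ?k = "Poly_Mapping.map_key shift_var :: _ \<Rightarrow> xa_var \<Rightarrow>\<^sub>0 nat"
  have kinv: "?k (inv_into UNIV ?k p) = p" "inv_into UNIV ?k (?k p) = p" for p
    using bij_map_shift by (auto simp: bij_def surj_f_inv_f)
  show "inj gamma"
    by (rule injI, rule mps_eqI) (metis coeff_gamma kinv(1))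
  show "surj gamma"
    by (rule surjI[of _ "\<lambda>f. Abs_mps (\<lambda>m. coeff_mps f (inv_into UNIV ?k m))"], rule mps_eqI)
      (simp add: coeff_gamma Abs_mps_inverse kinv)
qed

lemma var_power: "var_mps v ^ k = monom_mps (Poly_Mapping.single v k)"
proof (induction k)
  case 0
  show ?case
    by (rule mps_eqI) (simp add: one_mps.rep_eq monom_mps_def Abs_mps_inverse)
next
  case (Suc k)
  have "monom_mps p * monom_mps q = (monom_mps (p + q) :: ('a, 'b) mps)" for p q
  proof (rule mps_eqI)
    fix m
    have "coeff_mps (monom_mps p * monom_mps q :: ('a, 'b) mps) m
        = (\<Sum>x\<in>{(r, s). r + s = m}. if x = (p, q) then 1 else 0)"
      unfolding times_mps.rep_eq
      by (rule sum.cong) (auto simp: monom_mps_def Abs_mps_inverse split: if_splits)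
    also have "\<dots> = (if (p, q) \<in> {(r, s). r + s = m} then 1 else 0)"
      by (simp add: sum.delta finite_splits)
    finally show "coeff_mps (monom_mps p * monom_mps q :: ('a, 'b) mps) m = coeff_mps (monom_mps (p + q)) m"
      by (auto simp: monom_mps_def Abs_mps_inverse)
  qed
  then show ?case
    unfolding power_Suc Suc by (simp add: var_mps_def single_add[symmetric])
qed

lemma single_eq_iff_pos:
  "k \<ge> 1 \<Longrightarrow> Poly_Mapping.single u k = Poly_Mapping.single v (k :: nat) \<longleftrightarrow> u = v"
  by (metis lookup_single_eq lookup_single_not_eq not_one_le_zero)

lemma coeff_p_xa:
  assumes "k \<ge> 1"
  shows "coeff_mps (p_xa k) m =
    (if \<exists>i\<le>0. m = Poly_Mapping.single (X i) k then 1 else 0)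
    - (if \<exists>i\<le>0. m = Poly_Mapping.single (A i) k then 1 else 0)"
proof -
  let ?x = "\<lambda>i. Poly_Mapping.single (X i) k" and ?a = "\<lambda>i. Poly_Mapping.single (A i) k"
  let ?c = "\<lambda>i. (if m = ?x i then 1 else 0) - (if m = ?a i then 1 else 0) :: rat"
  have xa: "?x i \<noteq> ?a j" for i j by (simp add: single_eq_iff_pos[OF assms])
  have xx: "?x i = ?x j \<longleftrightarrow> i = j" and aa: "?a i = ?a j \<longleftrightarrow> i = j" for i j
    by (simp_all add: single_eq_iff_pos[OF assms])
  have "coeff_mps (p_xa k) m = (\<Sum>i \<in> {i \<in> {..0}. ?c i \<noteq> 0}. ?c i)"
    by (simp add: p_xa_def formal_sum_def Abs_mps_inverse var_power minus_mps.rep_eq monom_mps_def)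
  also have "\<dots> = (if \<exists>i\<le>0. m = ?x i then 1 else 0) - (if \<exists>i\<le>0. m = ?a i then 1 else 0)"
  proof (cases "\<exists>i\<le>0. m = ?x i")
    case True
    then obtain j where j: "j \<le> 0" "m = ?x j" by auto
    have "{i \<in> {..0}. ?c i \<noteq> 0} = {j}" using j xa xx by auto
    then show ?thesis using j xa xx by auto
  next
    case nx: False
    show ?thesis
    proof (cases "\<exists>i\<le>0. m = ?a i")
      case True
      then obtain j where j: "j \<le> 0" "m = ?a j" by auto
      have na: "m \<noteq> ?x i" for i using j xa by metis
      have "{i \<in> {..0}. ?c i \<noteq> 0} = {j}" using j aa na by auto
      moreover have "?c j = - 1" using j na by simp
      ultimately have "(\<Sum>i \<in> {i \<in> {..0}. ?c i \<noteq> 0}. ?c i) = - 1" by simp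
      then show ?thesis using nx True by simp
    next
      case False
      have "?c i = 0" if "i \<in> {..0}" for i using nx False that by auto
      then have "{i \<in> {..0}. ?c i \<noteq> 0} = {}" by blast
      then have "(\<Sum>i \<in> {i \<in> {..0}. ?c i \<noteq> 0}. ?c i) = 0" by simp
      then show ?thesis using nx False by simp
    qed
  qed
  finally show ?thesis .
qed

lemma embed_a_var: "embed_qa (a_var j) = var_mps (A j)"
proof -
  have "(1 :: (xa_var, rat) mps) = const_mps 1"
    by (rule mps_eqI) (simp add: one_mps.rep_eq const_mps_def Abs_mps_inverse)
  then show ?thesis by (simp add: embed_qa_def poly_eval_def a_var_def lookup_single)
qed

lemma gamma_a: "gamma (embed_qa (a_var i)) = embed_qa (a_var (i + 1))"
  by (simp add: embed_a_var gamma_var)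

lemma gamma_p:
  assumes "k \<ge> 1"
  shows "gamma (p_xa k) = p_xa k - embed_qa (a_var 1) ^ k"
proof (rule mps_eqI)
  fix m
  have "(\<exists>i\<le>0. m = Poly_Mapping.single (A (i + 1)) k) \<longleftrightarrow>
      (\<exists>i\<le>0. m = Poly_Mapping.single (A i) k) \<or> m = Poly_Mapping.single (A 1) k" (is "?L \<longleftrightarrow> ?R")
  proof
    assume ?L
    then obtain i where "i \<le> 0" "m = Poly_Mapping.single (A (i + 1)) k" by auto
    then show ?R
      by (cases "i = 0") (auto intro!: exI[of _ "i + 1"])
  next
    assume ?R
    then show ?L
    proof
      assume "\<exists>i\<le>0. m = Poly_Mapping.single (A i) k"
      then obtain i where "i \<le> 0" "m = Poly_Mapping.single (A i) k" by auto
      then show ?L by (intro exI[of _ "i - 1"]) auto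
    next
      assume "m = Poly_Mapping.single (A 1) k"
      then show ?L by (intro exI[of _ 0]) auto
    qed
  qed
  moreover have "\<not> ((\<exists>i\<le>0. m = Poly_Mapping.single (A i) k) \<and> m = Poly_Mapping.single (A 1) k)"
    by (auto simp: single_eq_iff_pos[OF assms])
  ultimately show "coeff_mps (gamma (p_xa k)) m = coeff_mps (p_xa k - embed_qa (a_var 1) ^ k) m"
    by (auto simp: coeff_gamma coeff_p_xa[OF assms] map_shift_single embed_a_var var_power
        minus_mps.rep_eq monom_mps_def Abs_mps_inverse)
qed

lemma gamma_unique:
  assumes add: "\<And>f g. f \<in> Lambda_xa \<Longrightarrow> g \<in> Lambda_xa \<Longrightarrow> \<phi> (f + g) = \<phi> f + \<phi> g"
    and mult: "\<And>f g. f \<in> Lambda_xa \<Longrightarrow> g \<in> Lambda_xa \<Longrightarrow> \<phi> (f * g) = \<phi> f * \<phi> g"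
    and const: "\<And>c. \<phi> (const_mps c) = const_mps c"
    and a: "\<And>i. \<phi> (embed_qa (a_var i)) = embed_qa (a_var (i + 1))"
    and p: "\<And>k. k \<ge> 1 \<Longrightarrow> \<phi> (p_xa k) = p_xa k - embed_qa (a_var 1) ^ k"
    and f: "f \<in> Lambda_xa"
  shows "\<phi> f = gamma f"
proof -
  let ?G = "{f \<in> Lambda_xa. \<phi> f = gamma f}"
  have c0: "const_mps 0 = (0 :: (xa_var, rat) mps)" "const_mps 1 = (1 :: (xa_var, rat) mps)"
    by (rule mps_eqI; simp add: zero_mps.rep_eq one_mps.rep_eq const_mps_def Abs_mps_inverse)+
  have "const_mps c \<in> Lambda_xa" for c
  proof -
    have "embed_qa (const_qa c) = const_mps c"
      by (cases "c = 0") (simp_all add: embed_qa_def poly_eval_def const_qa_def c0)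
    then show ?thesis by (metis Lambda_xa.coeff)
  qed
  then have cG: "const_mps c \<in> ?G" for c by (simp add: const gamma_const)
  have addG: "f + g \<in> ?G" if "f \<in> ?G" "g \<in> ?G" for f g
    using that by (simp add: Lambda_xa.add add gamma_add)
  have multG: "f * g \<in> ?G" if "f \<in> ?G" "g \<in> ?G" for f g
    using that by (simp add: Lambda_xa.mult mult gamma_mult)
  have aG: "var_mps (A i) \<in> ?G" for i
    using a[of i] gamma_a[of i] Lambda_xa.coeff[of "a_var i"] by (simp add: embed_a_var)
  have powG: "f ^ k \<in> ?G" if "f \<in> ?G" for f k
    using that cG[of 1] multG by (induction k) (simp_all only: c0 power.simps)
  have prodG: "(\<Prod>i\<in>I. t i) \<in> ?G" if "finite I" "\<And>i. t i \<in> ?G" for I and t :: "int \<Rightarrow> _"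
    using that cG[of 1] multG
    by (induction I rule: finite_induct) (simp_all only: c0 prod.empty prod.insert not_False_eq_True)
  have sumG: "(\<Sum>i\<in>I. t i) \<in> ?G" if "finite I" "\<And>i. t i \<in> ?G" for I and t :: "(int \<Rightarrow>\<^sub>0 nat) \<Rightarrow> _"
    using that cG[of 0] addG
    by (induction I rule: finite_induct) (simp_all only: c0 sum.empty sum.insert not_False_eq_True)
  have embG: "embed_qa c \<in> ?G" for c
    unfolding embed_qa_def poly_eval_def
    by (intro sumG multG cG prodG powG aG) simp_all
  from f have "f \<in> ?G"
  proof induction
    case (gen k)
    then show ?case by (simp add: Lambda_xa.gen p gamma_p)
  next
    case (coeff c)
    show ?case by (rule embG)
  next
    case (add f g)
    show ?case by (rule addG[OF add.IH])
  next
    case (mult f g)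
    show ?case by (rule multG[OF mult.IH])
  qed
  then show ?thesis by simp
qed

text \<open>The functions \<open>h\<^sub>r(x\<parallel>a) = \<gamma>\<^bsup>r-1\<^esup> h\<^sub>r(x/a)\<close>, vanishing for \<open>r < 0\<close>.\<close>

definition h_xa :: "int \<Rightarrow> (xa_var, rat) mps" where
  "h_xa r = gamma_pow (r - 1) (at_x_over_a (h_y r))"

text \<open>Rows and columns are numbered from 0, so the power \<open>\<gamma>\<^bsup>1-j\<^esup>\<close> for the \<open>j\<close>-th column becomes
  \<open>\<gamma>\<^bsup>-j\<^esup>\<close>.\<close>

definition double_schur :: "partition \<Rightarrow> (xa_var, rat) mps" where
  "double_schur lam = det (mat (len lam) (len lam)
     (\<lambda>(i, j). gamma_pow (- int j) (h_xa (int (part lam (i + 1)) - int i + int j))))"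


section \<open>The pairing and the dual Schur functions\<close>

text \<open>The functions \<open>s\<^sub>\<lambda>(x/a)\<close> form a \<open>\<rat>[a]\<close>-basis of \<open>\<Lambda>(x\<parallel>a)\<close>, whereas arbitrary
  families of coefficients are allowed for the \<open>s\<^sub>\<lambda>(y)\<close>.\<close>

definition xa_coords :: "(xa_var, rat) mps \<Rightarrow> partition \<Rightarrow> qa" where
  "xa_coords f = (THE d. finite {lam. d lam \<noteq> 0} \<and>
     f = (\<Sum>lam \<in> {lam. d lam \<noteq> 0}. embed_qa (d lam) * at_x_over_a (schur_y lam)))"

definition hat_coords :: "(int, qa) mps \<Rightarrow> partition \<Rightarrow> qa" where
  "hat_coords g = (THE c. g = schur_series c)"

definition pairing :: "(xa_var, rat) mps \<Rightarrow> (int, qa) mps \<Rightarrow> qa" where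
  "pairing f g = (\<Sum>lam \<in> {lam. xa_coords f lam \<noteq> 0}. xa_coords f lam * hat_coords g lam)"

definition dual_schur :: "partition \<Rightarrow> (int, qa) mps" where
  "dual_schur mu = (THE g. g \<in> Lambda_hat \<and>
     (\<forall>lam. pairing (double_schur lam) g = (if lam = mu then 1 else 0)))"


section \<open>The operators \<open>\<delta>\<^sub>w\<close>\<close>

definition Omega :: "(int, qa) mps" where
  "Omega = formal_prod
     (\<lambda>k. (1 - const_mps (a_var 0) * var_mps k)
          * inverse_mps (1 - const_mps (a_var 1) * var_mps k)) {..0}"

text \<open>Since the \<open>s\<^sub>\<lambda>(y)\<close> have rational coefficients, acting on the coefficients \<open>c\<^sub>\<lambda>\<close> of
  \<open>\<Sum>\<^sub>\<lambda> c\<^sub>\<lambda> s\<^sub>\<lambda>(y)\<close> amounts to acting on the coefficients of the monomials in \<open>y\<close>.\<close>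

definition delta :: "int \<Rightarrow> (int, qa) mps \<Rightarrow> (int, qa) mps" where
  "delta i f = (if i = 0
     then (THE g. const_mps (alpha 0) * g = f - Omega * map_mps (swap_a 0) f)
     else map_mps (divdiff i) f)"

definition delta_word :: "int list \<Rightarrow> (int, qa) mps \<Rightarrow> (int, qa) mps" where
  "delta_word is = foldr delta is"

definition word_perm :: "int list \<Rightarrow> int \<Rightarrow> int" where
  "word_perm is = foldr (\<lambda>i w. transpose i (i + 1) \<circ> w) is id"

definition reduced_word :: "int list \<Rightarrow> (int \<Rightarrow> int) \<Rightarrow> bool" where
  "reduced_word is w \<longleftrightarrow> word_perm is = w \<and> (\<forall>js. word_perm js = w \<longrightarrow> length is \<le> length js)"

text \<open>The common value of \<open>\<delta>\<^bsub>i\<^sub>1\<^esub> \<dots> \<delta>\<^bsub>i\<^sub>\<ell>\<^esub> f\<close> over all reduced words of \<open>w\<close>; it is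
  unspecified unless there is a reduced word and all of them give the same result.\<close>

definition delta_perm :: "(int \<Rightarrow> int) \<Rightarrow> (int, qa) mps \<Rightarrow> (int, qa) mps" where
  "delta_perm w f = (THE g. {delta_word is f | is. reduced_word is w} = {g})"

definition w_part :: "partition \<Rightarrow> int \<Rightarrow> int" where
  "w_part lam i = (if i \<le> 0 then i + int (part lam (nat (1 - i)))
                   else i - int (conj_part lam (nat i)))"

end

theory Submission
  imports Defs "HOL-Computational_Algebra.Formal_Power_Series"
begin

text \<open>For \<open>n\<close> large, the pairing of \<open>s\<^sub>\<kappa>(x\<parallel>a)\<close> with a symmetric series \<open>g(y)\<close> is the constant term in
  \<open>n\<close> variables \<open>u\<^sub>k = 1/y\<^sub>k\<close> of \<open>\<Prod>\<^sub>k (u\<^sub>k|a)\<^bsup>\<kappa>\<^sub>k-k\<^esup> u\<^sub>k\<^sup>n\<close> times the Vandermonde determinant times \<open>g\<close>,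
  where \<open>(u|a)\<^sup>l\<close> are the factorial powers, \<open>(u|a)\<^sup>l = (u|a)\<^bsup>l-1\<^esup> (u - a\<^sub>l)\<close>; these numbers determine
  \<open>g\<close>. The exchange of \<open>a\<^sub>i\<close> and \<open>a\<^bsub>i+1\<^esub>\<close> fixes \<open>(u|a)\<^sup>l\<close> for \<open>l \<noteq> i\<close> and adds
  \<open>\<alpha>\<^sub>i (u|a)\<^bsup>i-1\<^esup>\<close> to \<open>(u|a)\<^sup>i\<close>; for \<open>i = 0\<close> this holds up to the factor \<open>(u - a\<^sub>0)/(u - a\<^sub>1)\<close>, which is
  what \<open>\<Omega>\<close> compensates. Hence the twisted exchange turns \<open>s\<^sub>\<kappa>(x\<parallel>a)\<close> into itself plus \<open>\<alpha>\<^sub>i\<close> times the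
  double Schur function of \<open>\<kappa>\<close> with its box of content \<open>i\<close> removed (if there is one), and dually
  \<open>\<delta>\<^sub>i\<close> takes the dual Schur function of \<open>\<mu>\<close> to that of \<open>\<lambda>\<close> whenever \<open>\<lambda>\<close> arises from \<open>\<mu>\<close> by adding a
  box of content \<open>i\<close>. Every reduced word of \<open>w\<^sub>\<lambda>\<close>, read from right to left, builds \<open>\<lambda>\<close> from the empty
  partition in this way, so the braid relations are not needed.\<close>

section \<open>Monomial power series\<close>

text \<open>Origin of the constant term: in the determinant for s_\<kappa>(x||a) the column shift
  and the shift inside h_r add up to a power of \<gamma> that depends on the row only, with exponent
  \<kappa>_i - i. On the generating series of the h_r(x/a), \<gamma>^l acts as multiplication by
  \<open>rfac l\<close>, so expanding row by row writes s_\<kappa>(x||a) as a combination of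
  determinants in the h_r(x/a). Pairing such a determinant with g extracts one coefficient of g
  times the Vandermonde determinant, by the bialternant formula. The obstacle is that pairing, dual
  Schur functions and operators are given by definite descriptions, each of which needs existence
  and uniqueness. Coordinates are unique since the s_\<nu>(x/a) are independent over Q[a] and
  coefficients separate the s_\<nu>(y); dual functions exist since the constant terms 1 of the
  \<open>rfac\<close> make the pairing unitriangular. Divisibility by \<alpha>_i is never examined:
  \<alpha>_i times the new dual function is shown to be the difference to be divided, by comparing
  constant terms for all large n.\<close>

abbreviation lookup :: "('v \<Rightarrow>\<^sub>0 'c :: zero) \<Rightarrow> 'v \<Rightarrow> 'c" where
  "lookup \<equiv> Poly_Mapping.lookup"

abbreviation keys :: "('v \<Rightarrow>\<^sub>0 'c :: zero) \<Rightarrow> 'v set" where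
  "keys \<equiv> Poly_Mapping.keys"

abbreviation single :: "'v \<Rightarrow> 'c \<Rightarrow> 'v \<Rightarrow>\<^sub>0 'c :: zero" where
  "single \<equiv> Poly_Mapping.single"

abbreviation map_key :: "('v \<Rightarrow> 'w) \<Rightarrow> ('w \<Rightarrow>\<^sub>0 'c :: zero) \<Rightarrow> 'v \<Rightarrow>\<^sub>0 'c" where
  "map_key \<equiv> Poly_Mapping.map_key"

lemma coeff_Abs_mps [simp]: "coeff_mps (Abs_mps f) m = f m"
  by (simp add: Abs_mps_inverse)

lemma coeff_mps_zero [simp]: "coeff_mps 0 m = 0"
  by (simp add: zero_mps.rep_eq)

lemma coeff_mps_one: "coeff_mps 1 m = (if m = 0 then 1 else 0)"
  by (simp add: one_mps.rep_eq)

lemma coeff_mps_add [simp]: "coeff_mps (f + g) m = coeff_mps f m + coeff_mps g m"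
  by (simp add: plus_mps.rep_eq)

lemma coeff_mps_diff [simp]: "coeff_mps (f - g) m = coeff_mps f m - coeff_mps g m"
  by (simp add: minus_mps.rep_eq)

lemma coeff_mps_uminus [simp]: "coeff_mps (- f) m = - coeff_mps f m"
  by (simp add: uminus_mps.rep_eq)

lemma coeff_mps_mult:
  "coeff_mps (f * g) m = (\<Sum>(p, q)\<in>{(p, q). p + q = m}. coeff_mps f p * coeff_mps g q)"
  by (simp add: times_mps.rep_eq)

lemma coeff_mps_sum [simp]: "coeff_mps (sum f I) m = (\<Sum>i\<in>I. coeff_mps (f i) m)"
  by (induction I rule: infinite_finite_induct) auto

lemma coeff_const_mps: "coeff_mps (const_mps c) m = (if m = 0 then c else 0)"
  by (simp add: const_mps_def)

lemma coeff_const_mps_mult [simp]: "coeff_mps (const_mps c * f) m = c * coeff_mps f m"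
  for f :: "('v, 'c :: comm_ring_1) mps"
proof -
  have "coeff_mps (const_mps c * f) m
      = (\<Sum>(p, q)\<in>{(0, m)}. coeff_mps (const_mps c :: ('v, 'c) mps) p * coeff_mps f q)"
    unfolding coeff_mps_mult
    by (rule sum.mono_neutral_right[OF finite_splits]) (auto simp: coeff_const_mps split: if_splits)
  then show ?thesis by (simp add: coeff_const_mps)
qed

lemma const_mps_0 [simp]: "const_mps 0 = 0"
  by (rule mps_eqI) (simp add: coeff_const_mps)

lemma const_mps_1 [simp]: "const_mps 1 = 1"
  by (rule mps_eqI) (simp add: coeff_const_mps coeff_mps_one)

lemma coeff_monom_mps: "coeff_mps (monom_mps p) m = (if m = p then 1 else 0)"
  by (simp add: monom_mps_def)

lemma coeff_map_mps [simp]: "coeff_mps (map_mps \<phi> f) m = \<phi> (coeff_mps f m)"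
  by (simp add: map_mps_def)

lemma comm_ring_homI:
  fixes h :: "'a :: comm_ring_1 \<Rightarrow> 'b :: comm_ring_1"
  assumes "h 1 = 1" "\<And>x y. h (x + y) = h x + h y" "\<And>x y. h (x * y) = h x * h y"
  shows "comm_ring_hom h"
proof -
  have "h 0 = 0" using assms(2)[of 0 0] by simp
  then show ?thesis using assms by unfold_locales auto
qed

lemma const_mps_hom: "comm_ring_hom const_mps"
  by (rule comm_ring_homI) (auto intro!: mps_eqI simp: coeff_const_mps)

section \<open>Degrees and homogeneous series\<close>

definition mdeg :: "('v \<Rightarrow>\<^sub>0 nat) \<Rightarrow> nat" where
  "mdeg m = (\<Sum>i\<in>keys m. lookup m i)"

lemma mdeg_superset:
  "finite I \<Longrightarrow> keys m \<subseteq> I \<Longrightarrow> mdeg m = (\<Sum>i\<in>I. lookup m i)"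
  unfolding mdeg_def by (rule sum.mono_neutral_left) (auto simp: in_keys_iff)

lemma keys_add_nat: "keys (p + q) = keys p \<union> keys q"
  for p q :: "'v \<Rightarrow>\<^sub>0 nat"
  by (auto simp: in_keys_iff lookup_add)

lemma keys_eq_empty_nat: "keys m = {} \<longleftrightarrow> m = 0" for m :: "'v \<Rightarrow>\<^sub>0 nat"
  by (metis keys_zero empty_iff in_keys_iff poly_mapping_eqI lookup_zero)

lemma mdeg_add: "mdeg (p + q) = mdeg p + mdeg q"
proof -
  let ?A = "keys p \<union> keys q"
  show ?thesis
    by (simp add: mdeg_superset[of ?A] keys_add_nat lookup_add sum.distrib)
qed

lemma mdeg_0 [simp]: "mdeg 0 = 0"
  by (simp add: mdeg_def)

lemma mdeg_single [simp]: "mdeg (single i k) = k"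
  by (simp add: mdeg_def)

lemma mdeg_eq_0_iff: "mdeg m = 0 \<longleftrightarrow> m = 0"
  by (auto simp: mdeg_def in_keys_iff intro!: poly_mapping_eqI)

definition homog :: "nat \<Rightarrow> ('v, 'c :: comm_ring_1) mps \<Rightarrow> bool" where
  "homog d f \<longleftrightarrow> (\<forall>m. coeff_mps f m \<noteq> 0 \<longrightarrow> mdeg m = d)"

lemma homog_0: "homog d 0"
  by (simp add: homog_def)

lemma homog_add: "homog d f \<Longrightarrow> homog d g \<Longrightarrow> homog d (f + g)"
  unfolding homog_def by (metis add.right_neutral coeff_mps_add)

lemma homog_mult:
  assumes "homog d f" "homog e g"
  shows "homog (d + e) (f * g)"
  unfolding homog_def
proof (intro allI impI)
  fix m assume "coeff_mps (f * g) m \<noteq> 0"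
  then obtain p q where "p + q = m" "coeff_mps f p * coeff_mps g q \<noteq> 0"
    unfolding coeff_mps_mult by (auto elim: sum.not_neutral_contains_not_neutral)
  moreover from this have "coeff_mps f p \<noteq> 0" "coeff_mps g q \<noteq> 0" by auto
  ultimately show "mdeg m = d + e" using assms by (auto simp: homog_def mdeg_add)
qed

lemma homog_sum: "(\<And>i. i \<in> I \<Longrightarrow> homog d (f i)) \<Longrightarrow> homog d (sum f I)"
  by (induction I rule: infinite_finite_induct) (auto simp: homog_0 homog_add)

lemma homog_1: "homog 0 1"
  by (auto simp: homog_def coeff_mps_one)

lemma homog_prod: "finite I \<Longrightarrow> (\<And>i. i \<in> I \<Longrightarrow> homog (d i) (f i)) \<Longrightarrow> homog (sum d I) (prod f I)"
  by (induction I rule: finite_induct) (auto simp: homog_1 homog_mult)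

section \<open>Homomorphisms between series rings: restriction, base change, renaming, one-variable
  substitution\<close>

definition res :: "'v set \<Rightarrow> ('v, 'c :: comm_ring_1) mps \<Rightarrow> ('v, 'c) mps" where
  "res V f = Abs_mps (\<lambda>m. if keys m \<subseteq> V then coeff_mps f m else 0)"

lemma coeff_res: "coeff_mps (res V f) m = (if keys m \<subseteq> V then coeff_mps f m else 0)"
  by (simp add: res_def)

text \<open>\<open>res V\<close> sets the variables outside \<open>V\<close> to zero. A product of
  monomials lies in the variables \<open>V\<close> exactly when both factors do, so no cross terms
  are lost.\<close>

lemma res_hom: "comm_ring_hom (res V)"
proof (rule comm_ring_homI)
  show "res V (f * g) = res V f * res V g" for f g :: "('a, 'b) mps"
  proof (rule mps_eqI)
    fix m
    have "coeff_mps (res V f * res V g) m = (\<Sum>x\<in>{(p, q). p + q = m}.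
        if keys m \<subseteq> V then coeff_mps f (fst x) * coeff_mps g (snd x) else 0)"
      unfolding coeff_mps_mult
      by (rule sum.cong) (auto simp: coeff_res keys_add_nat split: if_splits)
    then show "coeff_mps (res V (f * g)) m = coeff_mps (res V f * res V g) m"
      by (simp add: coeff_res coeff_mps_mult case_prod_unfold)
  qed
qed (auto intro!: mps_eqI simp: coeff_res coeff_mps_one)

lemma map_mps_hom:
  assumes "comm_ring_hom \<phi>"
  shows "comm_ring_hom (map_mps \<phi>)"
proof -
  interpret comm_ring_hom \<phi> by (rule assms)
  show ?thesis
  proof (rule comm_ring_homI)
    show "map_mps \<phi> (f * g) = map_mps \<phi> f * map_mps \<phi> g" for f g :: "('c, 'a) mps"
      by (rule mps_eqI) (simp add: coeff_mps_mult hom_sum hom_mult case_prod_unfold)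
  qed (auto intro!: mps_eqI simp: coeff_mps_one hom_add)
qed

text \<open>Substitution of the variable \<pi> v for v: the coefficient at m is read off at the
  exponent vector pulled back along \<pi>. For bijective \<pi> this is a ring homomorphism.\<close>

definition ren :: "('v \<Rightarrow> 'w) \<Rightarrow> ('v, 'c :: comm_ring_1) mps \<Rightarrow> ('w, 'c) mps" where
  "ren \<pi> f = Abs_mps (\<lambda>m. coeff_mps f (map_key \<pi> m))"

lemma coeff_ren: "coeff_mps (ren \<pi> f) m = coeff_mps f (map_key \<pi> m)"
  by (simp add: ren_def)

lemma bij_map_key:
  assumes "bij \<pi>"
  shows "map_key \<pi> (map_key (Hilbert_Choice.inv \<pi>) n) = n"
    and "map_key (Hilbert_Choice.inv \<pi>) (map_key \<pi> m) = m"
  using assms bij_imp_bij_inv[OF assms]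
  by (auto intro!: poly_mapping_eqI simp: map_key.rep_eq bij_is_inj bij_is_surj surj_f_inv_f)

lemma map_key_bij_eq_0_iff:
  assumes "bij \<pi>"
  shows "map_key \<pi> (m :: 'b \<Rightarrow>\<^sub>0 nat) = 0 \<longleftrightarrow> m = 0"
proof
  assume "map_key \<pi> m = 0"
  then have "map_key (Hilbert_Choice.inv \<pi>) (map_key \<pi> m) = 0"
    using bij_is_inj[OF bij_imp_bij_inv[OF assms]] by simp
  then show "m = 0" by (simp add: bij_map_key[OF assms])
qed (simp add: bij_is_inj[OF assms])

lemma ren_hom:
  assumes "bij \<pi>"
  shows "comm_ring_hom (ren \<pi>)"
proof (rule comm_ring_homI)
  let ?k = "map_key \<pi> :: ('b \<Rightarrow>\<^sub>0 nat) \<Rightarrow> _"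
  let ?l = "map_key (Hilbert_Choice.inv \<pi>) :: ('a \<Rightarrow>\<^sub>0 nat) \<Rightarrow> _"
  note inj = bij_is_inj[OF assms] bij_is_inj[OF bij_imp_bij_inv[OF assms]]
  show "ren \<pi> 1 = (1 :: ('b, 'c) mps)"
    by (rule mps_eqI) (simp add: coeff_ren coeff_mps_one map_key_bij_eq_0_iff[OF assms])
  show "ren \<pi> (f * g) = ren \<pi> f * ren \<pi> g" for f g :: "('a, 'c) mps"
  proof (rule mps_eqI)
    fix m
    show "coeff_mps (ren \<pi> (f * g)) m = coeff_mps (ren \<pi> f * ren \<pi> g) m"
      unfolding coeff_mps_mult coeff_ren
      by (rule sum.reindex_bij_witness[of _ "map_prod ?k ?k" "map_prod ?l ?l"])
         (auto simp: bij_map_key[OF assms] map_key_plus[OF inj(1)] map_key_plus[OF inj(2), symmetric])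
  qed
qed (auto intro!: mps_eqI simp: coeff_ren)

lemma ren_const: "bij \<pi> \<Longrightarrow> ren \<pi> (const_mps c) = const_mps c"
  by (rule mps_eqI) (simp add: coeff_ren coeff_const_mps map_key_bij_eq_0_iff)

text \<open>The one-variable series \<open>F\<close> evaluated at the variable \<open>k\<close>.
  Factorial powers and the factors of \<Omega> are treated as one-variable series and only then
  moved to several variables.\<close>

definition emb :: "'v \<Rightarrow> 'c fps \<Rightarrow> ('v, 'c :: comm_ring_1) mps" where
  "emb k F = Abs_mps (\<lambda>m. if keys m \<subseteq> {k} then fps_nth F (lookup m k) else 0)"

lemma coeff_emb: "coeff_mps (emb k F) m =
    (if keys m \<subseteq> {k} then fps_nth F (lookup m k) else 0)"
  by (simp add: emb_def)

lemma keys_subset_single: "keys m \<subseteq> {k} \<longleftrightarrow> m = single k (lookup m k)"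
  by (auto intro!: poly_mapping_eqI simp: lookup_single when_def in_keys_iff)
     (metis in_keys_iff lookup_single_not_eq)

lemma single_add_minus:
  fixes m :: "'v \<Rightarrow>\<^sub>0 nat"
  assumes "k \<le> lookup m i"
  shows "single i k + (m - single i k) = m"
proof (rule poly_mapping_eqI)
  fix j
  show "lookup (single i k + (m - single i k)) j = lookup m j"
    using assms by (cases "j = i") (auto simp: lookup_add lookup_minus lookup_single)
qed

lemma coeff_emb_mult: "coeff_mps (emb k F * g) m =
    (\<Sum>s\<le>lookup m k. fps_nth F s * coeff_mps g (m - single k s))"
proof -
  let ?c = "\<lambda>s. (single k s, m - single k s)"
  have "coeff_mps (emb k F * g) m =
      (\<Sum>(p, q)\<in>?c ` {..lookup m k}. coeff_mps (emb k F) p * coeff_mps g q)"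
    unfolding coeff_mps_mult
  proof (rule sum.mono_neutral_right[OF finite_splits], goal_cases)
    case 1
    show ?case using single_add_minus by auto
  next
    case 2
    show ?case
    proof
      fix x assume x: "x \<in> {(p, q). p + q = m} - ?c ` {..lookup m k}"
      obtain p q where pq: "x = (p, q)" "p + q = m" using x by auto
      have "\<not> keys p \<subseteq> {k}"
      proof
        assume "keys p \<subseteq> {k}"
        then have "p = single k (lookup p k)" by (simp add: keys_subset_single)
        then have "x = ?c (lookup p k)" using pq by auto
        moreover have "lookup p k \<le> lookup m k"
          using pq by (auto simp: lookup_add)
        ultimately show False using x by auto
      qed
      then show "(case x of (p, q) \<Rightarrow> coeff_mps (emb k F) p * coeff_mps g q) = 0"
        using pq by (simp add: coeff_emb)
    qed
  qed
  also have "\<dots> = (\<Sum>s\<le>lookup m k. fps_nth F s * coeff_mps g (m - single k s))"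
    by (subst sum.reindex) (auto intro!: inj_onI simp: coeff_emb keys_subset_single dest: arg_cong[of _ _ "\<lambda>p. lookup p k"])
  finally show ?thesis .
qed

lemma emb_const [simp]: "emb k (fps_const c) = const_mps c"
  by (rule mps_eqI) (auto simp: coeff_emb coeff_const_mps keys_subset_single in_keys_iff)

lemma emb_hom: "comm_ring_hom (emb k :: 'b :: comm_ring_1 fps \<Rightarrow> ('a, 'b) mps)"
proof (rule comm_ring_homI)
  show "emb k 1 = (1 :: ('a, 'b) mps)"
    using emb_const[of k "1 :: 'b"] by simp
  show "emb k (F * G) = emb k F * emb k G" for F G :: "'b fps"
  proof (rule mps_eqI)
    fix m :: "'a \<Rightarrow>\<^sub>0 nat"
    have "keys (m - single k s) \<subseteq> {k} \<longleftrightarrow> keys m \<subseteq> {k}" for s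
      by (auto simp: in_keys_iff lookup_minus lookup_single when_def subset_iff)
    then show "coeff_mps (emb k (F * G)) m = coeff_mps (emb k F * emb k G) m"
      by (simp add: coeff_emb_mult coeff_emb lookup_minus fps_mult_nth atLeast0AtMost)
  qed
qed (auto intro!: mps_eqI simp: coeff_emb)

lemma emb_X [simp]: "emb k fps_X = var_mps k"
  by (rule mps_eqI) (auto simp: coeff_emb var_mps_def coeff_monom_mps keys_subset_single)

lemma res_emb: "res V (emb k F) = (if k \<in> V then emb k F else const_mps (fps_nth F 0))"
proof (rule mps_eqI)
  fix m :: "'a \<Rightarrow>\<^sub>0 nat"
  have "keys m \<subseteq> {k} \<Longrightarrow> k \<notin> V \<Longrightarrow> keys m \<subseteq> V \<longleftrightarrow> m = 0"
    using keys_eq_empty_nat[of m] by (auto simp: subset_singleton_iff)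
  then show "coeff_mps (res V (emb k F)) m = coeff_mps (if k \<in> V then emb k F else const_mps (fps_nth F 0)) m"
    by (auto simp: coeff_res coeff_emb coeff_const_mps)
qed

lemma map_mps_emb: "\<phi> 0 = 0 \<Longrightarrow> map_mps \<phi> (emb k F) = emb k (Abs_fps (\<lambda>n. \<phi> (fps_nth F n)))"
  by (rule mps_eqI) (simp add: coeff_emb)

lemma keys_map_key_bij: "bij \<pi> \<Longrightarrow> keys (map_key \<pi> m) = \<pi> -` keys m"
  by (simp add: keys_map_key bij_is_inj)

lemma lookup_map_key_bij: "bij \<pi> \<Longrightarrow> lookup (map_key \<pi> m) i = lookup m (\<pi> i)"
  by (simp add: map_key.rep_eq bij_is_inj)

lemma ren_emb:
  assumes "bij \<pi>"
  shows "ren \<pi> (emb k F) = emb (\<pi> k) F"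
proof (rule mps_eqI)
  fix m :: "'b \<Rightarrow>\<^sub>0 nat"
  have "\<pi> -` keys m \<subseteq> {k} \<longleftrightarrow> keys m \<subseteq> {\<pi> k}"
    using bij_is_inj[OF assms] bij_is_surj[OF assms] by (auto simp: subset_iff inj_eq) (metis surjD)
  then show "coeff_mps (ren \<pi> (emb k F)) m = coeff_mps (emb (\<pi> k) F) m"
    using assms by (simp add: coeff_ren coeff_emb keys_map_key_bij lookup_map_key_bij)
qed

lemma mdeg_map_key:
  assumes "bij \<pi>"
  shows "mdeg (map_key \<pi> m) = mdeg m"
proof -
  have "(\<Sum>i\<in>\<pi> -` keys m. lookup m (\<pi> i)) = (\<Sum>i\<in>keys m. lookup m i)"
    by (rule sum.reindex_bij_witness[of _ "Hilbert_Choice.inv \<pi>" \<pi>])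
       (use assms in \<open>auto simp: bij_is_inj bij_is_surj surj_f_inv_f\<close>)
  then show ?thesis
    by (simp add: mdeg_def keys_map_key_bij[OF assms] lookup_map_key_bij[OF assms])
qed

section \<open>Partitions and reduced words\<close>

lemma part_Suc: "part lam (Suc i) = (if i < len lam then parts_of lam ! i else 0)"
  by (auto simp: part_def)

lemma part_pos: "i < len lam \<Longrightarrow> 0 < part lam (Suc i)"
  using parts_of[of lam] by (auto simp: part_Suc len_def intro!: gr0I) (metis nth_mem)

lemma part_eq_0_iff: "part lam (Suc i) = 0 \<longleftrightarrow> len lam \<le> i"
  using part_pos[of i lam] by (auto simp: part_Suc not_less)

lemma part_antimono: "i \<le> j \<Longrightarrow> part lam (Suc j) \<le> part lam (Suc i)"
  using parts_of[of lam] sorted_wrt_nth_less[of "(\<ge>)" "parts_of lam" i j]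
  by (cases "i = j") (auto simp: part_Suc len_def)

lemma partition_eqI:
  assumes "\<And>i. part lam (Suc i) = part mu (Suc i)"
  shows "lam = mu"
proof -
  have "len lam \<le> i \<longleftrightarrow> len mu \<le> i" for i
    using assms by (metis part_eq_0_iff)
  then have l: "len lam = len mu"
    by (metis le_antisym order_refl)
  have "parts_of lam = parts_of mu"
    by (rule nth_equalityI) (use assms l in \<open>auto simp: len_def part_Suc split: if_splits\<close>, metis len_def)
  then show ?thesis by (simp add: parts_of_inject)
qed

lemma partition_exists:
  assumes mono: "\<And>i. f (Suc i) \<le> f i" and z: "f n = (0 :: nat)"
  shows "\<exists>lam. \<forall>i. part lam (Suc i) = f i"
proof -
  define L where "L = (LEAST l. f l = 0)"
  have L0: "f L = 0" unfolding L_def using z by (rule LeastI)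
  have anti: "i \<le> j \<Longrightarrow> f j \<le> f i" for i j
    using lift_Suc_antimono_le[of f] mono by blast
  have pos: "f i \<noteq> 0" if "i < L" for i
    using that unfolding L_def by (rule not_less_Least)
  have zero: "f i = 0" if "L \<le> i" for i
    using anti[OF that] L0 by simp
  let ?ps = "map f [0..<L]"
  have "?ps \<in> {ps. sorted_wrt (\<ge>) ps \<and> 0 \<notin> set ps}"
    using pos by (force simp: sorted_wrt_iff_nth_less intro: anti)
  then have "parts_of (Abs_partition ?ps) = ?ps" by (rule Abs_partition_inverse)
  then have "\<forall>i. part (Abs_partition ?ps) (Suc i) = f i"
    using zero by (auto simp: part_Suc len_def)
  then show ?thesis by blast
qed

definition psize :: "partition \<Rightarrow> nat" where
  "psize lam = (\<Sum>i<len lam. part lam (Suc i))"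

lemma psize_superset: "len lam \<le> N \<Longrightarrow> psize lam = (\<Sum>i<N. part lam (Suc i))"
  unfolding psize_def by (rule sum.mono_neutral_left) (auto simp: part_eq_0_iff)

lemma len_le_psize: "len lam \<le> psize lam"
proof -
  have "(\<Sum>i<len lam. 1) \<le> psize lam"
    unfolding psize_def by (rule sum_mono) (simp add: Suc_leI part_pos)
  then show ?thesis by simp
qed

lemma psize_sum_list: "psize lam = sum_list (parts_of lam)"
  by (simp add: psize_def sum_list_sum_nth part_Suc len_def atLeast0LessThan)

lemma finite_psize_le: "finite {lam. psize lam \<le> d}"
proof -
  have "parts_of ` {lam. psize lam \<le> d} \<subseteq> {xs. set xs \<subseteq> {..d} \<and> length xs \<le> d}"
    using len_le_psize by (auto simp: psize_sum_list len_def intro: order_trans[OF member_le_sum_list])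
       (meson le_trans)
  then have "finite (parts_of ` {lam. psize lam \<le> d})"
    by (rule finite_subset) (rule finite_lists_length_le, simp)
  then show ?thesis
    by (rule finite_imageD) (auto simp: inj_on_def parts_of_inject)
qed

lemma psize_0_iff: "psize lam = 0 \<longleftrightarrow> (\<forall>i. part lam (Suc i) = 0)"
proof
  assume "psize lam = 0"
  then have "len lam = 0" using len_le_psize[of lam] by simp
  then show "\<forall>i. part lam (Suc i) = 0" by (simp add: part_eq_0_iff)
qed (simp add: psize_def)

lemma empty_partition_exists: "\<exists>lam. psize lam = 0"
  using partition_exists[of "\<lambda>_. 0" 0] by (simp add: psize_0_iff)

lemma psize_0_unique: "psize lam = 0 \<Longrightarrow> psize mu = 0 \<Longrightarrow> lam = mu"
  by (rule partition_eqI) (simp add: psize_0_iff)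

definition add_box :: "partition \<Rightarrow> nat \<Rightarrow> partition \<Rightarrow> bool" where
  "add_box mu j lam \<longleftrightarrow> (\<forall>i. part lam (Suc i) = part mu (Suc i) + (if i = j then 1 else 0))"

lemma add_box_psize:
  assumes "add_box mu j lam"
  shows "psize lam = psize mu + 1"
proof -
  let ?N = "len lam + len mu + j + 1"
  show ?thesis
    using assms psize_superset[of lam ?N] psize_superset[of mu ?N]
    by (simp add: add_box_def sum.distrib)
qed

lemma add_box_exists:
  assumes "j = 0 \<or> part mu (Suc j) < part mu j"
  shows "\<exists>lam. add_box mu j lam"
proof -
  let ?f = "\<lambda>i. part mu (Suc i) + (if i = j then 1 else 0)"
  have "?f (Suc i) \<le> ?f i" for i
    using assms part_antimono[of i "Suc i" mu] by auto
  moreover have "?f (len mu + j + 1) = 0"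
    by (simp add: part_eq_0_iff)
  ultimately show ?thesis
    unfolding add_box_def by (rule partition_exists)
qed

lemma remove_box_exists:
  assumes "0 < psize lam"
  shows "\<exists>mu j. add_box mu j lam"
proof -
  let ?j = "len lam - 1"
  let ?f = "\<lambda>i. part lam (Suc i) - (if i = ?j then 1 else 0)"
  have "len lam \<noteq> 0" using assms by (metis lessThan_0 less_irrefl psize_def sum.empty)
  then have "0 < part lam (Suc ?j)" by (intro part_pos) auto
  moreover have "?f (Suc i) \<le> ?f i" for i
    using part_antimono[of i "Suc i" lam] part_eq_0_iff[of lam "Suc i"] by auto
  moreover have "?f (len lam) = 0" by (simp add: part_Suc)
  ultimately obtain mu where "\<forall>i. part mu (Suc i) = ?f i"
    using partition_exists[of ?f] by blast
  then have "add_box mu ?j lam"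
    using \<open>0 < part lam (Suc ?j)\<close> by (auto simp: add_box_def)
  then show ?thesis by blast
qed

text \<open>By strong induction: once the earlier values agree, both i-th values are the largest
  element of the common image not yet taken.\<close>

lemma strict_dec_image_eq:
  fixes f g :: "nat \<Rightarrow> 'a :: linorder"
  assumes f: "\<And>i j. i < j \<Longrightarrow> j < n \<Longrightarrow> f j < f i"
    and g: "\<And>i j. i < j \<Longrightarrow> j < n \<Longrightarrow> g j < g i"
    and im: "f ` {..<n} = g ` {..<n}"
  shows "i < n \<Longrightarrow> f i = g i"
proof (induction i rule: less_induct)
  case (less i)
  \<comment> \<open>Stated for arbitrary sequences so that it can be used with the roles of f and g
    exchanged.\<close>
  have le: "f' i \<le> g' i"
    if im': "f' ` {..<n} = g' ` {..<n}" and eq: "\<And>k. k < i \<Longrightarrow> f' k = g' k"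
      and f': "\<And>i j. i < j \<Longrightarrow> j < n \<Longrightarrow> f' j < f' i"
      and g': "\<And>i j. i < j \<Longrightarrow> j < n \<Longrightarrow> g' j < g' i"
    for f' g' :: "nat \<Rightarrow> 'a"
  proof -
    have "f' i \<in> g' ` {..<n}" using im' less.prems by blast
    then obtain k where k: "k < n" "f' i = g' k" by auto
    have "\<not> k < i"
      using eq[of k] f'[of k i] k less.prems by auto
    then show ?thesis
      using g'[of i k] k by (cases "k = i") auto
  qed
  have "k < i \<Longrightarrow> f k = g k" for k using less by simp
  then show ?case
    using le[of f g] le[of g f] im f g by (simp add: order.antisym)
qed

lemma w_part_nonpos: "w_part lam (- int a) = int (part lam (Suc a)) - int a"
proof -
  have "nat (1 - (- int a)) = Suc a" by simp
  then show ?thesis by (simp add: w_part_def)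
qed

lemma w_part_strict_nonpos: "a < b \<Longrightarrow> w_part lam (- int b) < w_part lam (- int a)"
  using part_antimono[of a b lam] by (simp add: w_part_nonpos)

lemma w_part_inj_nonpos: "w_part lam (- int a) = w_part lam (- int b) \<longleftrightarrow> a = b"
  using w_part_strict_nonpos[of a b lam] w_part_strict_nonpos[of b a lam]
  by (cases a b rule: linorder_cases) auto

lemma conj_part_eq: "1 \<le> c \<Longrightarrow> conj_part lam c = card {i. c \<le> part lam (Suc i)}"
proof -
  assume c: "1 \<le> c"
  have "{i. 1 \<le> i \<and> i \<le> len lam \<and> c \<le> part lam i} = Suc ` {i. c \<le> part lam (Suc i)}"
  proof (intro equalityI subsetI)
    fix i assume "i \<in> {i. 1 \<le> i \<and> i \<le> len lam \<and> c \<le> part lam i}"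
    then show "i \<in> Suc ` {i. c \<le> part lam (Suc i)}" by (cases i) auto
  next
    fix i assume "i \<in> Suc ` {i. c \<le> part lam (Suc i)}"
    then show "i \<in> {i. 1 \<le> i \<and> i \<le> len lam \<and> c \<le> part lam i}"
      using c part_eq_0_iff[of lam "i - 1"] by force
  qed
  then show ?thesis by (simp add: conj_part_def card_image)
qed

lemma finite_column: "1 \<le> c \<Longrightarrow> finite {i. c \<le> part lam (Suc i)}"
  by (rule finite_subset[of _ "{..<len lam}"]) (auto simp: part_Suc split: if_splits)

lemma w_part_pos: "1 \<le> c \<Longrightarrow> w_part lam (int c) = int c - int (card {i. c \<le> part lam (Suc i)})"
  by (simp add: w_part_def conj_part_eq)

lemma w_part_strict_pos: "1 \<le> c \<Longrightarrow> c < d \<Longrightarrow> w_part lam (int c) < w_part lam (int d)"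
proof -
  assume "1 \<le> c" "c < d"
  moreover from this have "card {i. d \<le> part lam (Suc i)} \<le> card {i. c \<le> part lam (Suc i)}"
    by (intro card_mono finite_column) auto
  ultimately show ?thesis by (simp add: w_part_pos)
qed

lemma w_part_inj_pos: "1 \<le> c \<Longrightarrow> 1 \<le> d \<Longrightarrow> w_part lam (int c) = w_part lam (int d) \<longleftrightarrow> c = d"
  using w_part_strict_pos[of c d lam] w_part_strict_pos[of d c lam]
  by (cases c d rule: linorder_cases) auto

text \<open>The new box changes the value at position -j from i to i + 1 and the value at its column
  from i + 1 to i. At all other positions the values for mu and lam agree, and injectivity on the
  nonpositive and on the positive positions keeps them away from i and i + 1.\<close>

lemma w_part_add_box:
  assumes ab: "add_box mu j lam" and i: "i = int (part mu (Suc j)) - int j"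
  shows "w_part lam = transpose i (i + 1) \<circ> w_part mu"
proof
  fix p :: int
  have lam: "part lam (Suc k) = part mu (Suc k) + (if k = j then 1 else 0)" for k
    using ab by (simp add: add_box_def)
  show "w_part lam p = (transpose i (i + 1) \<circ> w_part mu) p"
  proof (cases "p \<le> 0")
    case True
    define a where "a = nat (- p)"
    have p: "p = - int a" using True by (simp add: a_def)
    show ?thesis
    proof (cases "a = j")
      case True
      then show ?thesis by (simp add: p w_part_nonpos lam i)
    next
      case False
      have "w_part mu (- int a) \<noteq> w_part mu (- int j)" "w_part lam (- int a) \<noteq> w_part lam (- int j)"
        using False by (simp_all add: w_part_inj_nonpos)
      then show ?thesis using False by (auto simp: p w_part_nonpos lam i transpose_def)
    qed
  next
    case False
    define c where "c = nat p"
    have p: "p = int c" "1 \<le> c" using False by (auto simp: c_def)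
    \<comment> \<open>The column of the new box, counted from 1.\<close>
    define c0 where "c0 = Suc (part mu (Suc j))"
    have mu0: "{k. c0 \<le> part mu (Suc k)} = {..<j}"
    proof (intro equalityI subsetI)
      fix k assume "k \<in> {k. c0 \<le> part mu (Suc k)}"
      then show "k \<in> {..<j}"
        using part_antimono[of j k mu] by (force simp: c0_def)
    next
      fix k assume "k \<in> {..<j}"
      then show "k \<in> {k. c0 \<le> part mu (Suc k)}"
        using part_antimono[of k j lam] by (simp add: lam c0_def)
    qed
    have "{k. c0 \<le> part lam (Suc k)} = insert j {k. c0 \<le> part mu (Suc k)}"
      by (auto simp: lam c0_def)
    then have lam0: "{k. c0 \<le> part lam (Suc k)} = insert j {..<j}"
      by (simp only: mu0)
    have c01: "1 \<le> c0" by (simp add: c0_def)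
    have "w_part mu (int c0) = int c0 - int j" "w_part lam (int c0) = int c0 - int (Suc j)"
      by (simp_all only: w_part_pos[OF c01] mu0 lam0) simp_all
    then have wmu: "w_part mu (int c0) = i + 1" and wlam: "w_part lam (int c0) = i"
      by (simp_all add: c0_def i)
    show ?thesis
    proof (cases "c = c0")
      case True
      then show ?thesis by (simp add: p wmu wlam)
    next
      case False
      have "{k. c \<le> part lam (Suc k)} = {k. c \<le> part mu (Suc k)}"
        using False by (auto simp: lam c0_def)
      then have eq: "w_part lam (int c) = w_part mu (int c)"
        using p by (simp add: w_part_pos)
      have "w_part mu (int c) \<noteq> w_part mu (int c0)" "w_part lam (int c) \<noteq> w_part lam (int c0)"
        using False w_part_inj_pos[OF p(2) c01] by simp_all
      then have "w_part mu (int c) \<noteq> i + 1" "w_part lam (int c) \<noteq> i"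
        by (simp_all add: wmu wlam)
      then show ?thesis using eq by (simp add: p transpose_def)
    qed
  qed
qed

lemma w_part_empty:
  assumes "psize lam = 0"
  shows "w_part lam = id"
proof
  fix p :: int
  have z: "part lam (Suc i) = 0" for i using assms by (simp add: psize_0_iff)
  show "w_part lam p = id p"
  proof (cases "p \<le> 0")
    case True
    then show ?thesis using w_part_nonpos[of lam "nat (- p)"] z by simp
  next
    case False
    then show ?thesis using w_part_pos[of "nat p" lam] z by simp
  qed
qed

section \<open>Words, their permutations, and reduced words of \<open>w_part lam\<close>\<close>

lemma word_perm_Nil: "word_perm [] = id"
  and word_perm_Cons: "word_perm (i # js) = transpose i (i + 1) \<circ> word_perm js"
  by (simp_all add: word_perm_def)

lemma inj_word_perm: "inj (word_perm js)"
  by (induction js) (simp_all add: word_perm_Nil word_perm_Cons inj_compose del: o_apply)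

text \<open>One letter per box: the partition is built up by adding boxes, and each box contributes
  its content as the new leftmost letter.\<close>

lemma word_of_partition: "\<exists>is. word_perm is = w_part lam \<and> length is = psize lam"
proof (induction "psize lam" arbitrary: lam)
  case 0
  then show ?case by (intro exI[of _ "[]"]) (simp add: word_perm_Nil w_part_empty)
next
  case (Suc d)
  then obtain mu j where ab: "add_box mu j lam"
    using remove_box_exists[of lam] by auto
  then have "d = psize mu" using add_box_psize[OF ab] Suc.hyps(2) by simp
  then obtain js where "word_perm js = w_part mu" "length js = psize mu" using Suc.hyps(1) by blast
  then show ?case
    using w_part_add_box[OF ab refl] add_box_psize[OF ab]
    by (intro exI[of _ "(int (part mu (Suc j)) - int j) # js"]) (simp add: word_perm_Cons)
qed

text \<open>For \<open>w = w\<^sub>\<lambda>\<close> and large \<open>M\<close> the following statistic equals \<open>|\<lambda>|\<close>, while it grows by at most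
  one with every letter of a word.\<close>

definition shift_sum :: "nat \<Rightarrow> int list \<Rightarrow> int" where
  "shift_sum M js = (\<Sum>a\<le>M. word_perm js (- int a) + int a)"

text \<open>Left multiplication by the exchange of i and i + 1 raises the value i and lowers the
  value i + 1; by injectivity each occurs at most once at the positions 0, ..., -M.\<close>

lemma shift_sum_Cons:
  "shift_sum M (i # js) = shift_sum M js
     + (if i \<in> (\<lambda>a. word_perm js (- int a)) ` {..M} then 1 else 0)
     - (if i + 1 \<in> (\<lambda>a. word_perm js (- int a)) ` {..M} then 1 else 0)"
proof -
  let ?w = "\<lambda>a. word_perm js (- int a)"
  have inj: "inj_on ?w {..M}"
  proof (rule inj_onI)
    fix x y assume "?w x = ?w y"
    then have "- int x = - int y" by (rule injD[OF inj_word_perm])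
    then show "x = y" by simp
  qed
  have cnt: "(\<Sum>a\<le>M. if ?w a = x then 1 else 0) = (if x \<in> ?w ` {..M} then 1 else (0 :: int))" for x
  proof -
    have "(\<Sum>a\<le>M. if ?w a = x then 1 else 0) = (\<Sum>v\<in>?w ` {..M}. if v = x then 1 else (0 :: int))"
      by (simp add: sum.reindex[OF inj])
    then show ?thesis by simp
  qed
  have "word_perm (i # js) (- int a) + int a
      = (?w a + int a) + (if ?w a = i then 1 else 0) - (if ?w a = i + 1 then 1 else 0)" for a
    by (simp add: word_perm_Cons transpose_def)
  then show ?thesis
    by (simp add: shift_sum_def sum.distrib sum_subtractf cnt)
qed

lemma shift_sum_le_length: "shift_sum M js \<le> int (length js)"
proof (induction js)
  case Nil
  then show ?case by (simp add: shift_sum_def word_perm_Nil)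
next
  case (Cons i js)
  then show ?case by (simp add: shift_sum_Cons)
qed

lemma shift_sum_w_part:
  assumes "word_perm js = w_part lam" "len lam \<le> Suc M"
  shows "shift_sum M js = int (psize lam)"
  using assms by (simp add: shift_sum_def w_part_nonpos psize_superset[OF assms(2)] lessThan_Suc_atMost)

text \<open>The lower bound is the growth bound on \<open>shift_sum\<close>, the upper bound is the
  word with one letter per box.\<close>

lemma length_reduced_word:
  assumes "reduced_word js (w_part lam)"
  shows "length js = psize lam"
proof -
  have "int (psize lam) \<le> int (length js)"
    using shift_sum_le_length[of "len lam" js] shift_sum_w_part[of js lam "len lam"] assms
    by (simp add: reduced_word_def)
  moreover have "length js \<le> psize lam"
    using word_of_partition[of lam] assms by (metis reduced_word_def)
  ultimately show ?thesis by simp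
qed

lemma reduced_word_exists: "\<exists>js. reduced_word js (w_part lam)"
proof -
  obtain js where js: "word_perm js = w_part lam" "length js = psize lam"
    using word_of_partition by blast
  have "psize lam \<le> length ks" if "word_perm ks = w_part lam" for ks
    using shift_sum_le_length[of "len lam" ks] shift_sum_w_part[OF that, of "len lam"] by simp
  then show ?thesis using js by (auto simp: reduced_word_def)
qed

text \<open>On nonpositive positions \<open>w_part\<close> is strictly decreasing, so the set of its
  values there fixes the values, and with them the parts.\<close>

lemma partition_eq_of_image:
  assumes "(\<lambda>a. w_part lam (- int a)) ` {..M} = (\<lambda>a. w_part mu (- int a)) ` {..M}"
    and "len lam \<le> Suc M" "len mu \<le> Suc M"
  shows "lam = mu"
proof (rule partition_eqI)
  fix i
  show "part lam (Suc i) = part mu (Suc i)"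
  proof (cases "i \<le> M")
    case True
    have "w_part lam (- int i) = w_part mu (- int i)"
      by (rule strict_dec_image_eq[of "Suc M"])
        (use assms(1) True in \<open>auto simp: lessThan_Suc_atMost intro: w_part_strict_nonpos\<close>)
    then show ?thesis by (simp add: w_part_nonpos)
  next
    case False
    then show ?thesis using assms by (simp add: part_Suc)
  qed
qed

text \<open>A reduced word attains the bound \<open>shift_sum_le_length\<close>, and then so does
  every suffix: each letter i finds the value i, but not i + 1, at the positions 0, ..., -M. This
  says that a box of content i can be added to the partition reached so far.\<close>

lemma reduced_word_induct:
  assumes red: "reduced_word js (w_part lam)"
    and base: "\<And>mu. psize mu = 0 \<Longrightarrow> Q [] mu"
    and step: "\<And>i ks mu nu j. Q ks mu \<Longrightarrow> add_box mu j nu \<Longrightarrow> i = int (part mu (Suc j)) - int j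
      \<Longrightarrow> Q (i # ks) nu"
  shows "Q js lam"
proof -
  define M where "M = len lam"
  \<comment> \<open>Only the set of values at 0, ..., -M is followed; in the end it determines the
    partition by \<open>partition_eq_of_image\<close>.\<close>
  have "\<exists>mu. len mu \<le> Suc M \<and> Q ks mu \<and>
      (\<lambda>a. word_perm ks (- int a)) ` {..M} = (\<lambda>a. w_part mu (- int a)) ` {..M}"
    if "shift_sum M ks = int (length ks)" for ks
    using that
  proof (induction ks)
    case Nil
    obtain mu where "psize mu = 0" using empty_partition_exists by blast
    then show ?case
      using base[of mu] w_part_empty[of mu] len_le_psize[of mu]
      by (intro exI[of _ mu]) (simp add: word_perm_Nil)
  next
    case (Cons i ks)
    let ?S = "(\<lambda>a. word_perm ks (- int a)) ` {..M}"
    have iS: "i \<in> ?S" "i + 1 \<notin> ?S" and eq: "shift_sum M ks = int (length ks)"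
      using Cons.prems shift_sum_le_length[of M ks] by (auto simp: shift_sum_Cons split: if_splits)
    then obtain mu where mu: "len mu \<le> Suc M" "Q ks mu" "?S = (\<lambda>a. w_part mu (- int a)) ` {..M}"
      using Cons.IH by blast
    obtain j where j: "j \<le> M" "i = int (part mu (Suc j)) - int j"
      using iS(1) unfolding mu(3) by (auto simp: w_part_nonpos)
    have "j = 0 \<or> part mu (Suc j) < part mu j"
    proof (rule ccontr)
      assume a: "\<not> (j = 0 \<or> part mu (Suc j) < part mu j)"
      then obtain b where b: "j = Suc b" "part mu (Suc b) = part mu (Suc (Suc b))"
        using part_antimono[of "j - 1" j mu] by (cases j) auto
      \<comment> \<open>With equal parts, row b just above row j takes the value one larger.\<close>
      have "w_part mu (- int b) = i + 1"
        unfolding w_part_nonpos by (simp add: j(2) b)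
      moreover have "b \<in> {..M}" using j(1) b(1) by simp
      ultimately have "i + 1 \<in> (\<lambda>a. w_part mu (- int a)) ` {..M}" by (metis imageI)
      then show False using iS(2) unfolding mu(3) by blast
    qed
    then obtain nu where nu: "add_box mu j nu" using add_box_exists by blast
    have "part nu (Suc (Suc M)) = 0"
      using nu j mu(1) part_eq_0_iff[of mu "Suc M"] by (simp add: add_box_def)
    then have "len nu \<le> Suc M" by (simp add: part_eq_0_iff)
    moreover have "(\<lambda>a. word_perm (i # ks) (- int a)) ` {..M} = (\<lambda>a. w_part nu (- int a)) ` {..M}"
      using arg_cong[OF mu(3), of "(`) (transpose i (i + 1))"]
      by (simp add: word_perm_Cons w_part_add_box[OF nu j(2)] image_image)
    ultimately show ?case
      using step[OF mu(2) nu j(2)] by blast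
  qed
  moreover have "shift_sum M js = int (length js)"
    using red shift_sum_w_part[of js lam M] length_reduced_word[OF red]
    by (simp add: M_def reduced_word_def)
  ultimately obtain mu where "len mu \<le> Suc M" "Q js mu"
      "(\<lambda>a. word_perm js (- int a)) ` {..M} = (\<lambda>a. w_part mu (- int a)) ` {..M}"
    by blast
  moreover have "lam = mu"
    by (rule partition_eq_of_image[of _ M]) (use calculation red in \<open>auto simp: M_def reduced_word_def\<close>)
  ultimately show ?thesis by simp
qed

section \<open>Determinants and polynomial evaluation\<close>

definition dt :: "nat \<Rightarrow> (nat \<Rightarrow> nat \<Rightarrow> 'a) \<Rightarrow> 'a :: comm_ring_1" where
  "dt n M = det (mat n n (\<lambda>(i, j). M i j))"

lemma dt_perm: "dt n M = (\<Sum>p | p permutes {0..<n}. signof p * (\<Prod>i = 0..<n. M i (p i)))"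
proof -
  have c: "mat n n (\<lambda>(i, j). M i j) \<in> carrier_mat n n" by simp
  show ?thesis
    unfolding dt_def det_def'[OF c]
    by (intro sum.cong arg_cong2[of _ _ _ _ "(*)"] prod.cong refl)
       (auto dest: permutes_in_image)
qed

lemma dt_cong: "(\<And>i j. i < n \<Longrightarrow> j < n \<Longrightarrow> M i j = N i j) \<Longrightarrow> dt n M = dt n N"
  unfolding dt_def by (rule arg_cong[of _ _ det]) auto

lemma dt_hom:
  assumes "comm_ring_hom h"
  shows "h (dt n M) = dt n (\<lambda>i j. h (M i j))"
proof -
  have "map_mat h (mat n n (\<lambda>(i, j). M i j)) = mat n n (\<lambda>(i, j). h (M i j))" by auto
  then show ?thesis
    using comm_ring_hom.hom_det[OF assms, of "mat n n (\<lambda>(i, j). M i j)"] by (simp add: dt_def)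
qed

lemma dt_permute_rows:
  assumes "p permutes {0..<n}"
  shows "dt n (\<lambda>i. M (p i)) = signof p * dt n M"
proof -
  have "mat n n (\<lambda>(i, j). M (p i) j) = mat n n (\<lambda>(i, j). mat n n (\<lambda>(i, j). M i j) $$ (p i, j))"
    by (rule eq_matI) (use permutes_in_image[OF assms] in auto)
  then show ?thesis
    using det_permute_rows[OF _ assms, of "mat n n (\<lambda>(i, j). M i j)"] by (simp add: dt_def)
qed

lemma dt_permute_cols:
  assumes "p permutes {0..<n}"
  shows "dt n (\<lambda>i j. M i (p j)) = signof p * dt n M"
proof -
  have tr: "dt n (\<lambda>i j. N j i) = dt n N" for N :: "nat \<Rightarrow> nat \<Rightarrow> 'a"
  proof -
    have "transpose_mat (mat n n (\<lambda>(i, j). N i j)) = mat n n (\<lambda>(i, j). N j i)" by auto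
    then show ?thesis
      using det_transpose[of "mat n n (\<lambda>(i, j). N i j)" n] by (simp add: dt_def)
  qed
  show ?thesis
    using dt_permute_rows[OF assms, of "\<lambda>i j. M j i"] tr[of "\<lambda>i j. M i (p j)"] tr[of M] by simp
qed

lemma dt_identical_rows:
  assumes "i < n" "k < n" "i \<noteq> k" "\<And>j. j < n \<Longrightarrow> M i j = M k j"
  shows "dt n M = 0"
  unfolding dt_def
  by (rule det_identical_rows[of _ n i k]) (use assms in \<open>auto simp: row_def\<close>)

lemma dt_mult: "dt n M * dt n N = dt n (\<lambda>i j. \<Sum>k<n. M i k * N k j)"
proof -
  have "mat n n (\<lambda>(i, j). M i j) * mat n n (\<lambda>(i, j). N i j) = mat n n (\<lambda>(i, j). \<Sum>k<n. M i k * N k j)"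
    by (rule eq_matI) (auto simp: scalar_prod_def lessThan_atLeast0)
  then show ?thesis
    using det_mult[of "mat n n (\<lambda>(i, j). M i j)" n "mat n n (\<lambda>(i, j). N i j)"] by (simp add: dt_def)
qed

lemma dt_row_linear:
  assumes k: "k < n"
  shows "dt n (M(k := \<lambda>j. \<Sum>s\<in>S. c s * N s j)) = (\<Sum>s\<in>S. c s * dt n (M(k := N s)))"
proof -
  have exp: "dt n (M(k := r)) =
      (\<Sum>p | p permutes {0..<n}. r (p k) * (signof p * (\<Prod>i\<in>{0..<n} - {k}. M i (p i))))" for r
  proof -
    have "(\<Prod>i = 0..<n. (M(k := r)) i (p i)) = r (p k) * (\<Prod>i\<in>{0..<n} - {k}. M i (p i))" for p
      using k by (subst prod.remove[of _ k]) auto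
    then show ?thesis by (simp add: dt_perm mult.left_commute)
  qed
  show ?thesis
    unfolding exp by (simp add: sum_distrib_right sum_distrib_left mult.assoc sum.swap[of _ S])
qed

text \<open>By expansion along the last row. It makes a Jacobi-Trudi determinant independent of the
  number of zero parts appended: in the row of a zero part, h_r has negative index left of the
  diagonal and index 0 on it.\<close>

lemma dt_stable:
  assumes "l \<le> n" and "\<And>i j. l \<le> i \<Longrightarrow> i < n \<Longrightarrow> j < i \<Longrightarrow> M i j = 0"
    and "\<And>i. l \<le> i \<Longrightarrow> i < n \<Longrightarrow> M i i = 1"
  shows "dt n M = dt l M"
  using assms
proof (induction n rule: dec_induct)
  case (step n)
  let ?A = "mat (Suc n) (Suc n) (\<lambda>(i, j). M i j)"
  have "dt (Suc n) M = (\<Sum>j<Suc n. ?A $$ (n, j) * cofactor ?A n j)"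
    unfolding dt_def by (rule laplace_expansion_row) auto
  also have "\<dots> = (\<Sum>j\<in>{n}. ?A $$ (n, j) * cofactor ?A n j)"
    by (rule sum.mono_neutral_right) (use step in auto)
  also have "\<dots> = dt n M"
  proof -
    have "mat_delete ?A n n = mat n n (\<lambda>(i, j). M i j)"
      by (rule eq_matI) (auto simp: mat_delete_def)
    then show ?thesis using step.prems(2)[of n] step.hyps by (simp add: cofactor_def dt_def)
  qed
  finally show ?case using step by simp
qed simp

lemma dt_unitriangular:
  assumes "\<And>i j. i < n \<Longrightarrow> j < i \<Longrightarrow> M i j = 0" "\<And>i. i < n \<Longrightarrow> M i i = 1"
  shows "dt n M = 1"
  using dt_stable[of 0 n M] assms by (simp add: dt_def)

lemma homog_uminus: "homog d (- f) \<longleftrightarrow> homog d f"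
  by (simp add: homog_def)

lemma homog_signof_mult: "homog d f \<Longrightarrow> homog d (signof p * f)"
  by (simp add: sign_def homog_uminus)

text \<open>Every permutation picks each \<open>e i\<close> and each \<open>c j\<close> once. The
  degrees are integers because Jacobi-Trudi entries of negative degree do occur; they are zero and
  annihilate their product.\<close>

lemma homog_dt:
  fixes e c :: "nat \<Rightarrow> int"
  assumes M: "\<And>i j. i < n \<Longrightarrow> j < n \<Longrightarrow> M i j \<noteq> 0 \<Longrightarrow> 0 \<le> e i + c j \<and> homog (nat (e i + c j)) (M i j)"
    and D: "int D = (\<Sum>i<n. e i) + (\<Sum>j<n. c j)"
  shows "homog D (dt n M)"
  unfolding dt_perm
proof (intro homog_sum homog_signof_mult)
  fix p assume "p \<in> {p. p permutes {0..<n}}"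
  then have p: "p permutes {0..<n}" by simp
  show "homog D (\<Prod>i = 0..<n. M i (p i))"
  proof (cases "\<exists>i<n. M i (p i) = 0")
    case True
    then have "(\<Prod>i = 0..<n. M i (p i)) = 0" by (intro prod_zero) auto
    then show ?thesis by (simp add: homog_0)
  next
    case False
    then have M': "0 \<le> e i + c (p i)" "homog (nat (e i + c (p i))) (M i (p i))" if "i < n" for i
      using M[of i "p i"] permutes_in_image[OF p, of i] that by auto
    have hom: "homog (\<Sum>i = 0..<n. nat (e i + c (p i))) (\<Prod>i = 0..<n. M i (p i))"
      by (rule homog_prod) (use M' in auto)
    have "int (\<Sum>i = 0..<n. nat (e i + c (p i))) = (\<Sum>i = 0..<n. e i + c (p i))"
      unfolding of_nat_sum by (rule sum.cong) (use M' in auto)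
    moreover have "(\<Sum>i = 0..<n. c (p i)) = (\<Sum>i = 0..<n. c i)"
      using sum.permute[OF p, of c] by (simp add: o_def)
    ultimately have "int (\<Sum>i = 0..<n. nat (e i + c (p i))) = int D"
      by (simp only: D sum.distrib lessThan_atLeast0)
    then have "(\<Sum>i = 0..<n. nat (e i + c (p i))) = D"
      by (simp only: of_nat_eq_iff)
    with hom show ?thesis by simp
  qed
qed

section \<open>Evaluation of polynomials as a ring homomorphism\<close>

lemma poly_mapping_sum_single:
  "F = (\<Sum>m\<in>keys F. single m (lookup F m))"
proof (rule poly_mapping_eqI)
  fix m
  have "(\<Sum>x\<in>keys F. lookup F x when x = m) = lookup F m"
    by (cases "m \<in> keys F") (auto simp: when_def in_keys_iff sum.delta)
  then show "lookup F m = lookup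
      (\<Sum>m\<in>keys F. single m (lookup F m)) m"
    by (simp add: lookup_sum lookup_single)
qed

definition monom_eval :: "('v \<Rightarrow> 'd) \<Rightarrow> ('v \<Rightarrow>\<^sub>0 nat) \<Rightarrow> 'd :: comm_ring_1" where
  "monom_eval v m = (\<Prod>i\<in>keys m. v i ^ lookup m i)"

lemma monom_eval_superset:
  "finite I \<Longrightarrow> keys m \<subseteq> I \<Longrightarrow> monom_eval v m = (\<Prod>i\<in>I. v i ^ lookup m i)"
  unfolding monom_eval_def by (rule prod.mono_neutral_left) (auto simp: in_keys_iff)

lemma monom_eval_add: "monom_eval v (p + q) = monom_eval v p * monom_eval v q"
proof -
  let ?I = "keys p \<union> keys q"
  show ?thesis
    by (simp add: monom_eval_superset[of ?I] keys_add_nat lookup_add power_add prod.distrib)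
qed

lemma monom_eval_0 [simp]: "monom_eval v 0 = 1"
  by (simp add: monom_eval_def)

lemma monom_eval_single [simp]: "monom_eval v (single i k) = v i ^ k"
  by (simp add: monom_eval_def)

lemma poly_eval_superset:
  assumes "comm_ring_hom h" "finite I" "keys F \<subseteq> I"
  shows "poly_eval h v F = (\<Sum>m\<in>I. h (lookup F m) * monom_eval v m)"
proof -
  interpret comm_ring_hom h by fact
  show ?thesis
    unfolding poly_eval_def monom_eval_def
    by (rule sum.mono_neutral_left) (use assms in \<open>auto simp: in_keys_iff\<close>)
qed

lemma poly_eval_single:
  assumes "comm_ring_hom h"
  shows "poly_eval h v (single m c) = h c * monom_eval v m"
  using poly_eval_superset[OF assms, of "{m}" "single m c" v] by simp

lemma poly_eval_add:
  assumes "comm_ring_hom h"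
  shows "poly_eval h v (F + G) = poly_eval h v F + poly_eval h v G"
proof -
  interpret comm_ring_hom h by fact
  let ?I = "keys F \<union> keys G"
  have "keys (F + G) \<subseteq> ?I" by (rule keys_add)
  then show ?thesis
    by (simp add: poly_eval_superset[OF assms, of ?I] lookup_add hom_add distrib_right sum.distrib)
qed

lemma poly_eval_sum:
  assumes "comm_ring_hom h"
  shows "poly_eval h v (sum f I) = (\<Sum>i\<in>I. poly_eval h v (f i))"
  by (induction I rule: infinite_finite_induct)
    (simp_all add: poly_eval_add[OF assms], simp_all add: poly_eval_def)

lemma poly_eval_hom:
  assumes h: "comm_ring_hom h"
  shows "comm_ring_hom (poly_eval h v)"
proof (rule comm_ring_homI)
  interpret comm_ring_hom h by fact
  note sum = poly_eval_sum[OF h]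
  show "poly_eval h v 1 = 1"
    using poly_eval_single[OF h, of v 0 1] by simp
  show "poly_eval h v (F + G) = poly_eval h v F + poly_eval h v G" for F G
    by (rule poly_eval_add[OF h])
  show "poly_eval h v (F * G) = poly_eval h v F * poly_eval h v G" for F G
  proof -
    let ?F = "\<lambda>m. single m (lookup F m)"
    let ?G = "\<lambda>m. single m (lookup G m)"
    have FG: "F = sum ?F (keys F)" "G = sum ?G (keys G)"
      by (rule poly_mapping_sum_single)+
    have "F * G = sum ?F (keys F) * sum ?G (keys G)"
      by (rule arg_cong2[OF FG])
    then have "poly_eval h v (F * G) = (\<Sum>m\<in>keys F. \<Sum>n\<in>keys G.
        poly_eval h v (?F m) * poly_eval h v (?G n))"
      by (simp add: sum_product sum mult_single poly_eval_single[OF h] monom_eval_add hom_mult ac_simps)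
    also have "\<dots> = poly_eval h v (sum ?F (keys F)) * poly_eval h v (sum ?G (keys G))"
      by (simp add: sum_product sum)
    finally show ?thesis by (simp only: FG[symmetric])
  qed
qed

lemma hom_poly_eval:
  assumes "comm_ring_hom h" "comm_ring_hom g" "\<And>c. g (k c) = h c" "\<And>i. g (u i) = v i"
    "comm_ring_hom k"
  shows "g (poly_eval k u F) = poly_eval h v F"
proof -
  interpret comm_ring_hom g by fact
  show ?thesis
    using assms by (simp add: poly_eval_def hom_sum hom_mult hom_prod hom_power)
qed

section \<open>Schur functions as quotients of alternants\<close>

lemma monom_mps_mult: "monom_mps p * monom_mps q = (monom_mps (p + q) :: ('v, 'c :: comm_ring_1) mps)"
proof (rule mps_eqI)
  fix m
  have "coeff_mps (monom_mps p * monom_mps q :: ('v, 'c) mps) m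
      = (\<Sum>x\<in>{(r, s). r + s = m}. if x = (p, q) then 1 else 0)"
    unfolding coeff_mps_mult
    by (rule sum.cong) (auto simp: coeff_monom_mps split: if_splits)
  also have "\<dots> = (if (p, q) \<in> {(r, s). r + s = m} then 1 else 0)"
    by (simp add: sum.delta finite_splits)
  finally show "coeff_mps (monom_mps p * monom_mps q :: ('v, 'c) mps) m = coeff_mps (monom_mps (p + q)) m"
    by (auto simp: coeff_monom_mps)
qed

lemma monom_mps_0: "monom_mps 0 = 1"
  by (rule mps_eqI) (simp add: coeff_monom_mps coeff_mps_one)

lemma prod_monom_mps: "(\<Prod>i\<in>I. monom_mps (f i)) = monom_mps (sum f I)"
  by (induction I rule: infinite_finite_induct) (simp_all add: monom_mps_0 monom_mps_mult)

lemma coeff_var_mult: "coeff_mps (var_mps l * g) m =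
    (if 1 \<le> lookup m l then coeff_mps g (m - single l 1) else 0)"
proof -
  let ?N = "lookup m l"
  have "coeff_mps (var_mps l * g) m =
      (\<Sum>s\<le>?N. fps_nth fps_X s * coeff_mps g (m - single l s))"
    using coeff_emb_mult[of l fps_X g m] by simp
  also have "\<dots> = (\<Sum>s\<in>{..?N} \<inter> {1}. fps_nth fps_X s * coeff_mps g (m - single l s))"
    by (rule sum.mono_neutral_right) (auto simp: fps_X_def)
  finally show ?thesis by (auto simp: fps_X_def)
qed

definition vars :: "nat \<Rightarrow> int set" where
  "vars n = {- int n<..0}"

definition mon :: "nat \<Rightarrow> (nat \<Rightarrow> nat) \<Rightarrow> int \<Rightarrow>\<^sub>0 nat" where
  "mon n e = (\<Sum>k<n. single (- int k) (e k))"

lemma lookup_mon: "lookup (mon n e) i = (if i \<in> vars n then e (nat (- i)) else 0)"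
proof -
  have "lookup (mon n e) i = (\<Sum>k<n. if k = nat (- i) \<and> i \<le> 0 then e k else 0)"
    unfolding mon_def lookup_sum by (rule sum.cong) (auto simp: lookup_single when_def)
  also have "\<dots> = (if i \<in> vars n then e (nat (- i)) else 0)"
    by (cases "i \<le> 0") (auto simp: vars_def)
  finally show ?thesis .
qed

lemma lookup_mon_nat: "k < n \<Longrightarrow> lookup (mon n e) (- int k) = e k"
  by (simp add: lookup_mon vars_def)

lemma keys_mon: "keys (mon n e) \<subseteq> vars n"
  by (auto simp: in_keys_iff lookup_mon split: if_splits)

lemma mon_eq_iff: "mon n e = mon n f \<longleftrightarrow> (\<forall>k<n. e k = f k)"
proof
  assume "mon n e = mon n f"
  then show "\<forall>k<n. e k = f k" by (metis lookup_mon_nat)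
next
  assume "\<forall>k<n. e k = f k"
  then show "mon n e = mon n f" by (simp add: mon_def)
qed

lemma mon_minus_single:
  assumes "k < n"
  shows "mon n e - single (- int k) s = mon n (e(k := e k - s))"
proof (rule poly_mapping_eqI)
  fix j
  show "lookup (mon n e - single (- int k) s) j = lookup (mon n (e(k := e k - s))) j"
    using assms by (cases "j = - int k") (auto simp: lookup_minus lookup_mon lookup_single when_def vars_def)
qed

lemma mon_cover:
  assumes "keys m \<subseteq> vars n"
  shows "m = mon n (\<lambda>k. lookup m (- int k))"
proof (rule poly_mapping_eqI)
  fix i
  show "lookup m i = lookup (mon n (\<lambda>k. lookup m (- int k))) i"
    using assms by (auto simp: lookup_mon vars_def in_keys_iff)
qed

lemma mdeg_mon: "mdeg (mon n e) = (\<Sum>k<n. e k)"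
proof -
  have "mdeg (\<Sum>k\<in>K. single (- int k) (e k)) = (\<Sum>k\<in>K. e k)" for K
    by (induction K rule: infinite_finite_induct) (simp_all add: mdeg_add)
  then show ?thesis by (simp add: mon_def)
qed

lemma finite_vars [simp]: "finite (vars n)"
  and card_vars: "card (vars n) = n"
  and vars_nonpos: "vars n \<subseteq> {..0}"
  and vars_mem [simp]: "- int k \<in> vars n \<longleftrightarrow> k < n"
  by (auto simp: vars_def)

lemma prod_var_power: "(\<Prod>k<n. var_mps (- int k) ^ e k) = monom_mps (mon n e)"
  by (simp add: var_power prod_monom_mps mon_def)

definition alternant :: "nat \<Rightarrow> (nat \<Rightarrow> nat) \<Rightarrow> (int, 'c :: comm_ring_1) mps" where
  "alternant n e = dt n (\<lambda>i j. var_mps (- int j) ^ e i)"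

lemma alternant_expand: "(alternant n e :: (int, 'c :: comm_ring_1) mps) =
    (\<Sum>p | p permutes {0..<n}. signof p * monom_mps (mon n (\<lambda>k. e (Hilbert_Choice.inv p k))))"
proof -
  have "(\<Prod>i = 0..<n. var_mps (- int (p i)) ^ e i) =
      (monom_mps (mon n (\<lambda>k. e (Hilbert_Choice.inv p k))) :: (int, 'c) mps)"
    if p: "p permutes {0..<n}" for p
  proof -
    have "(\<Prod>i = 0..<n. var_mps (- int i) ^ e (Hilbert_Choice.inv p i)) =
        (\<Prod>i = 0..<n. var_mps (- int (p i)) ^ e i :: (int, 'c) mps)"
      using prod.permute[OF p, of "\<lambda>i. var_mps (- int i) ^ e (Hilbert_Choice.inv p i) :: (int, 'c) mps"]
      by (simp add: o_def permutes_inverses[OF p])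
    then show ?thesis
      using prod_var_power[of "\<lambda>i. e (Hilbert_Choice.inv p i)" n, where ?'a = 'c] by (simp add: lessThan_atLeast0)
  qed
  then show ?thesis by (simp add: alternant_def dt_perm)
qed

lemma coeff_signof_mult: "coeff_mps (signof p * f) m = signof p * coeff_mps f m"
  by (simp add: sign_def)

lemma coeff_alternant: "coeff_mps (alternant n e :: (int, 'c :: comm_ring_1) mps) m =
    (\<Sum>p | p permutes {0..<n}. signof p * (if m = mon n (\<lambda>k. e (Hilbert_Choice.inv p k)) then 1 else 0))"
  by (simp add: alternant_expand coeff_signof_mult coeff_monom_mps)

text \<open>Two strictly decreasing sequences with the same values coincide, so only the identity
  permutation can carry the exponents e to f.\<close>

lemma coeff_alternant_strict:
  assumes e: "\<And>i j. i < j \<Longrightarrow> j < n \<Longrightarrow> e j < e i" and f: "\<And>i j. i < j \<Longrightarrow> j < n \<Longrightarrow> f j < f i"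
  shows "coeff_mps (alternant n e :: (int, 'c :: comm_ring_1) mps) (mon n f) = (if \<forall>i<n. e i = f i then 1 else 0)"
proof -
  have id: "p = id \<and> (\<forall>i<n. e i = f i)"
    if p: "p permutes {0..<n}" and eq: "mon n f = mon n (\<lambda>k. e (Hilbert_Choice.inv p k))" for p
  proof -
    have ip: "Hilbert_Choice.inv p permutes {0..<n}" by (rule permutes_inv[OF p])
    have fe: "f k = e (Hilbert_Choice.inv p k)" if "k < n" for k
      using eq that by (simp add: mon_eq_iff)
    have "f ` {0..<n} = e ` Hilbert_Choice.inv p ` {0..<n}"
      by (auto simp: image_image fe intro!: image_cong)
    then have im: "e ` {..<n} = f ` {..<n}"
      by (simp add: permutes_image[OF ip] lessThan_atLeast0)
    have ef: "e i = f i" if "i < n" for i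
      by (rule strict_dec_image_eq[OF e f im that])
    have "Hilbert_Choice.inv p k = k" if k: "k < n" for k
    proof -
      have l: "Hilbert_Choice.inv p k < n" using permutes_in_image[OF ip, of k] k by simp
      have "e (Hilbert_Choice.inv p k) = e k" using fe[OF k] ef[OF k] by simp
      then show ?thesis
        using e[of k "Hilbert_Choice.inv p k"] e[of "Hilbert_Choice.inv p k" k] k l
        by (cases k "Hilbert_Choice.inv p k" rule: linorder_cases) auto
    qed
    then have "p k = k" for k
      using p by (cases "k < n") (metis permutes_inverses(1), simp add: permutes_def)
    then show ?thesis using ef by auto
  qed
  have "coeff_mps (alternant n e :: (int, 'c) mps) (mon n f) =
      (\<Sum>p\<in>{id}. signof p * (if mon n f = mon n (\<lambda>k. e (Hilbert_Choice.inv p k)) then 1 else 0))"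
    unfolding coeff_alternant
    by (rule sum.mono_neutral_right) (auto simp: finite_permutations permutes_id dest: id)
  then show ?thesis by (auto simp: mon_eq_iff)
qed

section \<open>Complete homogeneous functions and the Jacobi-Trudi matrix\<close>

definition h_in :: "int set \<Rightarrow> int \<Rightarrow> (int, 'c :: comm_ring_1) mps" where
  "h_in V r = Abs_mps (\<lambda>m. if keys m \<subseteq> V \<and> int (mdeg m) = r then 1 else 0)"

lemma coeff_h_in: "coeff_mps (h_in V r) m = (if keys m \<subseteq> V \<and> int (mdeg m) = r then 1 else 0)"
  by (simp add: h_in_def)

lemma h_in_neg: "r < 0 \<Longrightarrow> h_in V r = 0"
  by (rule mps_eqI) (simp add: coeff_h_in)

lemma h_in_0: "h_in V 0 = 1"
  by (rule mps_eqI) (auto simp: coeff_h_in coeff_mps_one mdeg_eq_0_iff)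

lemma homog_h_in: "homog (nat r) (h_in V r)"
  by (auto simp: homog_def coeff_h_in split: if_splits)

lemma h_y_eq: "h_y r = h_in {..0} r"
proof (rule mps_eqI)
  fix m
  let ?S = "{m. keys m \<subseteq> {..0} \<and> int (\<Sum>i\<in>keys m. lookup m i) = r}"
  have "{i \<in> ?S. coeff_mps (monom_mps i :: (int, rat) mps) m \<noteq> 0} = (if m \<in> ?S then {m} else {})"
    by (auto simp: coeff_monom_mps split: if_splits)
  then show "coeff_mps (h_y r) m = coeff_mps (h_in {..0} r) m"
    by (simp add: h_y_def formal_sum_def coeff_h_in coeff_monom_mps mdeg_def)
qed

lemma map_mps_h_in: "comm_ring_hom \<phi> \<Longrightarrow> map_mps \<phi> (h_in V r) = h_in V r"
proof (rule mps_eqI)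
  fix m assume "comm_ring_hom \<phi>"
  then interpret comm_ring_hom \<phi> .
  show "coeff_mps (map_mps \<phi> (h_in V r)) m = coeff_mps (h_in V r) m" by (simp add: coeff_h_in)
qed

lemma res_h_in: "res W (h_in V r) = h_in (V \<inter> W) r"
  by (rule mps_eqI) (auto simp: coeff_res coeff_h_in)

text \<open>Monomials of degree r divisible by y_l are y_l times those of degree r - 1; for
  generating series in t this reads (1 - y_l t) H_V = H_{V - {l}}.\<close>

lemma h_in_remove:
  assumes "l \<in> V"
  shows "h_in V r - var_mps l * h_in V (r - 1) = h_in (V - {l}) r"
proof (rule mps_eqI)
  fix m :: "int \<Rightarrow>\<^sub>0 nat"
  show "coeff_mps (h_in V r - var_mps l * h_in V (r - 1)) m = coeff_mps (h_in (V - {l}) r) m"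
  proof (cases "1 \<le> lookup m l")
    case True
    let ?m = "m - single l 1"
    have m: "m = single l 1 + ?m"
      by (rule single_add_minus[OF True, symmetric])
    have "mdeg m = mdeg ?m + 1" by (subst m) (simp add: mdeg_add del: single_diff)
    moreover have "keys m = insert l (keys ?m)"
      by (subst m) (simp add: keys_add_nat)
    ultimately show ?thesis using assms True by (auto simp: coeff_var_mult coeff_h_in)
  next
    case False
    then have "l \<notin> keys m" by (simp add: in_keys_iff)
    then show ?thesis using False by (auto simp: coeff_var_mult coeff_h_in)
  qed
qed

lemma h_in_single: "h_in {l} (int r) = var_mps l ^ r"
proof (rule mps_eqI)
  fix m :: "int \<Rightarrow>\<^sub>0 nat"
  have "keys m \<subseteq> {l} \<and> mdeg m = r \<longleftrightarrow> m = single l r"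
    using keys_subset_single[of m l] by (metis keys_single mdeg_single empty_subsetI order_refl)
  then show "coeff_mps (h_in {l} (int r)) m = coeff_mps (var_mps l ^ r) m"
    by (simp add: coeff_h_in var_power coeff_monom_mps)
qed

definition h_fps :: "int set \<Rightarrow> (int, 'c :: comm_ring_1) mps fps" where
  "h_fps V = Abs_fps (\<lambda>r. h_in V (int r))"

lemma h_fps_remove:
  assumes "l \<in> V"
  shows "h_fps V * (1 - fps_const (var_mps l) * fps_X) = h_fps (V - {l})"
proof (rule fps_ext)
  fix r
  show "fps_nth (h_fps V * (1 - fps_const (var_mps l) * fps_X)) r = fps_nth (h_fps (V - {l})) r"
    using h_in_remove[OF assms, of "int r"]
    by (cases r) (simp_all add: h_fps_def algebra_simps h_in_neg)
qed

lemma h_fps_diff: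
  assumes "finite W" "W \<subseteq> V"
  shows "(h_fps V :: (int, 'c :: comm_ring_1) mps fps) * (\<Prod>l\<in>W. 1 - fps_const (var_mps l) * fps_X) = h_fps (V - W)"
  using assms
proof (induction W rule: finite_induct)
  case (insert l W)
  have "(h_fps V :: (int, 'c) mps fps) * (\<Prod>l\<in>insert l W. 1 - fps_const (var_mps l) * fps_X) =
      h_fps V * (\<Prod>l\<in>W. 1 - fps_const (var_mps l) * fps_X) * (1 - fps_const (var_mps l) * fps_X)"
    unfolding prod.insert[OF insert.hyps] by (simp only: ac_simps)
  also have "\<dots> = h_fps (V - W) * (1 - fps_const (var_mps l) * fps_X)"
    using insert by simp
  also have "\<dots> = h_fps (V - W - {l})"
    by (rule h_fps_remove) (use insert in auto)
  finally show ?case by (subst Diff_insert)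
qed simp

lemma fps_nth_prod_linear:
  fixes c :: "'v \<Rightarrow> 'c :: comm_ring_1"
  assumes "finite W"
  shows "card W < s \<Longrightarrow> fps_nth (\<Prod>l\<in>W. 1 - fps_const (c l) * fps_X) s = 0"
  using assms
proof (induction W arbitrary: s rule: finite_induct)
  case (insert l W)
  have lin: "fps_nth ((1 - fps_const x * fps_X) * F) (Suc t) = fps_nth F (Suc t) - x * fps_nth F t" for x :: 'c and F t
    by (simp add: left_diff_distrib mult.assoc)
  obtain t where "s = Suc t" using insert.prems by (cases s) auto
  then show ?case using insert unfolding prod.insert[OF insert.hyps] by (simp add: lin del: fps_mult_nth_1)
qed simp

text \<open>Multiplying the Jacobi--Trudi matrix by the elementary symmetric polynomials in all variables but
  one turns row \<open>i\<close> into powers \<open>y\<^sub>k\<^bsup>\<alpha>\<^sub>i\<^esup>\<close>.\<close>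

lemma jacobi_trudi_alternant:
  "dt n (\<lambda>i j. h_in (vars n) (int (e i) - int (n - 1) + int j)) * alternant n (\<lambda>i. n - 1 - i)
    = (alternant n e :: (int, 'c :: comm_ring_1) mps)"
proof -
  define Q where "Q k = (\<Prod>l\<in>vars n - {- int k}. 1 - fps_const (var_mps l :: (int, 'c) mps) * fps_X)" for k
  \<comment> \<open>\<open>E j k\<close> is (-1)^s times the elementary symmetric polynomial of
    degree s = n - 1 - j in the variables other than \<open>- int k\<close>.\<close>
  define E where "E j k = fps_nth (Q k) (n - 1 - j)" for j k
  have HE: "(\<Sum>j<n. h_in (vars n) (int r - int (n - 1) + int j) * E j k) = var_mps (- int k) ^ r"
    if k: "k < n" for r k
  proof -
    let ?g = "\<lambda>s. h_in (vars n) (int r - int s) * fps_nth (Q k) s"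
    have "h_fps (vars n) * Q k = h_fps (vars n - (vars n - {- int k}))"
      unfolding Q_def by (rule h_fps_diff) auto
    also have "vars n - (vars n - {- int k}) = {- int k}" using k by (auto simp: vars_def)
    finally have HQ: "h_fps (vars n) * Q k = h_fps {- int k}" .
    have Q0: "fps_nth (Q k) s = 0" if "n \<le> s" for s
      unfolding Q_def by (rule fps_nth_prod_linear) (use that k in \<open>auto simp: card_vars\<close>)
    have "(\<Sum>j<n. h_in (vars n) (int r - int (n - 1) + int j) * E j k) = (\<Sum>s<n. ?g s)"
      unfolding E_def
      by (rule sum.reindex_bij_witness[of _ "\<lambda>s. n - 1 - s" "\<lambda>s. n - 1 - s"]) (auto simp: of_nat_diff algebra_simps)
    \<comment> \<open>Terms with s \<ge> n vanish by the degree of \<open>Q k\<close>, terms with s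
      > r because h has negative index; so both ranges give the same sum.\<close>
    also have "\<dots> = (\<Sum>s\<in>{..<n} \<union> {..r}. ?g s)"
      by (rule sum.mono_neutral_left) (auto simp: Q0)
    also have "\<dots> = (\<Sum>s\<le>r. ?g s)"
      by (rule sum.mono_neutral_right) (auto simp: h_in_neg)
    also have "\<dots> = fps_nth (Q k * h_fps (vars n)) r"
      by (simp add: fps_mult_nth h_fps_def atLeast0AtMost of_nat_diff mult.commute)
    also have "\<dots> = var_mps (- int k) ^ r"
      using HQ by (simp add: mult.commute[of "Q k"] h_fps_def h_in_single)
    finally show ?thesis .
  qed
  have main: "dt n (\<lambda>i j. h_in (vars n) (int (e i) - int (n - 1) + int j)) * dt n E = alternant n e" for e
    unfolding dt_mult alternant_def by (rule dt_cong) (rule HE)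
  \<comment> \<open>For the exponents n - 1 - i the matrix of the h is unitriangular, which
    identifies the determinant of \<open>E\<close> as the Vandermonde determinant without computing
    it.\<close>
  have "dt n (\<lambda>i j. h_in (vars n) (int (n - 1 - i) - int (n - 1) + int j)) = (1 :: (int, 'c) mps)"
    by (rule dt_unitriangular) (auto simp: of_nat_diff h_in_neg h_in_0)
  then have "dt n E = alternant n (\<lambda>i. n - 1 - i)"
    using main[of "\<lambda>i. n - 1 - i"] by simp
  then show ?thesis using main by simp
qed

section \<open>The bialternant formula\<close>

definition vand :: "nat \<Rightarrow> (int, 'c :: comm_ring_1) mps" where
  "vand n = alternant n (\<lambda>i. n - 1 - i)"

text \<open>The coefficient ring is left open: the instance over Q is \<open>schur_y\<close>, the
  one over Q[a] is \<open>schur_hat\<close>.\<close>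

definition schur_gen :: "partition \<Rightarrow> (int, 'c :: comm_ring_1) mps" where
  "schur_gen lam = dt (len lam) (\<lambda>i j. h_in {..0} (int (part lam (Suc i)) - int i + int j))"

lemma schur_gen_size:
  assumes "len lam \<le> n"
  shows "schur_gen lam = dt n (\<lambda>i j. h_in {..0} (int (part lam (Suc i)) - int i + int j))"
  unfolding schur_gen_def
  by (rule dt_stable[OF assms, symmetric]) (auto simp: part_Suc h_in_neg h_in_0)

lemma schur_y_eq: "schur_y lam = schur_gen lam"
  by (simp add: schur_y_def schur_gen_def dt_def h_y_eq)

lemma const_qa_hom: "comm_ring_hom const_qa"
  by (rule comm_ring_homI) (simp_all add: const_qa_def single_add mult_single)

lemma schur_hat_eq: "schur_hat lam = schur_gen lam"
  unfolding schur_hat_def schur_y_eq schur_gen_def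
  by (simp add: dt_hom[OF map_mps_hom[OF const_qa_hom]] map_mps_h_in[OF const_qa_hom])

lemma homog_schur_gen: "homog (psize lam) (schur_gen lam)"
  unfolding schur_gen_def
proof (rule homog_dt[where e = "\<lambda>i. int (part lam (Suc i)) - int i" and c = int])
  show "int (psize lam) = (\<Sum>i<len lam. int (part lam (Suc i)) - int i) + (\<Sum>j<len lam. int j)"
    by (simp add: psize_def sum_subtractf)
next
  fix i j
  assume "h_in {..0} (int (part lam (Suc i)) - int i + int j) \<noteq> (0 :: (int, 'a) mps)"
  then show "0 \<le> int (part lam (Suc i)) - int i + int j \<and>
      homog (nat (int (part lam (Suc i)) - int i + int j))
        (h_in {..0} (int (part lam (Suc i)) - int i + int j) :: (int, 'a) mps)"
    using h_in_neg homog_h_in linorder_not_less by blast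
qed

text \<open>The exponents \<open>\<lambda> + \<delta>\<close> of the bialternant formula. For a
  nonempty row k, counted from 0, \<open>exps n lam k - n\<close> is the content of its last
  box.\<close>

definition exps :: "nat \<Rightarrow> partition \<Rightarrow> nat \<Rightarrow> nat" where
  "exps n lam k = part lam (Suc k) + (n - 1 - k)"

lemma exps_strict: "i < j \<Longrightarrow> j < n \<Longrightarrow> exps n lam j < exps n lam i"
  using part_antimono[of i j lam] by (simp add: exps_def)

lemma exps_inj:
  assumes "len lam \<le> n" "len mu \<le> n" "\<And>i. i < n \<Longrightarrow> exps n lam i = exps n mu i"
  shows "lam = mu"
proof (rule partition_eqI)
  fix i
  show "part lam (Suc i) = part mu (Suc i)"
  proof (cases "i < n")
    case True
    then show ?thesis using assms(3)[of i] unfolding exps_def by (metis add_right_cancel)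
  next
    case False
    then show ?thesis using assms by (simp add: part_Suc)
  qed
qed

text \<open>Restricting to n variables turns the Jacobi-Trudi matrix into that of
  \<open>jacobi_trudi_alternant\<close> with exponents \<open>exps n lam\<close>.\<close>

lemma vand_schur_gen:
  assumes "len lam \<le> n"
  shows "res (vars n) (vand n * schur_gen lam) = (alternant n (exps n lam) :: (int, 'c :: comm_ring_1) mps)"
proof -
  interpret res: comm_ring_hom "res (vars n) :: (int, 'c) mps \<Rightarrow> _" by (rule res_hom)
  have "res (vars n) (alternant n e) = (alternant n e :: (int, 'c) mps)" for e
  proof (rule mps_eqI)
    fix m
    have "coeff_mps (alternant n e :: (int, 'c) mps) m = 0" if "\<not> keys m \<subseteq> vars n"
    proof -
      have "m \<noteq> mon n f" for f using that keys_mon[of n f] by auto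
      then show ?thesis by (simp add: coeff_alternant)
    qed
    then show "coeff_mps (res (vars n) (alternant n e)) m = coeff_mps (alternant n e :: (int, 'c) mps) m"
      by (auto simp: coeff_res)
  qed
  moreover have "res (vars n) (schur_gen lam :: (int, 'c) mps) =
      dt n (\<lambda>i j. h_in (vars n) (int (exps n lam i) - int (n - 1) + int j))"
  proof -
    have "{..0} \<inter> vars n = vars n" using vars_nonpos by auto
    then show ?thesis
      unfolding schur_gen_size[OF assms] dt_hom[OF res_hom]
      by (intro dt_cong) (auto simp: res_h_in exps_def of_nat_diff algebra_simps)
  qed
  ultimately show ?thesis
    using jacobi_trudi_alternant[of n "exps n lam", where ?'c = 'c] by (simp add: res.hom_mult vand_def mult.commute)
qed

lemma coeff_vand_schur_gen:
  assumes "len lam \<le> n" "len mu \<le> n"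
  shows "coeff_mps (vand n * schur_gen lam :: (int, 'c :: comm_ring_1) mps) (mon n (exps n mu))
    = (if lam = mu then 1 else 0)"
proof -
  have "coeff_mps (vand n * schur_gen lam :: (int, 'c) mps) (mon n (exps n mu)) =
      coeff_mps (res (vars n) (vand n * schur_gen lam) :: (int, 'c) mps) (mon n (exps n mu))"
    by (simp add: coeff_res keys_mon)
  also have "\<dots> = (if \<forall>i<n. exps n lam i = exps n mu i then 1 else 0)"
    unfolding vand_schur_gen[OF assms(1)] by (rule coeff_alternant_strict) (auto intro: exps_strict)
  also have "\<dots> = (if lam = mu then 1 else 0)"
    using exps_inj[OF assms] by auto
  finally show ?thesis .
qed

lemma homog_vand: "homog (\<Sum>k<n. n - 1 - k) (vand n)"
  unfolding homog_def
proof (intro allI impI)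
  fix m assume "coeff_mps (vand n :: (int, 'a) mps) m \<noteq> 0"
  then obtain p where p: "p permutes {0..<n}" "m = mon n (\<lambda>k. n - 1 - Hilbert_Choice.inv p k)"
    unfolding vand_def coeff_alternant by (auto elim!: sum.not_neutral_contains_not_neutral split: if_splits)
  show "mdeg m = (\<Sum>k<n. n - 1 - k)"
    using sum.permute[OF permutes_inv[OF p(1)], of "\<lambda>k. n - 1 - k"] p(2)
    by (simp add: mdeg_mon o_def lessThan_atLeast0)
qed

lemma sum_exps: "len lam \<le> n \<Longrightarrow> (\<Sum>k<n. exps n lam k) = psize lam + (\<Sum>k<n. n - 1 - k)"
  by (simp only: exps_def sum.distrib psize_superset)

section \<open>Factorial powers and the series \<open>\<Omega>\<close>\<close>

lemma swap_a_hom: "comm_ring_hom (swap_a i)"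
  unfolding swap_a_def by (rule poly_eval_hom[OF const_qa_hom])

lemma swap_a_var: "swap_a i (a_var j) = a_var (transpose i (i + 1) j)"
  unfolding swap_a_def
  using poly_eval_single[OF const_qa_hom, of "\<lambda>j. a_var (transpose i (i + 1) j)" "single j 1" 1]
  by (simp add: a_var_def const_qa_def)

lemma swap_alpha: "swap_a i (alpha i) = - alpha i"
proof -
  interpret comm_ring_hom "swap_a i" by (rule swap_a_hom)
  show ?thesis by (simp add: alpha_def hom_minus swap_a_var)
qed

lemma alpha_nonzero: "alpha i \<noteq> 0"
proof
  assume "alpha i = 0"
  then have "lookup (a_var i) (single i 1) = lookup (a_var (i + 1)) (single i 1)"
    by (simp add: alpha_def)
  moreover have "single (i + 1) (1 :: nat) \<noteq> single i 1"
    by (simp add: single_eq_iff_pos)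
  ultimately show False by (simp add: a_var_def lookup_single)
qed

definition geo :: "'c :: comm_ring_1 \<Rightarrow> 'c fps" where
  "geo c = Abs_fps (\<lambda>n. c ^ n)"

lemma geo_mult: "(1 - fps_const c * fps_X) * geo c = 1"
proof (rule fps_ext)
  fix n
  show "fps_nth ((1 - fps_const c * fps_X) * geo c) n = fps_nth 1 n"
    by (cases n) (simp_all add: geo_def left_diff_distrib mult.assoc)
qed

abbreviation lin_fps :: "int \<Rightarrow> qa fps" where
  "lin_fps k \<equiv> 1 - fps_const (a_var k) * fps_X"

text \<open>\<open>rfac l = y\<^sup>l (u|a)\<^sup>l\<close> with \<open>u = 1/y\<close> and the factorial powers
  \<open>(u|a)\<^sup>l = (u|a)\<^bsup>l-1\<^esup> (u - a\<^sub>l)\<close>, \<open>(u|a)\<^sup>0 = 1\<close>.\<close>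

definition rfac :: "int \<Rightarrow> qa fps" where
  "rfac l = (if 0 \<le> l then \<Prod>k\<in>{1..l}. lin_fps k else \<Prod>k\<in>{l+1..0}. geo (a_var k))"

lemma rfac_step: "rfac l = rfac (l - 1) * lin_fps l"
proof (cases "1 \<le> l")
  case True
  then have "{1..l} = insert l {1..l - 1}" by auto
  then show ?thesis using True by (simp add: rfac_def mult.commute)
next
  case False
  then have "{l..0} = insert l {l+1..0}" by auto
  then have "rfac (l - 1) * lin_fps l = (\<Prod>k\<in>{l+1..0}. geo (a_var k)) * (lin_fps l * geo (a_var l))"
    using False by (simp add: rfac_def ac_simps)
  also have "\<dots> = rfac l" using False by (auto simp: geo_mult rfac_def)
  finally show ?thesis ..
qed

lemma rfac_0: "rfac 0 = 1"
  by (simp add: rfac_def)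

lemma rfac_minus1: "rfac (- 1) = geo (a_var 0)"
  by (simp add: rfac_def)

lemma rfac_nth_0: "fps_nth (rfac l) 0 = 1"
proof -
  have "fps_nth (\<Prod>k\<in>I. f k) 0 = (\<Prod>k\<in>I. fps_nth (f k) 0)" for f :: "int \<Rightarrow> qa fps" and I
    by (induction I rule: infinite_finite_induct) auto
  then show ?thesis by (simp add: rfac_def geo_def)
qed

lemma rfac_nth_big: "0 \<le> l \<Longrightarrow> l < int s \<Longrightarrow> fps_nth (rfac l) s = 0"
  unfolding rfac_def by (simp add: fps_nth_prod_linear)

definition map_fps :: "('c \<Rightarrow> 'd) \<Rightarrow> 'c fps \<Rightarrow> 'd fps" where
  "map_fps \<phi> F = Abs_fps (\<lambda>n. \<phi> (fps_nth F n))"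

lemma map_fps_hom:
  fixes \<phi> :: "'c :: comm_ring_1 \<Rightarrow> 'd :: comm_ring_1"
  assumes "comm_ring_hom \<phi>"
  shows "comm_ring_hom (map_fps \<phi>)"
proof (rule comm_ring_homI)
  interpret comm_ring_hom \<phi> by fact
  show "map_fps \<phi> 1 = 1"
    by (rule fps_ext) (simp add: map_fps_def)
  show "map_fps \<phi> (F + G) = map_fps \<phi> F + map_fps \<phi> G" for F G
    by (rule fps_ext) (simp add: map_fps_def hom_add)
  show "map_fps \<phi> (F * G) = map_fps \<phi> F * map_fps \<phi> G" for F G
    by (rule fps_ext) (simp add: map_fps_def fps_mult_nth hom_sum hom_mult)
qed

lemma map_fps_const:
  fixes \<phi> :: "'c :: comm_ring_1 \<Rightarrow> 'd :: comm_ring_1"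
  shows "comm_ring_hom \<phi> \<Longrightarrow> map_fps \<phi> (fps_const c) = fps_const (\<phi> c)"
proof (rule fps_ext)
  fix n assume "comm_ring_hom \<phi>"
  then interpret comm_ring_hom \<phi> .
  show "fps_nth (map_fps \<phi> (fps_const c)) n = fps_nth (fps_const (\<phi> c)) n" by (simp add: map_fps_def)
qed

lemma map_fps_X:
  fixes \<phi> :: "'c :: comm_ring_1 \<Rightarrow> 'd :: comm_ring_1"
  shows "comm_ring_hom \<phi> \<Longrightarrow> map_fps \<phi> fps_X = fps_X"
proof (rule fps_ext)
  fix n assume "comm_ring_hom \<phi>"
  then interpret comm_ring_hom \<phi> .
  show "fps_nth (map_fps \<phi> fps_X) n = fps_nth fps_X n" by (simp add: map_fps_def fps_X_def)
qed

lemma map_fps_geo: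
  fixes \<phi> :: "'c :: comm_ring_1 \<Rightarrow> 'd :: comm_ring_1"
  shows "comm_ring_hom \<phi> \<Longrightarrow> map_fps \<phi> (geo c) = geo (\<phi> c)"
proof (rule fps_ext)
  fix n assume "comm_ring_hom \<phi>"
  then interpret comm_ring_hom \<phi> .
  show "fps_nth (map_fps \<phi> (geo c)) n = fps_nth (geo (\<phi> c)) n" by (simp add: map_fps_def geo_def hom_power)
qed

definition om :: "int \<Rightarrow> qa fps" where
  "om i = (if i = 0 then lin_fps 0 * geo (a_var 1) else 1)"

lemma transpose_mem_iff: "(i \<in> I \<longleftrightarrow> j \<in> I) \<Longrightarrow> transpose i j x \<in> I \<longleftrightarrow> x \<in> I"
  by (cases "x = i"; cases "x = j") simp_all

lemma prod_transpose:
  fixes f :: "int \<Rightarrow> 'd :: comm_monoid_mult"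
  assumes "i \<in> I \<longleftrightarrow> j \<in> I"
  shows "(\<Prod>k\<in>I. f (transpose i j k)) = (\<Prod>k\<in>I. f k)"
  by (rule prod.reindex_bij_witness[of _ "transpose i j" "transpose i j"])
    (simp_all add: transpose_mem_iff[OF assms])

text \<open>As (u - a_i) + \<alpha>_i = u - a_{i+1}, the argument for l = i is (u|a)^(i-1) (u -
  a_{i+1}) up to a power of y, and for i \<noteq> 0 the exchange sends this to (u|a)^i;
  \<open>fps_X\<close> makes up for the lower power of y in \<open>rfac (i - 1)\<close>. For l
  \<noteq> i \<noteq> 0 both or neither of a_i, a_{i+1} occur in \<open>rfac l\<close>. For i = 0
  exactly one occurs whenever l \<noteq> 0, and exchanging it costs the factor
  \<open>om 0\<close>.\<close>

lemma rfac_swap: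
  "map_fps (swap_a i) (rfac l + (if l = i then fps_const (alpha i) * (fps_X * rfac (i - 1)) else 0))
    = om i * rfac l"
proof -
  note h = swap_a_hom[of i]
  interpret f: comm_ring_hom "map_fps (swap_a i)" by (rule map_fps_hom[OF h])
  have lin: "map_fps (swap_a i) (lin_fps k) = lin_fps (transpose i (i + 1) k)" for k
    by (simp add: f.hom_minus f.hom_mult map_fps_const[OF h] map_fps_X[OF h] swap_a_var)
  have geo: "map_fps (swap_a i) (geo (a_var k)) = geo (a_var (transpose i (i + 1) k))" for k
    by (simp add: map_fps_geo[OF h] swap_a_var)
  have prods: "map_fps (swap_a i) (\<Prod>k\<in>I. lin_fps k) = (\<Prod>k\<in>I. lin_fps k)"
    "map_fps (swap_a i) (\<Prod>k\<in>I. geo (a_var k)) = (\<Prod>k\<in>I. geo (a_var k))"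
    if "i \<in> I \<longleftrightarrow> i + 1 \<in> I" for I
    using prod_transpose[OF that, of lin_fps] prod_transpose[OF that, of "\<lambda>k. geo (a_var k)"]
    by (simp_all add: f.hom_prod lin geo del: minus_diff_eq)
  have stable: "map_fps (swap_a i) (rfac l) = rfac l" if "l \<noteq> i" "i \<noteq> 0" for l
  proof (cases "0 \<le> l")
    case True
    have "i \<in> {1..l} \<longleftrightarrow> i + 1 \<in> {1..l}" using that True by auto
    from prods(1)[OF this] show ?thesis using True by (simp add: rfac_def)
  next
    case False
    have "i \<in> {l+1..0} \<longleftrightarrow> i + 1 \<in> {l+1..0}" using that False by auto
    from prods(2)[OF this] show ?thesis using False by (simp add: rfac_def)
  qed
  have al: "map_fps (swap_a i) (fps_const (alpha i)) = - fps_const (alpha i)"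
    by (simp add: map_fps_const[OF h] swap_alpha)
  show ?thesis
  proof (cases "i = 0")
    case False
    show ?thesis
    proof (cases "l = i")
      case True
      have "map_fps (swap_a i) (rfac i + fps_const (alpha i) * (fps_X * rfac (i - 1)))
          = rfac (i - 1) * lin_fps (i + 1) - fps_const (alpha i) * (fps_X * rfac (i - 1))"
        unfolding rfac_step[of i] f.hom_add f.hom_mult lin al stable[of "i - 1", simplified, OF False] map_fps_X[OF h]
        by (simp only: mult_minus_left add_uminus_conv_diff transpose_apply_first)
      also have "\<dots> = rfac (i - 1) * lin_fps i"
        by (simp add: alpha_def algebra_simps flip: fps_const_sub)
      also have "\<dots> = rfac i" using rfac_step[of i] by simp
      finally show ?thesis using True False by (simp add: om_def)
    next
      case False
      then show ?thesis using stable[OF False \<open>i \<noteq> 0\<close>] \<open>i \<noteq> 0\<close> by (simp add: om_def)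
    qed
  next
    case i: True
    have om: "om i = lin_fps 0 * geo (a_var 1)" by (simp add: om_def i)
    consider "l = 0" | "0 < l" | "l < 0" by linarith
    then show ?thesis
    proof cases
      case 1
      have "map_fps (swap_a i) (rfac l + (if l = i then fps_const (alpha i) * (fps_X * rfac (i - 1)) else 0))
          = map_fps (swap_a i) (1 + fps_const (alpha i) * (fps_X * geo (a_var i)))"
        using 1 by (simp add: i rfac_0 rfac_minus1)
      also have "\<dots> = 1 - fps_const (alpha i) * (fps_X * geo (a_var (i + 1)))"
        unfolding f.hom_add f.hom_mult f.hom_one al geo map_fps_X[OF h]
        by (simp only: mult_minus_left add_uminus_conv_diff transpose_apply_first)
      also have "\<dots> = 1 - fps_const (alpha 0) * (fps_X * geo (a_var 1))"
        by (simp add: i)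
      also have "\<dots> = lin_fps 1 * geo (a_var 1) - fps_const (alpha 0) * (fps_X * geo (a_var 1))"
        by (simp only: geo_mult)
      also have "\<dots> = om i * rfac l"
        using 1 by (simp add: om rfac_0 alpha_def algebra_simps flip: fps_const_sub)
      finally show ?thesis .
    next
      case 2
      then have I: "{1..l} = insert 1 {2..l}" by auto
      have r: "rfac l = lin_fps 1 * (\<Prod>k\<in>{2..l}. lin_fps k)"
        using 2 unfolding rfac_def I by simp
      have "map_fps (swap_a i) (rfac l) = lin_fps 0 * (\<Prod>k\<in>{2..l}. lin_fps k)"
        unfolding r f.hom_mult using prods(1)[of "{2..l}"] lin[of 1] by (simp add: i)
      also have "\<dots> = lin_fps 0 * ((lin_fps 1 * geo (a_var 1)) * (\<Prod>k\<in>{2..l}. lin_fps k))"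
        by (simp only: geo_mult mult_1_left)
      also have "\<dots> = om i * rfac l"
        unfolding om r by (simp only: ac_simps)
      finally show ?thesis using 2 i by simp
    next
      case 3
      then have I: "{l+1..0} = insert 0 {l+1..-1}" by auto
      have r: "rfac l = geo (a_var 0) * (\<Prod>k\<in>{l+1..-1}. geo (a_var k))"
        using 3 unfolding rfac_def I by simp
      have "map_fps (swap_a i) (rfac l) = geo (a_var 1) * (\<Prod>k\<in>{l+1..-1}. geo (a_var k))"
        unfolding r f.hom_mult using prods(2)[of "{l+1..-1}"] geo[of 0] by (simp add: i)
      also have "\<dots> = (lin_fps 0 * geo (a_var 0)) * geo (a_var 1) * (\<Prod>k\<in>{l+1..-1}. geo (a_var k))"
        by (simp only: geo_mult mult_1_left)
      also have "\<dots> = om i * rfac l"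
        unfolding om r by (simp only: ac_simps)
      finally show ?thesis using 3 i by simp
    qed
  qed
qed

section \<open>Coefficients of the infinite product \<Omega>\<close>

lemma inverse_mps_eq:
  assumes "f * g = 1"
  shows "inverse_mps f = g"
  unfolding inverse_mps_def
proof (rule the_equality[where P = "\<lambda>g. f * g = 1", OF assms])
  fix g' assume "f * g' = 1"
  have "g' = (f * g) * g'" by (simp add: assms)
  also have "\<dots> = (f * g') * g" by (simp only: ac_simps)
  finally show "g' = g" by (simp add: \<open>f * g' = 1\<close>)
qed

lemma emb_lin: "emb k (1 - fps_const c * fps_X) = 1 - const_mps c * var_mps k"
proof -
  interpret comm_ring_hom "emb k" by (rule emb_hom)
  show ?thesis by (simp add: hom_minus hom_mult)
qed

lemma Omega_factor:
  "(1 - const_mps (a_var 0) * var_mps k) * inverse_mps (1 - const_mps (a_var 1) * var_mps k) = emb k (om 0)"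
proof -
  interpret comm_ring_hom "emb k :: qa fps \<Rightarrow> _" by (rule emb_hom)
  have "inverse_mps (1 - const_mps (a_var 1) * var_mps k) = emb k (geo (a_var 1))"
    by (rule inverse_mps_eq) (simp add: emb_lin[symmetric] hom_mult[symmetric] geo_mult)
  then show ?thesis by (simp add: om_def hom_mult emb_lin)
qed

lemma om_nth_0: "fps_nth (om i) 0 = 1"
  by (simp add: om_def geo_def)

text \<open>Setting the variables outside V to zero turns every factor outside V into its constant
  term 1 and keeps the coefficient at m.\<close>

lemma coeff_prod_emb_stable:
  assumes "finite S" "V \<subseteq> S" "keys m \<subseteq> V" and F: "\<And>k. fps_nth (F k) 0 = 1"
  shows "coeff_mps (\<Prod>k\<in>S. emb k (F k)) m = coeff_mps (\<Prod>k\<in>V. emb k (F k) :: (int, 'c :: comm_ring_1) mps) m"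
proof -
  interpret res: comm_ring_hom "res V :: (int, 'c) mps \<Rightarrow> _" by (rule res_hom)
  have "res V (\<Prod>k\<in>S. emb k (F k)) = (\<Prod>k\<in>S. if k \<in> V then emb k (F k) else 1)"
    unfolding res.hom_prod by (rule prod.cong) (simp_all add: res_emb F)
  also have "\<dots> = (\<Prod>k\<in>V. emb k (F k))"
    using assms by (simp add: prod.If_cases Int_absorb1)
  finally have "coeff_mps (res V (\<Prod>k\<in>S. emb k (F k))) m = coeff_mps (\<Prod>k\<in>V. emb k (F k)) m" by simp
  then show ?thesis using assms(3) by (simp add: coeff_res)
qed

lemma Omega_coeff_eq:
  assumes "\<And>S. finite S \<Longrightarrow> V \<subseteq> S \<Longrightarrow> S \<subseteq> {..0} \<Longrightarrow> coeff_mps (\<Prod>k\<in>S. emb k (om 0)) m = c"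
    and "finite V" "V \<subseteq> {..0}"
  shows "coeff_mps Omega m = c"
proof -
  let ?P = "\<lambda>c. eventually (\<lambda>S. coeff_mps (\<Prod>k\<in>S. emb k (om 0)) m = c) (finite_subsets_at_top {..(0 :: int)})"
  have ev: "?P c"
    unfolding eventually_finite_subsets_at_top using assms by blast
  have "c' = c" if "?P c'" for c'
  proof -
    \<comment> \<open>The filter of finite subsets is proper, so an eventual statement that mentions
      no subset is true: the eventual value is unique.\<close>
    have "eventually (\<lambda>S. c' = c) (finite_subsets_at_top {..(0 :: int)})"
      using eventually_conj[OF that ev] by (rule eventually_mono) auto
    then show ?thesis by simp
  qed
  then have "(THE c. ?P c) = c" using ev by (rule the_equality[rotated])
  then show ?thesis by (simp add: Omega_def formal_prod_def Omega_factor)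
qed

lemma coeff_Omega:
  assumes "finite V" "V \<subseteq> {..0}" "keys m \<subseteq> V"
  shows "coeff_mps Omega m = coeff_mps (\<Prod>k\<in>V. emb k (om 0)) m"
  by (rule Omega_coeff_eq[OF _ assms(1,2)]) (rule coeff_prod_emb_stable[OF _ _ assms(3) om_nth_0])

lemma coeff_Omega_outside:
  assumes "\<not> keys m \<subseteq> {..0}"
  shows "coeff_mps Omega m = 0"
proof (rule Omega_coeff_eq[of "{}"])
  fix S :: "int set" assume S: "finite S" "S \<subseteq> {..0}"
  interpret res: comm_ring_hom "res {..0} :: (int, qa) mps \<Rightarrow> _" by (rule res_hom)
  have "res {..0} (\<Prod>k\<in>S. emb k (om 0)) = (\<Prod>k\<in>S. emb k (om 0))"
    unfolding res.hom_prod using S by (intro prod.cong) (auto simp: res_emb)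
  then have "coeff_mps (\<Prod>k\<in>S. emb k (om 0)) m = coeff_mps (res {..0} (\<Prod>k\<in>S. emb k (om 0))) m" by simp
  then show "coeff_mps (\<Prod>k\<in>S. emb k (om 0)) m = 0" using assms by (simp add: coeff_res)
qed auto

section \<open>Symmetric series\<close>

text \<open>Transpositions of nonpositive indices generate all finite permutations of the variables;
  the condition on \<open>res\<close> excludes variables of positive index.\<close>

definition sym_mps :: "(int, 'c :: comm_ring_1) mps \<Rightarrow> bool" where
  "sym_mps g \<longleftrightarrow> res {..0} g = g \<and> (\<forall>i\<le>0. \<forall>j\<le>0. ren (transpose i j) g = g)"

lemma sym_hom_closed:
  assumes "sym_mps f" "sym_mps g"
  shows "sym_mps (f + g)" "sym_mps (f - g)" "sym_mps (f * g)"
proof -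
  interpret res: comm_ring_hom "res {..0} :: (int, 'a) mps \<Rightarrow> _" by (rule res_hom)
  interpret ren: comm_ring_hom "ren (transpose i j) :: (int, 'a) mps \<Rightarrow> _" for i j by (rule ren_hom) simp
  show "sym_mps (f + g)" "sym_mps (f - g)" "sym_mps (f * g)"
    using assms by (simp_all add: sym_mps_def res.hom_add res.hom_minus res.hom_mult
        ren.hom_add ren.hom_minus ren.hom_mult)
qed

lemma sym_dt: "(\<And>i j. sym_mps (M i j)) \<Longrightarrow> sym_mps (dt n M)"
  unfolding sym_mps_def by (simp add: dt_hom[OF res_hom] dt_hom[OF ren_hom])

lemma sym_const: "sym_mps (const_mps c)"
  by (auto simp: sym_mps_def ren_const intro!: mps_eqI) (simp add: coeff_res coeff_const_mps)

lemma sym_1: "sym_mps 1"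
  using sym_const[of 1] by simp

lemma keys_map_transpose_subset:
  assumes "i \<in> V \<longleftrightarrow> j \<in> V"
  shows "keys (map_key (transpose i j) m) \<subseteq> V \<longleftrightarrow> keys m \<subseteq> V"
proof -
  note mem = transpose_mem_iff[OF assms]
  show ?thesis
    unfolding keys_map_key_bij[OF bij_transpose]
  proof (intro iffI subsetI)
    fix x assume "transpose i j -` keys m \<subseteq> V" "x \<in> keys m"
    then have "transpose i j x \<in> V" by (simp add: subset_iff)
    then show "x \<in> V" by (simp only: mem)
  next
    fix x assume "keys m \<subseteq> V" "x \<in> transpose i j -` keys m"
    then have "transpose i j x \<in> V" by auto
    then show "x \<in> V" by (simp only: mem)
  qed
qed

lemma sym_coeffI:
  assumes "\<And>m. \<not> keys m \<subseteq> {..0} \<Longrightarrow> coeff_mps g m = 0"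
    and "\<And>i j m. i \<le> 0 \<Longrightarrow> j \<le> 0 \<Longrightarrow> keys m \<subseteq> {..0} \<Longrightarrow>
      coeff_mps g (map_key (transpose i j) m) = coeff_mps g m"
  shows "sym_mps g"
  unfolding sym_mps_def
proof (intro conjI allI impI)
  show "res {..0} g = g"
    by (rule mps_eqI) (simp add: coeff_res assms(1))
  fix i j :: int assume ij: "i \<le> 0" "j \<le> 0"
  show "ren (transpose i j) g = g"
  proof (rule mps_eqI)
    fix m :: "int \<Rightarrow>\<^sub>0 nat"
    have "keys (map_key (transpose i j) m) \<subseteq> {..0} \<longleftrightarrow> keys m \<subseteq> {..0}"
      by (rule keys_map_transpose_subset) (use ij in auto)
    then show "coeff_mps (ren (transpose i j) g) m = coeff_mps g m"
      using assms ij by (cases "keys m \<subseteq> {..0}") (simp_all add: coeff_ren)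
  qed
qed

lemma sym_coeffD:
  assumes "sym_mps g"
  shows "\<not> keys m \<subseteq> {..0} \<Longrightarrow> coeff_mps g m = 0"
    and "i \<le> 0 \<Longrightarrow> j \<le> 0 \<Longrightarrow> coeff_mps g (map_key (transpose i j) m) = coeff_mps g m"
proof -
  have "coeff_mps g m = coeff_mps (res {..0} g) m" using assms by (simp add: sym_mps_def)
  then show "\<not> keys m \<subseteq> {..0} \<Longrightarrow> coeff_mps g m = 0" by (simp add: coeff_res)
  assume "i \<le> 0" "j \<le> 0"
  then have "coeff_mps g m = coeff_mps (ren (transpose i j) g) m" using assms by (simp add: sym_mps_def)
  then show "coeff_mps g (map_key (transpose i j) m) = coeff_mps g m" by (simp add: coeff_ren)
qed

lemma sym_h_in: "sym_mps (h_in {..0} r)"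
  by (rule sym_coeffI) (simp_all add: coeff_h_in mdeg_map_key keys_map_transpose_subset)

lemma sym_schur_gen: "sym_mps (schur_gen lam)"
  unfolding schur_gen_def by (rule sym_dt) (rule sym_h_in)

lemma sym_map_mps: "\<phi> 0 = 0 \<Longrightarrow> sym_mps g \<Longrightarrow> sym_mps (map_mps \<phi> g)"
  by (rule sym_coeffI) (simp_all add: sym_coeffD)

text \<open>The coefficient at m can be computed from any finite set of factors covering the
  variables of m; with i and j added, this set is stable under their exchange.\<close>

lemma sym_Omega: "sym_mps Omega"
proof (rule sym_coeffI)
  show "coeff_mps Omega m = 0" if "\<not> keys m \<subseteq> {..0}" for m
    using that by (rule coeff_Omega_outside)
  fix i j :: int and m :: "int \<Rightarrow>\<^sub>0 nat"
  assume a: "i \<le> 0" "j \<le> 0" "keys m \<subseteq> {..0}"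
  let ?V = "keys m \<union> {i, j}"
  interpret ren: comm_ring_hom "ren (transpose i j) :: (int, qa) mps \<Rightarrow> _" by (rule ren_hom) simp
  have "coeff_mps Omega (map_key (transpose i j) m)
      = coeff_mps (\<Prod>k\<in>?V. emb k (om 0)) (map_key (transpose i j) m)"
    by (rule coeff_Omega) (use a in \<open>auto simp: keys_map_transpose_subset\<close>)
  also have "\<dots> = coeff_mps (ren (transpose i j) (\<Prod>k\<in>?V. emb k (om 0))) m"
    by (simp add: coeff_ren)
  also have "ren (transpose i j) (\<Prod>k\<in>?V. emb k (om 0)) = (\<Prod>k\<in>?V. emb k (om 0))"
    unfolding ren.hom_prod using prod_transpose[of i ?V j "\<lambda>k. emb k (om 0)"] by (simp add: ren_emb)
  also have "coeff_mps (\<Prod>k\<in>?V. emb k (om 0)) m = coeff_mps Omega m"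
    by (rule coeff_Omega[symmetric]) (use a in auto)
  finally show "coeff_mps Omega (map_key (transpose i j) m) = coeff_mps Omega m" .
qed

text \<open>By homogeneity only partitions of size \<open>mdeg m\<close> contribute. The bound d may
  be larger, which provides one index set for all splittings of a monomial in
  \<open>coeff_mult_schur_series\<close>.\<close>

lemma coeff_schur_series:
  assumes "mdeg m \<le> d"
  shows "coeff_mps (schur_series c) m = (\<Sum>nu | psize nu \<le> d. c nu * coeff_mps (schur_gen nu) m)"
proof -
  have "coeff_mps (schur_series c) m =
      (\<Sum>nu | c nu * coeff_mps (schur_gen nu) m \<noteq> 0. c nu * coeff_mps (schur_gen nu) m)"
    by (simp add: schur_series_def formal_sum_def schur_hat_eq)
  also have "\<dots> = (\<Sum>nu | psize nu \<le> d. c nu * coeff_mps (schur_gen nu) m)"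
  proof (rule sum.mono_neutral_left)
    show "finite {nu. psize nu \<le> d}" by (rule finite_psize_le)
    show "{nu. c nu * coeff_mps (schur_gen nu) m \<noteq> 0} \<subseteq> {nu. psize nu \<le> d}"
    proof safe
      fix nu assume "c nu * coeff_mps (schur_gen nu) m \<noteq> 0"
      then have "coeff_mps (schur_gen nu :: (int, qa) mps) m \<noteq> 0" by auto
      then have "mdeg m = psize nu"
        using homog_schur_gen[of nu] unfolding homog_def by blast
      then show "psize nu \<le> d" using assms by simp
    qed
  qed auto
  finally show ?thesis .
qed

lemma sym_schur_series: "sym_mps (schur_series c)"
proof (rule sym_coeffI)
  show "coeff_mps (schur_series c) m = 0" if "\<not> keys m \<subseteq> {..0}" for m
  proof -
    have "coeff_mps (schur_gen nu :: (int, qa) mps) m = 0" for nu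
      by (rule sym_coeffD(1)[OF sym_schur_gen that])
    then show ?thesis unfolding coeff_schur_series[OF order_refl] by simp
  qed
  fix i j :: int and m :: "int \<Rightarrow>\<^sub>0 nat"
  assume "i \<le> 0" "j \<le> 0"
  then have "coeff_mps (schur_gen nu :: (int, qa) mps) (map_key (transpose i j) m) = coeff_mps (schur_gen nu) m" for nu
    by (rule sym_coeffD(2)[OF sym_schur_gen])
  then show "coeff_mps (schur_series c) (map_key (transpose i j) m) = coeff_mps (schur_series c) m"
    unfolding coeff_schur_series[OF order_refl] by (simp add: mdeg_map_key)
qed

section \<open>The constant term functional\<close>

text \<open>The number N of factors is separate from n: with N < n only the first N rows carry
  factorial powers, as in the row-by-row expansion of \<open>pairs_xdet\<close>.\<close>

definition rprod :: "nat \<Rightarrow> nat \<Rightarrow> (nat \<Rightarrow> nat) \<Rightarrow> (int, qa) mps" where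
  "rprod n N e = (\<Prod>k<N. emb (- int k) (rfac (int (e k) - int n)))"

text \<open>With \<open>u\<^sub>k = 1/y\<^bsub>-k\<^esub>\<close>, this is the constant term of
  \<open>\<Prod>\<^sub>k (u\<^sub>k|a)\<^bsup>e\<^sub>k-n\<^esup> u\<^sub>k\<^sup>n\<close> times the Vandermonde determinant times \<open>g\<close>; it will compute the pairing
  of \<open>g\<close> with a double Schur function.\<close>

definition Phi :: "nat \<Rightarrow> (nat \<Rightarrow> nat) \<Rightarrow> (int, qa) mps \<Rightarrow> qa" where
  "Phi n e g = coeff_mps (rprod n n e * (vand n * g)) (mon n e)"

lemma Phi_cong: "(\<And>k. k < n \<Longrightarrow> e k = f k) \<Longrightarrow> Phi n e g = Phi n f g"
  by (simp add: Phi_def rprod_def mon_def)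

lemma Phi_diff: "Phi n e (f - g) = Phi n e f - Phi n e g"
  by (simp add: Phi_def right_diff_distrib)

lemma Phi_const_mult: "Phi n e (const_mps c * g) = c * Phi n e g"
  by (simp add: Phi_def mult.left_commute[of _ "const_mps c"])

lemma transpose_neg: "transpose (- int a) (- int b) (- int k) = - int (transpose a b k)"
  by (auto simp: transpose_def)

lemma ren_vand:
  assumes "a < n" "b < n" "a \<noteq> b"
  shows "ren (transpose (- int a) (- int b)) (vand n) = (- vand n :: (int, 'c :: comm_ring_1) mps)"
proof -
  let ?t = "transpose (- int a) (- int b)"
  interpret ren: comm_ring_hom "ren ?t :: (int, 'c) mps \<Rightarrow> _" by (rule ren_hom) simp
  have v: "ren ?t (var_mps (- int j)) = (var_mps (- int (transpose a b j)) :: (int, 'c) mps)" for j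
    using ren_emb[of ?t "- int j" "fps_X :: 'c fps"] by (simp add: transpose_neg)
  have p: "transpose a b permutes {0..<n}" by (rule permutes_swap_id) (use assms in auto)
  have "ren ?t (vand n :: (int, 'c) mps) = dt n (\<lambda>i j. var_mps (- int (transpose a b j)) ^ (n - 1 - i))"
    unfolding vand_def alternant_def dt_hom[OF ren.comm_ring_hom_axioms] by (simp add: ren.hom_power v)
  also have "\<dots> = signof (transpose a b) * vand n"
    unfolding vand_def alternant_def
    using dt_permute_cols[OF p, of "\<lambda>i j. var_mps (- int j) ^ (n - 1 - i) :: (int, 'c) mps"] by simp
  finally show ?thesis using assms by (simp add: sign_swap_id)
qed

lemma map_key_mon:
  assumes "a < n" "b < n"
  shows "map_key (transpose (- int a) (- int b)) (mon n e) = mon n (e \<circ> transpose a b)"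
proof -
  let ?m = "map_key (transpose (- int a) (- int b)) (mon n e)"
  have t: "transpose a b k < n \<longleftrightarrow> k < n" for k
    using transpose_mem_iff[of a "{..<n}" b k] assms by simp
  have "keys ?m \<subseteq> vars n"
    using keys_map_transpose_subset[of "- int a" "vars n" "- int b" "mon n e"] keys_mon[of n e] assms by simp
  then have "?m = mon n (\<lambda>k. lookup ?m (- int k))" by (rule mon_cover)
  also have "\<dots> = mon n (e \<circ> transpose a b)"
    by (simp add: mon_eq_iff lookup_map_key_bij transpose_neg lookup_mon_nat t)
  finally show ?thesis .
qed

lemma coeff_mult_vand_transpose:
  fixes g :: "(int, 'c :: comm_ring_1) mps"
  assumes g: "sym_mps g" and ab: "a < n" "b < n" "a \<noteq> b"
    and P: "ren (transpose (- int a) (- int b)) P = P'"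
  shows "coeff_mps (P * (vand n * g)) (mon n (e \<circ> transpose a b)) = - coeff_mps (P' * (vand n * g)) (mon n e)"
proof -
  let ?t = "transpose (- int a) (- int b)"
  interpret ren: comm_ring_hom "ren ?t :: (int, 'c) mps \<Rightarrow> _" by (rule ren_hom) simp
  have gg: "ren ?t g = g" using g by (simp add: sym_mps_def)
  have "coeff_mps (P * (vand n * g)) (mon n (e \<circ> transpose a b)) = coeff_mps (ren ?t (P * (vand n * g))) (mon n e)"
    by (simp add: coeff_ren map_key_mon ab)
  also have "\<dots> = - coeff_mps (P' * (vand n * g)) (mon n e)"
    unfolding ren.hom_mult P gg ren_vand[OF ab] by simp
  finally show ?thesis .
qed

lemma coeff_vand_transpose:
  fixes g :: "(int, 'c :: comm_ring_1) mps"
  assumes "sym_mps g" "a < n" "b < n" "a \<noteq> b"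
  shows "coeff_mps (vand n * g) (mon n (e \<circ> transpose a b)) = - coeff_mps (vand n * g) (mon n e)"
proof -
  interpret ren: comm_ring_hom "ren (transpose (- int a) (- int b)) :: (int, 'c) mps \<Rightarrow> _"
    by (rule ren_hom) simp
  show ?thesis using coeff_mult_vand_transpose[OF assms ren.hom_one, of e] by simp
qed

text \<open>Exchanging two exponents amounts to exchanging two variables: \<open>rprod\<close>
  follows the exponents, g is invariant, and the Vandermonde determinant changes sign.\<close>

lemma Phi_transpose:
  assumes g: "sym_mps g" and ab: "a < n" "b < n" "a \<noteq> b"
  shows "Phi n (e \<circ> transpose a b) g = - Phi n e g"
  unfolding Phi_def
proof (rule coeff_mult_vand_transpose[OF assms])
  let ?t = "transpose (- int a) (- int b)"
  interpret ren: comm_ring_hom "ren ?t :: (int, qa) mps \<Rightarrow> _" by (rule ren_hom) simp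
  have "ren ?t (rprod n n (e \<circ> transpose a b)) = (\<Prod>k<n. emb (- int (transpose a b k)) (rfac (int (e (transpose a b k)) - int n)))"
    by (simp add: rprod_def ren.hom_prod ren_emb transpose_neg)
  also have "\<dots> = rprod n n e"
    unfolding rprod_def
    by (rule prod.reindex_bij_witness[of _ "transpose a b" "transpose a b"])
      (use ab transpose_mem_iff[of a "{..<n}" b] in simp_all)
  finally show "ren ?t (rprod n n (e \<circ> transpose a b)) = rprod n n e" .
qed

lemma Phi_repeat:
  assumes "sym_mps g" "a < n" "b < n" "a \<noteq> b" "e a = e b"
  shows "Phi n e g = 0"
proof -
  have "e \<circ> transpose a b = e" using assms(5) by (auto simp: transpose_def)
  then have "Phi n e g = - Phi n e g" using Phi_transpose[OF assms(1-4), of e] by simp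
  then have "2 * Phi n e g = 0" by (metis add_eq_0_iff2 mult_2)
  then show ?thesis by simp
qed

section \<open>Sorting exponents; the constant terms determine the series\<close>

lemma sum_transpose_lessThan:
  assumes "a < n" "b < n"
  shows "(\<Sum>k<n. f (transpose a b k)) = (\<Sum>k<n. f k :: nat)"
  by (rule sum.reindex_bij_witness[of _ "transpose a b" "transpose a b"])
    (use assms transpose_mem_iff[of a "{..<n}" b] in simp_all)

lemma exps_exist:
  assumes "\<And>k. Suc k < n \<Longrightarrow> e (Suc k) < e k"
  shows "\<exists>lam. len lam \<le> n \<and> (\<forall>k<n. e k = exps n lam k)"
proof -
  have ge: "n - 1 - k \<le> e k" if "k < n" for k
    using that
  proof (induction "n - 1 - k" arbitrary: k)
    case (Suc d)
    then have "Suc k < n" "d = n - 1 - Suc k" by auto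
    then show ?case using Suc.hyps(1)[of "Suc k"] assms[of k] Suc.hyps(2) by linarith
  qed simp
  define f where "f k = (if k < n then e k - (n - 1 - k) else 0)" for k
  have "f (Suc k) \<le> f k" for k
    using assms[of k] ge[of k] ge[of "Suc k"] by (auto simp: f_def)
  then obtain lam where lam: "\<forall>k. part lam (Suc k) = f k"
    using partition_exists[of f n] by (auto simp: f_def)
  have "len lam \<le> n" using lam part_eq_0_iff[of lam n] by (simp add: f_def)
  moreover have "e k = exps n lam k" if "k < n" for k
    using lam ge[OF that] that by (simp add: exps_def f_def)
  ultimately show ?thesis by blast
qed

text \<open>For statements alternating in e. Exchanging an ascending adjacent pair lowers the sum of
  k * e k, and a sequence without ascents and repetitions is \<open>exps n lam\<close> for some
  lam.\<close>

lemma exps_induct: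
  assumes swap: "\<And>e k. Suc k < n \<Longrightarrow> Q (e \<circ> transpose k (Suc k)) \<Longrightarrow> Q e"
    and repeat: "\<And>e k. Suc k < n \<Longrightarrow> e k = e (Suc k) \<Longrightarrow> Q e"
    and exps: "\<And>e lam. len lam \<le> n \<Longrightarrow> (\<And>k. k < n \<Longrightarrow> e k = exps n lam k) \<Longrightarrow> Q e"
  shows "Q e"
proof (induction "\<Sum>k<n. k * e k" arbitrary: e rule: less_induct)
  case less
  consider k where "Suc k < n" "e k = e (Suc k)" | k where "Suc k < n" "e k < e (Suc k)"
    | "\<And>k. Suc k < n \<Longrightarrow> e (Suc k) < e k"
    using linorder_less_linear by blast
  then show ?case
  proof cases
    case (1 k)
    then show ?thesis by (rule repeat)
  next
    case (2 k)
    let ?e = "e \<circ> transpose k (Suc k)"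
    have split: "{..<n} = insert k (insert (Suc k) ({..<n} - {k, Suc k}))" using 2 by auto
    have exp: "(\<Sum>j<n. f j) = f k + (f (Suc k) + (\<Sum>j\<in>{..<n} - {k, Suc k}. f j))" for f :: "nat \<Rightarrow> nat"
      by (subst split) simp
    have "(\<Sum>j\<in>{..<n} - {k, Suc k}. j * ?e j) = (\<Sum>j\<in>{..<n} - {k, Suc k}. j * e j)"
      by (rule sum.cong) (auto simp: transpose_def)
    then have "(\<Sum>j<n. j * ?e j) < (\<Sum>j<n. j * e j)"
      unfolding exp[of "\<lambda>j. j * ?e j"] exp[of "\<lambda>j. j * e j"] using 2 by simp
    then have "Q ?e" by (rule less)
    then show ?thesis by (rule swap[OF 2(1)])
  next
    case 3
    then obtain lam where "len lam \<le> n" "\<forall>k<n. e k = exps n lam k" using exps_exist by blast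
    then show ?thesis by (intro exps) auto
  qed
qed

text \<open>The size bound on lam becomes a degree bound on e that sorting preserves, so alternation
  spreads the vanishing from partitions to all such e.\<close>

lemma Phi_all_zero:
  assumes g: "sym_mps g" and z: "\<And>lam. psize lam \<le> n \<Longrightarrow> Phi n (exps n lam) g = 0"
    and e: "(\<Sum>k<n. e k) \<le> n + (\<Sum>k<n. n - 1 - k)"
  shows "Phi n e g = 0"
  using e
proof (induction e rule: exps_induct[where n = n])
  case (1 e k)
  have "(\<Sum>j<n. (e \<circ> transpose k (Suc k)) j) = (\<Sum>j<n. e j)"
    using sum_transpose_lessThan[of k n "Suc k" e] 1(1) by simp
  then have "Phi n (e \<circ> transpose k (Suc k)) g = 0" using 1(2,3) by (simp only:)
  moreover have "Phi n (e \<circ> transpose k (Suc k)) g = - Phi n e g"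
    by (rule Phi_transpose[OF g]) (use 1(1) in auto)
  ultimately show ?case by simp
next
  case (2 e k)
  then show ?case using Phi_repeat[OF g, of k n "Suc k" e] by simp
next
  case (3 e lam)
  have "(\<Sum>k<n. e k) = (\<Sum>k<n. exps n lam k)" by (rule sum.cong) (use 3 in auto)
  then have "psize lam \<le> n" using 3 by (simp add: sum_exps)
  then show ?case using Phi_cong[of n e "exps n lam" g] z[of lam] 3 by simp
qed

lemma coeff_rprod_0: "coeff_mps (rprod n N e) 0 = 1"
proof -
  interpret res: comm_ring_hom "res {} :: (int, qa) mps \<Rightarrow> _" by (rule res_hom)
  have "res {} (rprod n N e) = 1"
    by (simp add: rprod_def res.hom_prod res_emb rfac_nth_0)
  then have "coeff_mps (res {} (rprod n N e)) 0 = 1" by (simp add: coeff_mps_one)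
  then show ?thesis by (simp add: coeff_res)
qed

text \<open>\<open>rprod\<close> has constant term 1, so \<open>Phi n e g\<close> is the coefficient
  of \<open>vand n * g\<close> at e plus a combination of coefficients in smaller degree: a
  unitriangular system, solved by induction on the degree.\<close>

lemma vand_mult_zero:
  assumes z: "\<And>e. (\<Sum>k<n. e k) \<le> B \<Longrightarrow> Phi n e g = 0"
  shows "(\<Sum>k<n. e k) \<le> B \<Longrightarrow> coeff_mps (vand n * g) (mon n e) = 0"
proof (induction "\<Sum>k<n. e k" arbitrary: e rule: less_induct)
  case less
  let ?P = "rprod n n e" and ?F = "vand n * g"
  have "0 = Phi n e g" using z[OF less.prems] by simp
  also have "\<dots> = (\<Sum>(p, q)\<in>{(p, q). p + q = mon n e}. coeff_mps ?P p * coeff_mps ?F q)"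
    by (simp add: Phi_def coeff_mps_mult)
  also have "\<dots> = (\<Sum>(p, q)\<in>{(0, mon n e)}. coeff_mps ?P p * coeff_mps ?F q)"
  proof (rule sum.mono_neutral_right[OF finite_splits], goal_cases)
    case 2
    have zero: "coeff_mps ?F q = 0" if pq: "p + q = mon n e" "(p, q) \<noteq> (0, mon n e)" for p q
    proof -
      have "p \<noteq> 0" using pq by auto
      have "keys q \<subseteq> vars n"
        using keys_add_nat[of p q] keys_mon[of n e] by (simp add: pq)
      then have q: "q = mon n (\<lambda>k. lookup q (- int k))" by (rule mon_cover)
      have "mdeg p + mdeg q = (\<Sum>k<n. e k)"
        using arg_cong[OF pq(1), of mdeg] by (simp add: mdeg_add mdeg_mon)
      moreover have "mdeg p \<noteq> 0" using \<open>p \<noteq> 0\<close> by (simp add: mdeg_eq_0_iff)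
      moreover have "mdeg q = (\<Sum>k<n. lookup q (- int k))"
        by (subst q) (simp only: mdeg_mon)
      ultimately have "coeff_mps ?F (mon n (\<lambda>k. lookup q (- int k))) = 0"
        using less.prems by (intro less.hyps) auto
      then show ?thesis using q by simp
    qed
    show ?case
    proof
      fix x assume x: "x \<in> {(p, q). p + q = mon n e} - {(0, mon n e)}"
      obtain p q where pq: "x = (p, q)" by (cases x)
      then have "coeff_mps ?F q = 0" using x by (intro zero[of p]) auto
      then show "(case x of (p, q) \<Rightarrow> coeff_mps ?P p * coeff_mps ?F q) = 0" by (simp add: pq)
    qed
  qed auto
  finally show ?case by (simp add: coeff_rprod_0)
qed

text \<open>Divisibility is tested explicitly because subtraction of exponent vectors truncates at
  0.\<close>

lemma coeff_monom_mult:
  "coeff_mps (monom_mps q * g :: ('v, 'c :: comm_ring_1) mps) m =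
    (if \<forall>i. lookup q i \<le> lookup m i then coeff_mps g (m - q) else 0)"
proof -
  have eq: "q + (m - q) = m" if "\<forall>i. lookup q i \<le> lookup m i"
    by (rule poly_mapping_eqI) (simp add: lookup_add lookup_minus that)
  have "coeff_mps (monom_mps q * g) m =
      (\<Sum>(p, r)\<in>{(p, r). p + r = m} \<inter> {(q, m - q)}. coeff_mps (monom_mps q :: ('v, 'c) mps) p * coeff_mps g r)"
    unfolding coeff_mps_mult
    by (rule sum.mono_neutral_right[OF finite_splits]) (auto simp: coeff_monom_mps split: if_splits)
  also have "\<dots> = (if q + (m - q) = m then coeff_mps g (m - q) else 0)"
    by (auto simp: coeff_monom_mps)
  also have "q + (m - q) = m \<longleftrightarrow> (\<forall>i. lookup q i \<le> lookup m i)"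
  proof
    assume "q + (m - q) = m"
    then have "lookup m i = lookup q i + lookup (m - q) i" for i
      using lookup_add[of q "m - q" i] by simp
    then show "\<forall>i. lookup q i \<le> lookup m i" by simp
  qed (rule eq)
  finally show ?thesis .
qed

text \<open>Twice the sum is the sum of the squares (d k - d (p k))^2, since p only permutes the (d
  k)^2.\<close>

lemma rearrangement_strict:
  fixes d :: "nat \<Rightarrow> int"
  assumes p: "p permutes {0..<n}" and "p \<noteq> id" and inj: "inj_on d {0..<n}"
  shows "0 < (\<Sum>k = 0..<n. d k * (d k - d (p k)))"
proof -
  obtain k where k: "p k \<noteq> k" using \<open>p \<noteq> id\<close> by (auto simp: fun_eq_iff)
  then have "k < n" using p by (auto simp: permutes_def)
  moreover have "p k < n" using permutes_in_image[OF p, of k] \<open>k < n\<close> by simp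
  ultimately have "d k \<noteq> d (p k)" using inj_on_eq_iff[OF inj, of k "p k"] k by simp
  have "0 < (\<Sum>k = 0..<n. (d k - d (p k))\<^sup>2)"
    by (rule sum_pos2[of _ k]) (use \<open>k < n\<close> \<open>d k \<noteq> d (p k)\<close> in auto)
  also have "\<dots> = (\<Sum>k = 0..<n. (d k)\<^sup>2) + (\<Sum>k = 0..<n. (d (p k))\<^sup>2) - 2 * (\<Sum>k = 0..<n. d k * d (p k))"
    by (simp add: power2_diff sum.distrib sum_subtractf sum_distrib_left mult.assoc)
  also have "(\<Sum>k = 0..<n. (d (p k))\<^sup>2) = (\<Sum>k = 0..<n. (d k)\<^sup>2)"
    using sum.permute[OF p, of "\<lambda>k. (d k)\<^sup>2"] by (simp add: o_def)
  finally show ?thesis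
    by (simp add: right_diff_distrib sum_subtractf power2_eq_square)
qed

text \<open>Among the monomials \<open>\<epsilon> + \<delta> - w\<delta>\<close> the functional \<open>\<epsilon> \<mapsto> \<delta> \<cdot> \<epsilon>\<close> singles out \<open>w = 1\<close>.\<close>

lemma vand_cancel:
  assumes z: "\<And>e. (\<Sum>k<n. e k) \<le> d + (\<Sum>k<n. n - 1 - k) \<Longrightarrow>
      coeff_mps (vand n * g :: (int, 'c :: comm_ring_1) mps) (mon n e) = 0"
  shows "(\<Sum>k<n. e k) \<le> d \<Longrightarrow> coeff_mps g (mon n e) = 0"
proof (induction "n * d - (\<Sum>k<n. (n - 1 - k) * e k)" arbitrary: e rule: less_induct)
  case less
  define \<delta> where "\<delta> k = n - 1 - k" for k :: nat
  define f where "f k = e k + \<delta> k" for k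
  let ?t = "\<lambda>p. signof p * coeff_mps (monom_mps (mon n (\<lambda>k. \<delta> (Hilbert_Choice.inv p k))) * g) (mon n f)"
  have zero: "?t p = 0" if p: "p permutes {0..<n}" "p \<noteq> id" for p
  proof -
    let ?q = "Hilbert_Choice.inv p"
    have q: "?q permutes {0..<n}" by (rule permutes_inv[OF p(1)])
    have "?q \<noteq> id" using p by (metis permutes_inv_inv inv_id)
    let ?m = "mon n (\<lambda>k. \<delta> (?q k))"
    have "coeff_mps g (mon n f - ?m) = 0" if le: "\<forall>i. lookup ?m i \<le> lookup (mon n f) i"
    proof -
      define e' where "e' k = f k - \<delta> (?q k)" for k
      have le': "\<delta> (?q k) \<le> f k" if "k < n" for k
        using le[rule_format, of "- int k"] that by (simp add: lookup_mon_nat)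
      have m: "mon n f - ?m = mon n e'"
        by (rule poly_mapping_eqI) (simp add: lookup_minus lookup_mon e'_def)
      have e': "int (e' k) = int (e k) + (int (\<delta> k) - int (\<delta> (?q k)))" if "k < n" for k
        using le'[OF that] by (simp add: e'_def f_def of_nat_diff)
      have perm: "(\<Sum>k<n. int (\<delta> (?q k))) = (\<Sum>k<n. int (\<delta> k))"
        using sum.permute[OF q, of "\<lambda>k. int (\<delta> k)"] by (simp add: o_def lessThan_atLeast0)
      have "int (\<Sum>k<n. e' k) = int (\<Sum>k<n. e k)"
        by (simp add: e' sum.distrib sum_subtractf perm)
      then have s: "(\<Sum>k<n. e' k) = (\<Sum>k<n. e k)" by (simp only: of_nat_eq_iff)
      have "0 < (\<Sum>k = 0..<n. int (\<delta> k) * (int (\<delta> k) - int (\<delta> (?q k))))"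
        by (rule rearrangement_strict[OF q \<open>?q \<noteq> id\<close>]) (auto simp: inj_on_def \<delta>_def)
      moreover have "int (\<Sum>k<n. \<delta> k * e' k) = int (\<Sum>k<n. \<delta> k * e k) + (\<Sum>k<n. int (\<delta> k) * (int (\<delta> k) - int (\<delta> (?q k))))"
        by (simp add: e' distrib_left sum.distrib)
      ultimately have "int (\<Sum>k<n. \<delta> k * e k) < int (\<Sum>k<n. \<delta> k * e' k)"
        unfolding lessThan_atLeast0 by linarith
      then have W: "(\<Sum>k<n. \<delta> k * e k) < (\<Sum>k<n. \<delta> k * e' k)"
        by (simp only: of_nat_less_iff)
      \<comment> \<open>Gives \<delta> \<cdot> e' \<le> n * d, so that the truncated difference used
        as induction measure drops strictly.\<close>
      have "(\<Sum>k<n. \<delta> k * e' k) \<le> (\<Sum>k<n. n * e' k)"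
        by (rule sum_mono) (simp add: \<delta>_def)
      also have "\<dots> \<le> n * d" using less.prems s by (simp flip: sum_distrib_left)
      finally have "coeff_mps g (mon n e') = 0"
        using W less.prems s by (intro less.hyps) (auto simp: \<delta>_def)
      then show ?thesis by (simp add: m)
    qed
    then show ?thesis by (simp add: coeff_monom_mult)
  qed
  have "(\<Sum>k<n. f k) \<le> d + (\<Sum>k<n. n - 1 - k)"
    unfolding f_def \<delta>_def sum.distrib using less.prems by simp
  then have "0 = coeff_mps (vand n * g) (mon n f)" using z by simp
  also have "\<dots> = (\<Sum>p | p permutes {0..<n}. ?t p)"
    by (simp add: vand_def alternant_expand sum_distrib_right mult.assoc coeff_signof_mult \<delta>_def)
  also have "\<dots> = (\<Sum>p\<in>{id}. ?t p)"
    by (rule sum.mono_neutral_right) (auto simp: finite_permutations permutes_id zero)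
  also have "\<dots> = coeff_mps g (mon n f - mon n \<delta>)"
    by (simp add: coeff_monom_mult lookup_mon f_def)
  also have "mon n f - mon n \<delta> = mon n e"
    by (rule poly_mapping_eqI) (simp add: lookup_minus lookup_mon f_def)
  finally show ?case by simp
qed

text \<open>Inverts the passage from g to its constant terms: sort the exponents, remove
  \<open>rprod\<close> by unitriangularity, cancel the Vandermonde determinant. The threshold n0
  accommodates identities established for large n only.\<close>

lemma Phi_unique:
  assumes g: "sym_mps g" and z: "\<And>n lam. n0 \<le> n \<Longrightarrow> psize lam \<le> n \<Longrightarrow> Phi n (exps n lam) g = 0"
  shows "g = 0"
proof (rule mps_eqI)
  fix m
  show "coeff_mps g m = coeff_mps 0 m"
  proof (cases "keys m \<subseteq> {..0}")
    case True
    define M where "M = Max (insert 0 (uminus ` keys m))"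
    define N where "N = nat M"
    \<comment> \<open>Above the threshold and the degree of m, and large enough for
      \<open>vars n\<close> to contain the variables of m.\<close>
    define n where "n = n0 + mdeg m + Suc N"
    have "- int N \<le> i" if "i \<in> keys m" for i
    proof -
      have "- i \<le> M"
        unfolding M_def by (rule Max_ge) (use that in auto)
      then show ?thesis unfolding N_def by linarith
    qed
    then have "keys m \<subseteq> vars n"
      using True by (force simp: vars_def n_def)
    then have m: "m = mon n (\<lambda>k. lookup m (- int k))" by (rule mon_cover)
    have "n0 \<le> n" by (simp add: n_def)
    note 1 = Phi_all_zero[OF g z[OF this]]
    note 2 = vand_mult_zero[OF 1]
    have "(\<Sum>k<n. lookup m (- int k)) \<le> n"
      using arg_cong[OF m, of mdeg] by (simp add: mdeg_mon n_def)
    then have "coeff_mps g (mon n (\<lambda>k. lookup m (- int k))) = 0"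
      by (intro vand_cancel[OF 2]) auto
    then show ?thesis using m by simp
  next
    case False
    then show ?thesis using sym_coeffD(1)[OF g] by simp
  qed
qed

section \<open>Exchanging two parameters\<close>

text \<open>Unifies the cases of \<open>delta\<close>: for every i, \<alpha>_i times
  \<open>delta i f\<close> is to be f minus \<open>twist i\<close> times the exchanged f.\<close>

definition twist :: "int \<Rightarrow> (int, qa) mps" where
  "twist i = (if i = 0 then Omega else 1)"

lemma sym_twist: "sym_mps (twist i)"
  by (simp add: twist_def sym_Omega sym_1)

lemma res_twist: "res (vars n) (twist i) = (\<Prod>k<n. emb (- int k) (om i))"
proof -
  interpret res: comm_ring_hom "res (vars n) :: (int, qa) mps \<Rightarrow> _" by (rule res_hom)
  interpret emb: comm_ring_hom "emb v :: qa fps \<Rightarrow> (int, qa) mps" for v by (rule emb_hom)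
  have vars: "vars n = (\<lambda>k. - int k) ` {..<n}"
  proof (intro equalityI subsetI)
    fix i assume "i \<in> vars n"
    then show "i \<in> (\<lambda>k. - int k) ` {..<n}"
      by (intro image_eqI[of _ _ "nat (- i)"]) (auto simp: vars_def)
  qed (auto simp: vars_def)
  have P: "(\<Prod>k<n. emb (- int k) (om i)) = (\<Prod>k\<in>vars n. emb k (om i))"
    unfolding vars by (subst prod.reindex) (auto simp: inj_on_def)
  show ?thesis
  proof (cases "i = 0")
    case True
    have r: "res (vars n) (\<Prod>k\<in>vars n. emb k (om 0)) = (\<Prod>k\<in>vars n. emb k (om 0))"
      unfolding res.hom_prod by (rule prod.cong) (simp_all add: res_emb)
    have "res (vars n) Omega = res (vars n) (\<Prod>k\<in>vars n. emb k (om 0))"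
      by (rule mps_eqI) (simp add: coeff_res coeff_Omega[OF finite_vars vars_nonpos])
    then show ?thesis unfolding P using True r by (simp add: twist_def)
  qed (simp add: twist_def om_def)
qed

lemma map_mps_var:
  assumes "comm_ring_hom \<phi>"
  shows "map_mps \<phi> (var_mps v) = var_mps v"
proof -
  interpret comm_ring_hom \<phi> by fact
  show ?thesis by (rule mps_eqI) (simp add: var_mps_def coeff_monom_mps)
qed

lemma map_mps_vand:
  fixes \<phi> :: "'a :: comm_ring_1 \<Rightarrow> 'b :: comm_ring_1"
  assumes "comm_ring_hom \<phi>"
  shows "map_mps \<phi> (vand n) = vand n"
proof -
  interpret m: comm_ring_hom "map_mps \<phi> :: (int, 'a) mps \<Rightarrow> _" by (rule map_mps_hom[OF assms])
  show ?thesis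
    unfolding vand_def alternant_def dt_hom[OF map_mps_hom[OF assms]]
    by (intro dt_cong) (simp add: m.hom_power map_mps_var[OF assms])
qed

text \<open>A preimage of \<open>om i * rfac l\<close> under the exchange, by
  \<open>rfac_swap\<close>.\<close>

definition tfac :: "int \<Rightarrow> int \<Rightarrow> qa fps" where
  "tfac i l = rfac l + (if l = i then fps_const (alpha i) * (fps_X * rfac (i - 1)) else 0)"

text \<open>The exchange acts on coefficients and fixes the Vandermonde determinant. In n variables
  \<open>twist i\<close> is the product of the \<open>om i\<close>, which \<open>rfac_swap\<close>
  merges with \<open>rprod\<close>; so the whole product is an exchanged one and the exchange can be
  taken outside.\<close>

lemma Phi_twist_aux:
  "Phi n e (twist i * map_mps (swap_a i) g) = swap_a i (coeff_mps
     ((\<Prod>k<n. emb (- int k) (tfac i (int (e k) - int n)))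
      * (vand n * g)) (mon n e))"
proof -
  let ?S = "map_mps (swap_a i) :: (int, qa) mps \<Rightarrow> _"
  let ?P' = "\<Prod>k<n. emb (- int k) (tfac i (int (e k) - int n))"
  interpret S: comm_ring_hom ?S by (rule map_mps_hom[OF swap_a_hom])
  interpret s: comm_ring_hom "swap_a i" by (rule swap_a_hom)
  interpret res: comm_ring_hom "res (vars n) :: (int, qa) mps \<Rightarrow> _" by (rule res_hom)
  interpret emb: comm_ring_hom "emb v :: qa fps \<Rightarrow> (int, qa) mps" for v by (rule emb_hom)
  have Semb: "?S (emb k F) = emb k (map_fps (swap_a i) F)" for k F
    by (simp add: map_mps_emb map_fps_def)
  have P': "?S ?P' = (\<Prod>k<n. emb (- int k) (om i)) * rprod n n e"
    by (simp add: S.hom_prod Semb tfac_def rfac_swap emb.hom_mult prod.distrib rprod_def)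
  have cr: "coeff_mps (res (vars n) f) (mon n e) = coeff_mps f (mon n e)" for f :: "(int, qa) mps"
    by (simp add: coeff_res keys_mon)
  have rr: "res (vars n) (\<Prod>k<n. emb (- int k) (om i)) = (\<Prod>k<n. emb (- int k) (om i))"
    unfolding res.hom_prod by (rule prod.cong) (simp_all add: res_emb)
  have "Phi n e (twist i * ?S g) = coeff_mps (res (vars n) (rprod n n e * (vand n * (twist i * ?S g)))) (mon n e)"
    by (simp add: Phi_def cr)
  also have "res (vars n) (rprod n n e * (vand n * (twist i * ?S g))) =
      res (vars n) (((\<Prod>k<n. emb (- int k) (om i)) * rprod n n e) * (vand n * ?S g))"
    unfolding res.hom_mult res_twist rr by (simp only: ac_simps)
  also have "coeff_mps \<dots> (mon n e) = coeff_mps (?S (?P' * (vand n * g))) (mon n e)"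
    unfolding cr S.hom_mult P' map_mps_vand[OF swap_a_hom] by (rule refl)
  finally show ?thesis by simp
qed

lemma Phi_twist_fixed:
  assumes "\<And>k. k < n \<Longrightarrow> int (e k) \<noteq> i + int n"
  shows "Phi n e (twist i * map_mps (swap_a i) g) = swap_a i (Phi n e g)"
proof -
  have "(\<Prod>k<n. emb (- int k) (tfac i (int (e k) - int n))) = rprod n n e"
    unfolding rprod_def by (rule prod.cong) (use assms in \<open>auto simp: tfac_def algebra_simps\<close>)
  then show ?thesis unfolding Phi_twist_aux by (simp add: Phi_def)
qed

text \<open>Only the factor of row k differs from that in \<open>rprod\<close>. Its extra term
  carries one power of the variable \<open>- int k\<close>, which lowers the extracted exponent by
  1, in step with the lowered factorial power \<open>rfac (i - 1)\<close>.\<close>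

lemma Phi_twist_moved:
  assumes k: "k < n" "int (e k) = i + int n" and pos: "0 < e k"
    and other: "\<And>l. l < n \<Longrightarrow> l \<noteq> k \<Longrightarrow> e l \<noteq> e k"
  shows "Phi n e (twist i * map_mps (swap_a i) g) =
    swap_a i (Phi n e g + alpha i * Phi n (e(k := e k - 1)) g)"
proof -
  interpret emb: comm_ring_hom "emb v :: qa fps \<Rightarrow> (int, qa) mps" for v by (rule emb_hom)
  let ?e = "e(k := e k - 1)"
  let ?Q = "\<Prod>l\<in>{..<n} - {k}. emb (- int l) (rfac (int (e l) - int n))"
  have r: "rprod n n e = emb (- int k) (rfac i) * ?Q"
    unfolding rprod_def by (subst prod.remove[of _ k]) (use k in auto)
  have r': "rprod n n ?e = emb (- int k) (rfac (i - 1)) * ?Q"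
  proof -
    have "int (?e k) - int n = i - 1" using k pos by (simp add: of_nat_diff)
    then show ?thesis
      unfolding rprod_def by (subst prod.remove[of _ k]) (use k in \<open>auto intro!: prod.cong\<close>)
  qed
  have "(\<Prod>l<n. emb (- int l) (tfac i (int (e l) - int n)))
      = emb (- int k) (rfac i + fps_const (alpha i) * (fps_X * rfac (i - 1))) * ?Q"
  proof (subst prod.remove[of _ k], goal_cases)
    case 3
    have "(\<Prod>l\<in>{..<n} - {k}. emb (- int l) (tfac i (int (e l) - int n))) = ?Q"
    proof (rule prod.cong)
      fix l assume l: "l \<in> {..<n} - {k}"
      then have "int (e l) \<noteq> int (e k)" using other[of l] by simp
      then have "int (e l) - int n \<noteq> i" using k by auto
      then show "emb (- int l) (tfac i (int (e l) - int n)) = emb (- int l) (rfac (int (e l) - int n))"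
        by (simp add: tfac_def)
    qed simp
    then show ?case using k by (simp add: tfac_def)
  qed (use k in auto)
  also have "\<dots> = rprod n n e + const_mps (alpha i) * (var_mps (- int k) * rprod n n ?e)"
    unfolding r r' by (simp add: emb.hom_add emb.hom_mult algebra_simps)
  finally have P': "(\<Prod>l<n. emb (- int l) (tfac i (int (e l) - int n)))
      = rprod n n e + const_mps (alpha i) * (var_mps (- int k) * rprod n n ?e)" .
  have "coeff_mps (var_mps (- int k) * (rprod n n ?e * (vand n * g))) (mon n e) = Phi n ?e g"
    using k pos mon_minus_single[OF k(1), of e 1] by (simp add: coeff_var_mult lookup_mon_nat Phi_def del: single_diff)
  then have "coeff_mps ((rprod n n e + const_mps (alpha i) * (var_mps (- int k) * rprod n n ?e)) * (vand n * g)) (mon n e)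
      = Phi n e g + alpha i * Phi n ?e g"
    by (simp add: distrib_right mult.assoc Phi_def)
  then show ?thesis unfolding Phi_twist_aux P' by simp
qed

section \<open>Values on Schur functions\<close>

lemma coeff_mult_schur_series:
  assumes "mdeg m \<le> d"
  shows "coeff_mps (f * schur_series c) m = (\<Sum>nu | psize nu \<le> d. c nu * coeff_mps (f * schur_gen nu) m)"
proof -
  have "coeff_mps (f * schur_series c) m = (\<Sum>x\<in>{(p, q). p + q = m}.
      \<Sum>nu | psize nu \<le> d. c nu * (coeff_mps f (fst x) * coeff_mps (schur_gen nu) (snd x)))"
    unfolding coeff_mps_mult
  proof (rule sum.cong)
    fix x assume x: "x \<in> {(p, q). p + q = m}"
    obtain p q where pq: "x = (p, q)" "p + q = m" using x by auto
    have "mdeg q \<le> d" using assms mdeg_add[of p q] pq by simp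
    then show "(case x of (p, q) \<Rightarrow> coeff_mps f p * coeff_mps (schur_series c) q) =
        (\<Sum>nu | psize nu \<le> d. c nu * (coeff_mps f (fst x) * coeff_mps (schur_gen nu) (snd x)))"
      by (simp add: pq coeff_schur_series sum_distrib_left mult.left_commute)
  qed simp
  also have "\<dots> = (\<Sum>nu | psize nu \<le> d. c nu * coeff_mps (f * schur_gen nu) m)"
    by (subst sum.swap) (simp add: coeff_mps_mult sum_distrib_left case_prod_unfold)
  finally show ?thesis .
qed

text \<open>If the sizes agree, both lengths are at most n and \<open>coeff_vand_schur_gen\<close>
  applies; otherwise the degrees differ.\<close>

lemma coeff_vand_schur_gen_any:
  assumes "psize kap \<le> n"
  shows "coeff_mps (vand n * schur_gen nu :: (int, 'c :: comm_ring_1) mps) (mon n (exps n kap))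
    = (if nu = kap then 1 else 0)"
proof (cases "psize nu = psize kap")
  case True
  then show ?thesis
    using coeff_vand_schur_gen[of nu n kap] len_le_psize[of nu] len_le_psize[of kap] assms by simp
next
  case False
  have "homog ((\<Sum>k<n. n - 1 - k) + psize nu) (vand n * schur_gen nu :: (int, 'c) mps)"
    by (rule homog_mult[OF homog_vand homog_schur_gen])
  moreover have "mdeg (mon n (exps n kap)) = psize kap + (\<Sum>k<n. n - 1 - k)"
    using len_le_psize[of kap] assms by (simp only: mdeg_mon sum_exps)
  ultimately have "coeff_mps (vand n * schur_gen nu :: (int, 'c) mps) (mon n (exps n kap)) = 0"
    using False unfolding homog_def by fastforce
  then show ?thesis using False by auto
qed

lemma coeff_vand_schur_series:
  assumes "psize kap \<le> n"
  shows "coeff_mps (vand n * schur_series c) (mon n (exps n kap)) = c kap"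
proof -
  let ?d = "mdeg (mon n (exps n kap)) + psize kap"
  have "coeff_mps (vand n * schur_series c) (mon n (exps n kap)) =
      (\<Sum>nu | psize nu \<le> ?d. c nu * (if nu = kap then 1 else 0))"
    using coeff_mult_schur_series[of "mon n (exps n kap)" ?d "vand n" c]
    by (simp add: coeff_vand_schur_gen_any[OF assms])
  also have "\<dots> = (\<Sum>nu\<in>{kap}. c nu * (if nu = kap then 1 else 0))"
    by (rule sum.mono_neutral_right) (auto simp: finite_psize_le)
  finally show ?thesis by simp
qed

lemma hat_coords_schur_series: "hat_coords (schur_series c) = c"
  unfolding hat_coords_def
proof (rule the_equality)
  fix d assume "schur_series c = schur_series d"
  then show "d = c"
    using coeff_vand_schur_series[OF order_refl] by (metis ext)
qed simp

lemma coeff_mult_homog: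
  assumes "homog d F" "mdeg m \<le> d"
  shows "coeff_mps (P * F) m = coeff_mps P 0 * coeff_mps F m"
proof -
  have "coeff_mps (P * F) m = (\<Sum>(p, q)\<in>{(0, m)}. coeff_mps P p * coeff_mps F q)"
    unfolding coeff_mps_mult
  proof (rule sum.mono_neutral_right[OF finite_splits], goal_cases)
    case 2
    show ?case
    proof
      fix x assume x: "x \<in> {(p, q). p + q = m} - {(0, m)}"
      obtain p q where pq: "x = (p, q)" "p + q = m" "p \<noteq> 0" using x by (cases x) auto
      have "mdeg q \<noteq> d"
        using pq assms(2) mdeg_add[of p q] mdeg_eq_0_iff[of p] by auto
      then have "coeff_mps F q = 0" using assms(1) by (auto simp: homog_def)
      then show "(case x of (p, q) \<Rightarrow> coeff_mps P p * coeff_mps F q) = 0" by (simp add: pq)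
    qed
  qed auto
  then show ?thesis by simp
qed

text \<open>The Vandermonde determinant times s_nu has at least the degree at which the coefficient
  is taken, so \<open>rprod\<close> enters through its constant term 1 only.\<close>

lemma Phi_schur_gen:
  assumes "psize kap \<le> n" "psize kap \<le> psize nu"
  shows "Phi n (exps n kap) (schur_gen nu) = (if nu = kap then 1 else 0)"
proof -
  have "homog ((\<Sum>k<n. n - 1 - k) + psize nu) (vand n * schur_gen nu :: (int, qa) mps)"
    by (rule homog_mult[OF homog_vand homog_schur_gen])
  moreover have "mdeg (mon n (exps n kap)) = psize kap + (\<Sum>k<n. n - 1 - k)"
    using len_le_psize[of kap] assms by (simp only: mdeg_mon sum_exps)
  ultimately have "Phi n (exps n kap) (schur_gen nu) = coeff_mps (rprod n n (exps n kap)) 0 *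
      coeff_mps (vand n * schur_gen nu) (mon n (exps n kap))"
    unfolding Phi_def using assms(2) by (intro coeff_mult_homog) auto
  then show ?thesis by (simp add: coeff_rprod_0 coeff_vand_schur_gen_any[OF assms(1)])
qed

lemma Phi_schur_series:
  assumes "psize kap \<le> n"
  shows "Phi n (exps n kap) (schur_series c) = c kap +
    (\<Sum>nu | psize nu < psize kap. c nu * Phi n (exps n kap) (schur_gen nu))"
proof -
  let ?d = "mdeg (mon n (exps n kap)) + psize kap"
  let ?t = "\<lambda>nu. c nu * Phi n (exps n kap) (schur_gen nu)"
  have fin: "finite {nu. psize nu < psize kap}"
    by (rule finite_subset[OF _ finite_psize_le[of "psize kap"]]) auto
  have "Phi n (exps n kap) (schur_series c) = (\<Sum>nu | psize nu \<le> ?d. ?t nu)"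
    using coeff_mult_schur_series[of "mon n (exps n kap)" ?d "rprod n n (exps n kap) * vand n" c]
    by (simp add: Phi_def mult.assoc)
  also have "\<dots> = (\<Sum>nu\<in>insert kap {nu. psize nu < psize kap}. ?t nu)"
    by (rule sum.mono_neutral_right) (auto simp: finite_psize_le Phi_schur_gen[OF assms] not_less)
  also have "\<dots> = c kap + (\<Sum>nu | psize nu < psize kap. ?t nu)"
    using fin by (simp add: Phi_schur_gen[OF assms])
  finally show ?thesis .
qed

text \<open>Solves the unitriangular system of \<open>Phi_schur_series\<close> by recursion on the
  size of kap, using the smallest admissible n = \<open>psize kap\<close>.\<close>

function dual_coeff :: "partition \<Rightarrow> partition \<Rightarrow> qa" where
  "dual_coeff mu kap = (if kap = mu then 1 else 0) -
    (\<Sum>nu | psize nu < psize kap. dual_coeff mu nu * Phi (psize kap) (exps (psize kap) kap) (schur_gen nu))"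
  by auto
termination by (relation "measure (\<lambda>(mu, kap). psize kap)") auto

declare dual_coeff.simps [simp del]

lemma Phi_dual_coeff:
  "Phi (psize kap) (exps (psize kap) kap) (schur_series (dual_coeff mu)) = (if kap = mu then 1 else 0)"
  unfolding Phi_schur_series[OF order_refl] by (subst dual_coeff.simps) simp

lemma schur_gen_empty: "psize lam = 0 \<Longrightarrow> schur_gen lam = 1"
  using len_le_psize[of lam] by (simp add: schur_gen_def dt_def)

text \<open>For \<open>\<kappa> \<noteq> \<emptyset>\<close> the factor \<open>rfac\<close> of \<open>y\<^sub>0\<close> is a polynomial of degree \<open>\<kappa>\<^sub>1 - 1\<close>, so that the degree
  in \<open>y\<^sub>0\<close> of its product with the Vandermonde determinant is too small.\<close>

lemma Phi_one:
  assumes "psize kap \<le> n"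
  shows "Phi n (exps n kap) 1 = (if psize kap = 0 then 1 else 0)"
proof (cases "psize kap = 0")
  case True
  then show ?thesis using Phi_schur_gen[of kap n kap] schur_gen_empty[of kap, where ?'a = qa] assms by simp
next
  case False
  \<comment> \<open>\<open>low G\<close> says that G has degree less than n in y_0; multiplication
    by series in other variables preserves this.\<close>
  define low where "low G \<longleftrightarrow> (\<forall>m. n \<le> lookup m 0 \<longrightarrow> coeff_mps G m = 0)" for G :: "(int, qa) mps"
  have n: "0 < n" using False assms by simp
  have "part kap (Suc 0) \<noteq> 0" using False by (auto simp: psize_0_iff part_eq_0_iff)
  then have e0: "n \<le> exps n kap 0" by (simp add: exps_def)
  have lowv: "low (vand n)"
    unfolding low_def vand_def coeff_alternant
  proof (intro allI impI sum.neutral ballI)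
    fix m :: "int \<Rightarrow>\<^sub>0 nat" and p assume m: "n \<le> lookup m 0"
    have "m \<noteq> mon n (\<lambda>k. n - 1 - Hilbert_Choice.inv p k)"
      using m n lookup_mon_nat[of 0 n "\<lambda>k. n - 1 - Hilbert_Choice.inv p k"] by auto
    then show "signof p * (if m = mon n (\<lambda>k. n - 1 - Hilbert_Choice.inv p k) then 1 else 0) = (0 :: qa)" by simp
  qed
  have low_emb: "low (emb k F * G)" if "low G" "k \<noteq> 0" for k F G
    using that by (simp add: low_def coeff_emb_mult lookup_minus lookup_single)
  have "low ((\<Prod>k\<in>I. emb (- int k) (F k)) * vand n)" if "0 \<notin> I" "finite I" for I F
    using that(2,1)
  proof (induction I rule: finite_induct)
    case (insert k I)
    then show ?case using low_emb[of "(\<Prod>k\<in>I. emb (- int k) (F k)) * vand n" "- int k" "F k"]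
      by (simp add: mult.assoc)
  qed (simp add: lowv)
  then have L: "low ((\<Prod>k\<in>{..<n} - {0}. emb (- int k) (rfac (int (exps n kap k) - int n))) * vand n)"
    by simp
  let ?F = "rfac (int (exps n kap 0) - int n)"
  let ?G = "(\<Prod>k\<in>{..<n} - {0}. emb (- int k) (rfac (int (exps n kap k) - int n))) * vand n"
  have "rprod n n (exps n kap) * (vand n * 1) = emb 0 ?F * ?G"
    unfolding rprod_def by (subst prod.remove[of _ 0]) (use n in \<open>auto simp: mult.assoc\<close>)
  then have "Phi n (exps n kap) 1 = (\<Sum>s\<le>exps n kap 0. fps_nth ?F s *
      coeff_mps ?G (mon n (exps n kap) - single 0 s))"
    using lookup_mon_nat[OF n, of "exps n kap"] by (simp add: Phi_def coeff_emb_mult)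
  also have "\<dots> = 0"
  proof (intro sum.neutral ballI)
    fix s assume "s \<in> {..exps n kap 0}"
    show "fps_nth ?F s * coeff_mps ?G (mon n (exps n kap) - single 0 s) = 0"
    \<comment> \<open>Either s exceeds the degree of \<open>?F\<close>, or at least n powers of y_0
      are left for \<open>?G\<close>.\<close>
    proof (cases "int (exps n kap 0) - int n < int s")
      case True
      then show ?thesis using e0 by (simp add: rfac_nth_big)
    next
      case False
      then have "n \<le> lookup (mon n (exps n kap) - single 0 s) 0"
        using lookup_mon_nat[OF n, of "exps n kap"] e0 by (simp add: lookup_minus)
      then show ?thesis using L by (simp add: low_def)
    qed
  qed
  finally show ?thesis using False by simp
qed

section \<open>Power sums and the functions \<open>h\<^sub>r(x/a)\<close>\<close>

lemma coeff_p_y: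
  assumes "k \<ge> 1"
  shows "coeff_mps (p_y k) m = (if \<exists>i\<le>0. m = single i k then 1 else 0)"
proof -
  let ?c = "\<lambda>i. if m = single i k then 1 else 0 :: rat"
  have "coeff_mps (p_y k) m = (\<Sum>i \<in> {i \<in> {..0}. ?c i \<noteq> 0}. ?c i)"
    by (simp add: p_y_def formal_sum_def var_power coeff_monom_mps)
  also have "\<dots> = (if \<exists>i\<le>0. m = single i k then 1 else 0)"
  proof (cases "\<exists>i\<le>0. m = single i k")
    case True
    then obtain j where j: "j \<le> 0" "m = single j k" by auto
    then have "{i \<in> {..0}. ?c i \<noteq> 0} = {j}" by (auto simp: single_eq_iff_pos[OF assms])
    then show ?thesis using j by auto
  next
    case False
    then have "{i \<in> {..0}. ?c i \<noteq> 0} = {}" by auto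
    then show ?thesis using False by simp
  qed
  finally show ?thesis .
qed

lemma coeff_p_y_mult:
  assumes k: "k \<ge> 1"
  shows "coeff_mps (p_y k * g) m =
    (\<Sum>i | i \<in> keys m \<and> i \<le> 0 \<and> k \<le> lookup m i. coeff_mps g (m - single i k))"
proof -
  let ?I = "{i. i \<in> keys m \<and> i \<le> 0 \<and> k \<le> lookup m i}"
  let ?f = "\<lambda>i. (single i k, m - single i k)"
  have inj: "inj_on ?f ?I" by (auto simp: inj_on_def single_eq_iff_pos[OF k])
  have "coeff_mps (p_y k * g) m = (\<Sum>(p, q)\<in>?f ` ?I. coeff_mps (p_y k) p * coeff_mps g q)"
    unfolding coeff_mps_mult
  proof (rule sum.mono_neutral_right[OF finite_splits], goal_cases)
    case 1
    then show ?case using single_add_minus by auto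
  next
    case 2
    show ?case
    proof
      fix x assume x: "x \<in> {(p, q). p + q = m} - ?f ` ?I"
      obtain p q where pq: "x = (p, q)" "p + q = m" using x by auto
      have "\<not> (\<exists>i\<le>0. p = single i k)"
      proof
        assume "\<exists>i\<le>0. p = single i k"
        then obtain i where i: "i \<le> 0" "p = single i k" by auto
        then have "k \<le> lookup m i" using pq by (auto simp: lookup_add)
        moreover have "q = m - single i k" using pq i by auto
        ultimately have "x \<in> ?f ` ?I" using i k pq by (auto simp: in_keys_iff intro!: image_eqI[of _ _ i])
        then show False using x by simp
      qed
      then show "(case x of (p, q) \<Rightarrow> coeff_mps (p_y k) p * coeff_mps g q) = 0"
        by (auto simp: pq coeff_p_y[OF k])
    qed
  qed
  also have "\<dots> = (\<Sum>i\<in>?I. coeff_mps (p_y k) (single i k) * coeff_mps g (m - single i k))"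
    by (simp add: sum.reindex[OF inj])
  also have "\<dots> = (\<Sum>i\<in>?I. coeff_mps g (m - single i k))"
  proof (rule sum.cong)
    fix i assume "i \<in> ?I"
    then have "\<exists>j\<le>0. single i k = single j k" by blast
    then show "coeff_mps (p_y k) (single i k) * coeff_mps g (m - single i k) =
        coeff_mps g (m - single i k)"
      unfolding coeff_p_y[OF k] by simp
  qed simp
  finally show ?thesis .
qed

lemma newton_y: "const_mps (of_nat r) * h_y (int r) = (\<Sum>k = 1..r. p_y k * h_y (int r - int k))"
proof (rule mps_eqI)
  fix m :: "int \<Rightarrow>\<^sub>0 nat"
  let ?I = "\<lambda>k. {i. i \<in> keys m \<and> i \<le> 0 \<and> k \<le> lookup m i}"
  have fI: "finite (?I k)" for k by (rule finite_subset[OF _ finite_keys[of m]]) auto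
  have t: "coeff_mps (h_y (int r - int k)) (m - single i k) =
      (if keys m \<subseteq> {..0} \<and> mdeg m = r then 1 else 0)"
    if "i \<in> ?I k" for i k
  proof -
    let ?m = "m - single i k"
    have m: "m = single i k + ?m" using that single_add_minus[of k m i] by simp
    have "mdeg m = k + mdeg ?m" by (subst m) (simp only: mdeg_add mdeg_single)
    moreover have "keys m \<subseteq> {..0} \<longleftrightarrow> keys ?m \<subseteq> {..0}"
      by (subst m) (use that in \<open>auto simp only: keys_add_nat, auto split: if_splits\<close>)
    ultimately show ?thesis by (auto simp: h_y_eq coeff_h_in)
  qed
  have "coeff_mps (\<Sum>k = 1..r. p_y k * h_y (int r - int k)) m =
      (\<Sum>k = 1..r. \<Sum>i\<in>?I k. if keys m \<subseteq> {..0} \<and> mdeg m = r then 1 else 0)"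
    unfolding coeff_mps_sum by (rule sum.cong) (auto simp: coeff_p_y_mult t simp del: h_y_eq)
  also have "\<dots> = of_nat r * (if keys m \<subseteq> {..0} \<and> mdeg m = r then 1 else 0)"
  proof (cases "keys m \<subseteq> {..0} \<and> mdeg m = r")
    case True
    have le: "lookup m i \<le> r" for i
    proof (cases "i \<in> keys m")
      case True
      then have "lookup m i \<le> mdeg m" unfolding mdeg_def by (intro member_le_sum) auto
      then show ?thesis using \<open>_ \<and> mdeg m = r\<close> by simp
    qed (simp add: in_keys_iff)
    have "(\<Sum>k = 1..r. card (?I k)) = (\<Sum>k = 1..r. \<Sum>i\<in>keys m. if k \<le> lookup m i then 1 else 0)"
    proof (rule sum.cong)
      fix k
      have "?I k = {i \<in> keys m. k \<le> lookup m i}" using True by auto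
      then show "card (?I k) = (\<Sum>i\<in>keys m. if k \<le> lookup m i then 1 else 0)"
        by (simp add: sum.If_cases Int_def)
    qed simp
    also have "\<dots> = (\<Sum>i\<in>keys m. \<Sum>k = 1..r. if k \<le> lookup m i then 1 else 0)"
      by (rule sum.swap)
    also have "\<dots> = (\<Sum>i\<in>keys m. lookup m i)"
    proof (rule sum.cong)
      fix i
      have "{1..r} \<inter> {k. k \<le> lookup m i} = {1..lookup m i}" using le[of i] by auto
      then show "(\<Sum>k = 1..r. if k \<le> lookup m i then 1 else 0) = lookup m i"
        by (simp add: sum.If_cases)
    qed simp
    also have "\<dots> = r" using True by (simp add: mdeg_def)
    finally have "of_nat (\<Sum>k = 1..r. card (?I k)) = (of_nat r :: rat)" by simp
    then show ?thesis using True by simp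
  qed auto
  also have "\<dots> = coeff_mps (const_mps (of_nat r) * h_y (int r)) m"
    by (simp add: h_y_eq coeff_h_in)
  finally show "coeff_mps (const_mps (of_nat r) * h_y (int r)) m =
      coeff_mps (\<Sum>k = 1..r. p_y k * h_y (int r - int k)) m" by simp
qed

section \<open>Algebraic independence of the power sums\<close>

definition pev_y :: "((nat \<Rightarrow>\<^sub>0 nat) \<Rightarrow>\<^sub>0 rat) \<Rightarrow> (int, rat) mps" where
  "pev_y = poly_eval const_mps (\<lambda>n. p_y (Suc n))"

definition pev_x :: "((nat \<Rightarrow>\<^sub>0 nat) \<Rightarrow>\<^sub>0 rat) \<Rightarrow> (xa_var, rat) mps" where
  "pev_x = poly_eval const_mps (\<lambda>n. p_xa (Suc n))"

abbreviation pmon :: "(nat \<Rightarrow>\<^sub>0 nat) \<Rightarrow> (int, rat) mps" where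
  "pmon \<equiv> monom_eval (\<lambda>n. p_y (Suc n))"

lemma nat_monom_induct [case_names zero add]:
  assumes "P 0" "\<And>M n. P M \<Longrightarrow> P (single n 1 + M)"
  shows "P (M :: nat \<Rightarrow>\<^sub>0 nat)"
proof (induction "mdeg M" arbitrary: M)
  case 0
  then show ?case using assms(1) by (metis mdeg_eq_0_iff)
next
  case (Suc d)
  then have "M \<noteq> 0" by auto
  then obtain n where "n \<in> keys M" using keys_eq_empty_nat[of M] by blast
  then have n: "1 \<le> lookup M n" by (simp add: in_keys_iff)
  let ?M = "M - single n 1"
  have M: "single n 1 + ?M = M" using n by (rule single_add_minus)
  have "mdeg M = 1 + mdeg ?M" by (subst M[symmetric]) (simp only: mdeg_add mdeg_single)
  then have "mdeg ?M = d" using Suc.hyps(2) by linarith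
  then have "P ?M" using Suc.hyps(1) by simp
  then show ?case using assms(2)[of ?M n] M by simp
qed

lemma pmon_add: "pmon (single n 1 + M) = p_y (Suc n) * pmon M"
  by (simp add: monom_eval_add)

lemma pmon_nonneg: "0 \<le> coeff_mps (pmon M) m"
proof (induction M arbitrary: m rule: nat_monom_induct)
  case (add M n)
  then show ?case unfolding pmon_add by (simp add: coeff_p_y_mult sum_nonneg)
qed (simp add: coeff_mps_one)

text \<open>The algebraic independence of the power sums rests on the monomials with as many variables as
  there are factors in a product of power sums.\<close>

lemma pmon_spread:
  assumes "mdeg M \<le> card (keys m)" "coeff_mps (pmon M) m \<noteq> 0"
  shows "mdeg M = card (keys m) \<and>
    (\<forall>l. lookup M l = card {i. lookup m i = Suc l})"
  using assms
proof (induction M arbitrary: m rule: nat_monom_induct)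
  case zero
  then have "m = 0" by (auto simp: coeff_mps_one split: if_splits)
  then show ?case by simp
next
  case (add M n)
  have "(\<Sum>i | i \<in> keys m \<and> i \<le> 0 \<and> Suc n \<le> lookup m i.
      coeff_mps (pmon M) (m - single i (Suc n))) \<noteq> 0"
    using add.prems(2) unfolding pmon_add by (simp add: coeff_p_y_mult)
  then obtain i where i: "Suc n \<le> lookup m i"
    and c: "coeff_mps (pmon M) (m - single i (Suc n)) \<noteq> 0"
    by (auto elim: sum.not_neutral_contains_not_neutral)
  let ?m = "m - single i (Suc n)"
  have lk: "lookup ?m j = (if j = i then lookup m i - Suc n else lookup m j)" for j
    by (simp add: lookup_minus lookup_single when_def)
  have sub: "keys m - {i} \<subseteq> keys ?m" "keys ?m \<subseteq> keys m"
    using i by (auto simp: in_keys_iff lk split: if_splits)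
  have ik: "i \<in> keys m" using i by (simp add: in_keys_iff)
  have "card (keys m) - 1 \<le> card (keys ?m)"
    using card_mono[OF _ sub(1)] ik by simp
  moreover have dM: "mdeg (single n 1 + M) = Suc (mdeg M)" by (simp add: mdeg_add)
  ultimately have "mdeg M \<le> card (keys ?m)" using add.prems(1) by simp
  note IH = add.IH[OF this c]
  have "i \<notin> keys ?m"
  proof
    assume "i \<in> keys ?m"
    then have "keys ?m = keys m" using sub by auto
    then show False using IH add.prems(1) dM by simp
  qed
  then have k: "keys ?m = keys m - {i}" and l0: "lookup ?m i = 0"
    using sub by (blast, simp only: in_keys_iff simp_thms)
  have mi: "lookup m i = Suc n"
    using i l0 lk[of i] by simp
  have "card (keys m) = Suc (card (keys ?m))"
    unfolding k by (rule card_Suc_Diff1[OF finite_keys ik, symmetric])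
  moreover have "lookup (single n 1 + M) l = card {j. lookup m j = Suc l}" for l
  proof -
    define S where "S = {j. lookup ?m j = Suc l}"
    have f: "finite S"
      unfolding S_def by (rule finite_subset[OF _ finite_keys[of ?m]]) (auto simp: in_keys_iff)
    have i: "i \<notin> S" using mi by (simp add: S_def lk)
    have "{j. lookup m j = Suc l} = (if l = n then insert i S else S)"
      using mi by (auto simp: S_def lk split: if_splits)
    then have "card {j. lookup m j = Suc l} = (if l = n then 1 else 0) + card S"
      using f i by simp
    moreover have "card S = lookup M l" using IH by (simp add: S_def)
    ultimately show ?thesis by (simp add: lookup_add lookup_single when_def)
  qed
  ultimately show ?case using IH dM by simp
qed

text \<open>Each factor is given a fresh variable; \<open>pmon_nonneg\<close> excludes
  cancellation.\<close>

lemma pmon_spread_exists: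
  "\<exists>m. card (keys m) = mdeg M \<and> 0 < coeff_mps (pmon M) m"
proof (induction M rule: nat_monom_induct)
  case zero
  show ?case by (rule exI[of _ 0]) (simp add: coeff_mps_one)
next
  case (add M n)
  then obtain m where m: "card (keys m) = mdeg M" "0 < coeff_mps (pmon M) m" by blast
  have "infinite {..(0 :: int)}" by (simp add: infinite_Iic)
  then obtain j where j: "j \<le> 0" "j \<notin> keys m"
    by (metis atMost_iff finite_keys rev_finite_subset subsetI)
  let ?m = "single j (Suc n) + m"
  have "?m - single j (Suc n) = m" by simp
  moreover have "j \<in> keys ?m" "Suc n \<le> lookup ?m j"
    by (auto simp: in_keys_iff lookup_add)
  ultimately have "coeff_mps (pmon M) m \<le> (\<Sum>i | i \<in> keys ?m \<and> i \<le> 0 \<and> Suc n \<le> lookup ?m i.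
      coeff_mps (pmon M) (?m - single i (Suc n)))"
    using j pmon_nonneg
      member_le_sum[of j "{i. i \<in> keys ?m \<and> i \<le> 0 \<and> Suc n \<le> lookup ?m i}"
        "\<lambda>i. coeff_mps (pmon M) (?m - single i (Suc n))"]
    by simp
  then have "0 < coeff_mps (pmon (single n 1 + M)) ?m"
    unfolding pmon_add using m(2) by (simp add: coeff_p_y_mult)
  moreover have "card (keys ?m) = mdeg (single n 1 + M)"
    using j m(1) by (simp add: keys_add_nat mdeg_add)
  ultimately show ?case by blast
qed

lemma pev_y_hom: "comm_ring_hom pev_y" and pev_x_hom: "comm_ring_hom pev_x"
  unfolding pev_y_def pev_x_def by (rule poly_eval_hom[OF const_mps_hom])+

text \<open>A product of maximal degree in F contains a monomial with as many variables as factors.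
  By \<open>pmon_spread\<close> this monomial determines the product, so no other term of F
  contributes to its coefficient.\<close>

lemma pev_y_eq_0: "pev_y F = 0 \<Longrightarrow> F = 0"
proof (rule ccontr)
  assume z: "pev_y F = 0" and "F \<noteq> 0"
  then have ne: "keys F \<noteq> {}"
    by (metis empty_iff in_keys_iff lookup_zero poly_mapping_eqI)
  define D where "D = Max (mdeg ` keys F)"
  have "D \<in> mdeg ` keys F" unfolding D_def by (rule Max_in) (use ne in auto)
  then obtain M where M: "M \<in> keys F" "mdeg M = D" by auto
  have D: "mdeg M' \<le> D" if "M' \<in> keys F" for M'
    unfolding D_def by (rule Max_ge) (use that in auto)
  obtain m where m: "card (keys m) = mdeg M" "0 < coeff_mps (pmon M) m"
    using pmon_spread_exists by blast
  have o: "coeff_mps (pmon M') m = 0" if M': "M' \<in> keys F" "M' \<noteq> M" for M'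
  proof (rule ccontr)
    assume "coeff_mps (pmon M') m \<noteq> 0"
    then have "\<forall>l. lookup M' l = card {i. lookup m i = Suc l}"
      using pmon_spread[of M' m] D[OF M'(1)] m M by simp
    moreover have "\<forall>l. lookup M l = card {i. lookup m i = Suc l}"
      using pmon_spread[of M m] m by simp
    ultimately have "M' = M" by (intro poly_mapping_eqI) simp
    then show False using M' by simp
  qed
  have "0 = coeff_mps (pev_y F) m" using z by simp
  also have "\<dots> = (\<Sum>M'\<in>keys F. lookup F M' * coeff_mps (pmon M') m)"
    unfolding pev_y_def by (simp add: poly_eval_superset[OF const_mps_hom finite_keys order_refl])
  also have "\<dots> = (\<Sum>M'\<in>{M}. lookup F M' * coeff_mps (pmon M') m)"
    by (rule sum.mono_neutral_right) (use M o in auto)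
  finally show False using m(2) M(1) by (simp add: in_keys_iff)
qed

lemma at_x_over_a_pev: "at_x_over_a (pev_y F) = pev_x F"
proof -
  interpret comm_ring_hom pev_y by (rule pev_y_hom)
  have "(THE G. pev_y G = pev_y F) = F"
  proof (rule the_equality)
    fix G assume "pev_y G = pev_y F"
    then have "pev_y (G - F) = 0" by (simp add: hom_minus)
    then show "G = F" using pev_y_eq_0 by force
  qed simp
  then show ?thesis by (simp add: at_x_over_a_def pev_x_def[symmetric] pev_y_def[symmetric])
qed

lemma pev_p:
  assumes "1 \<le> k"
  shows "pev_y (single (single (k - 1) 1) 1) = p_y k"
    and "pev_x (single (single (k - 1) 1) 1) = p_xa k"
  using assms by (simp_all add: pev_y_def pev_x_def poly_eval_single[OF const_mps_hom])

lemma pev_const: "pev_y (single 0 c) = const_mps c" "pev_x (single 0 c) = const_mps c"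
  by (simp_all add: pev_y_def pev_x_def poly_eval_single[OF const_mps_hom])

lemma const_mult_cancel:
  fixes f g :: "('v, rat) mps"
  assumes "const_mps (of_nat r) * f = const_mps (of_nat r) * g" "r \<noteq> 0"
  shows "f = g"
proof (rule mps_eqI)
  fix m
  show "coeff_mps f m = coeff_mps g m"
    using arg_cong[OF assms(1), of "\<lambda>f. coeff_mps f m"] assms(2) by simp
qed

section \<open>The functions h_r(x/a) and the powers of \<gamma> on them\<close>

lemma h_y_pev: "\<exists>F. pev_y F = h_y r"
proof (cases "0 \<le> r")
  case False
  interpret comm_ring_hom pev_y by (rule pev_y_hom)
  have "pev_y 0 = h_y r" using False by (simp add: h_y_eq h_in_neg)
  then show ?thesis by blast
next
  case True
  have "\<exists>F. pev_y F = h_y (int r)" for r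
  proof (induction r rule: less_induct)
    case (less r)
    interpret comm_ring_hom pev_y by (rule pev_y_hom)
    show ?case
    proof (cases "r = 0")
      case True
      have "pev_y 1 = h_y (int r)" using True by (simp add: h_y_eq h_in_0)
      then show ?thesis by blast
    next
      case False
      define F where "F k = (SOME F. pev_y F = h_y (int (r - k)))" for k
      have F: "pev_y (F k) = h_y (int (r - k))" if "1 \<le> k" for k
      proof -
        have "r - k < r" using that False by simp
        then show ?thesis unfolding F_def by (rule someI_ex[OF less.IH])
      qed
      \<comment> \<open>Newton's identity solved for h_r over the rationals; variable number k - 1
        stands for p_k.\<close>
      let ?G = "single 0 (1 / of_nat r) *
        (\<Sum>k = 1..r. single (single (k - 1) 1) 1 * F k)"
      have "const_mps (of_nat r) * pev_y ?G = (\<Sum>k = 1..r. p_y k * h_y (int r - int k))"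
      proof -
        have "(\<Sum>k = 1..r. p_y k * pev_y (F k)) = (\<Sum>k = 1..r. p_y k * h_y (int r - int k))"
          by (rule sum.cong) (auto simp: F of_nat_diff)
        moreover have "const_mps (of_nat r) * (const_mps (1 / of_nat r) * f) = f" for f :: "(int, rat) mps"
          using False by (intro mps_eqI) simp
        ultimately show ?thesis
          using pev_p(1) by (simp add: hom_mult hom_sum pev_const)
      qed
      then have "const_mps (of_nat r) * pev_y ?G = const_mps (of_nat r) * h_y (int r)"
        by (simp only: newton_y)
      then have "pev_y ?G = h_y (int r)"
        using False by (rule const_mult_cancel)
      then show ?thesis by blast
    qed
  qed
  from this[of "nat r"] show ?thesis using True by simp
qed

definition h_poly :: "int \<Rightarrow> (nat \<Rightarrow>\<^sub>0 nat) \<Rightarrow>\<^sub>0 rat" where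
  "h_poly r = (SOME F. pev_y F = h_y r)"

lemma pev_y_h_poly: "pev_y (h_poly r) = h_y r"
  unfolding h_poly_def using h_y_pev by (rule someI_ex)

definition hx :: "int \<Rightarrow> (xa_var, rat) mps" where
  "hx r = at_x_over_a (h_y r)"

lemma hx_pev: "hx r = pev_x (h_poly r)"
  by (simp add: hx_def at_x_over_a_pev flip: pev_y_h_poly)

lemma pev_y_inj: "pev_y F = pev_y G \<Longrightarrow> F = G"
proof -
  interpret comm_ring_hom pev_y by (rule pev_y_hom)
  assume "pev_y F = pev_y G"
  then have "pev_y (F - G) = 0" by (simp add: hom_minus)
  then show "F = G" using pev_y_eq_0 by force
qed

lemma hx_neg: "r < 0 \<Longrightarrow> hx r = 0"
  and hx_0: "hx 0 = 1"
proof -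
  interpret y: comm_ring_hom pev_y by (rule pev_y_hom)
  interpret x: comm_ring_hom pev_x by (rule pev_x_hom)
  have "h_poly 0 = 1" by (rule pev_y_inj) (simp add: pev_y_h_poly h_y_eq h_in_0)
  then show "hx 0 = 1" by (simp add: hx_pev)
  assume "r < 0"
  then have "h_poly r = 0" by (intro pev_y_inj) (simp add: pev_y_h_poly h_y_eq h_in_neg)
  then show "hx r = 0" by (simp add: hx_pev)
qed

text \<open>The identity in y lifts to polynomials in the power sums by their independence and is
  then evaluated at x/a.\<close>

lemma newton_x: "const_mps (of_nat r) * hx (int r) = (\<Sum>k = 1..r. p_xa k * hx (int r - int k))"
proof -
  interpret y: comm_ring_hom pev_y by (rule pev_y_hom)
  interpret x: comm_ring_hom pev_x by (rule pev_x_hom)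
  let ?p = "\<lambda>k. single (single (k - 1) (1 :: nat)) (1 :: rat)"
  have "single 0 (of_nat r) * h_poly (int r) = (\<Sum>k = 1..r. ?p k * h_poly (int r - int k))"
  proof (rule pev_y_inj)
    have "pev_y (\<Sum>k = 1..r. ?p k * h_poly (int r - int k)) = (\<Sum>k = 1..r. p_y k * h_y (int r - int k))"
      unfolding y.hom_sum y.hom_mult by (rule sum.cong) (simp_all add: pev_p(1)[unfolded One_nat_def] pev_y_h_poly)
    then show "pev_y (single 0 (of_nat r) * h_poly (int r)) = pev_y (\<Sum>k = 1..r. ?p k * h_poly (int r - int k))"
      by (simp only: y.hom_mult pev_const pev_y_h_poly newton_y)
  qed
  then have "pev_x (single 0 (of_nat r) * h_poly (int r)) = pev_x (\<Sum>k = 1..r. ?p k * h_poly (int r - int k))"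
    by simp
  moreover have "pev_x (\<Sum>k = 1..r. ?p k * h_poly (int r - int k)) = (\<Sum>k = 1..r. p_xa k * hx (int r - int k))"
    unfolding x.hom_sum x.hom_mult by (rule sum.cong) (simp_all add: pev_p(2)[unfolded One_nat_def] hx_pev)
  ultimately show ?thesis by (simp only: x.hom_mult pev_const hx_pev)
qed

lemma at_x_schur_y:
  "at_x_over_a (schur_y lam) = dt (len lam) (\<lambda>i j. hx (int (part lam (Suc i)) - int i + int j))"
proof -
  have "schur_y lam = dt (len lam) (\<lambda>i j. h_y (int (part lam (Suc i)) - int i + int j))"
    by (simp add: schur_y_def dt_def)
  also have "\<dots> = pev_y (dt (len lam) (\<lambda>i j. h_poly (int (part lam (Suc i)) - int i + int j)))"
    by (simp add: dt_hom[OF pev_y_hom] pev_y_h_poly)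
  finally show ?thesis
    by (simp add: at_x_over_a_pev dt_hom[OF pev_x_hom] hx_pev)
qed

lemma gamma_hom: "comm_ring_hom gamma"
  by (rule comm_ring_homI) (simp_all add: gamma_one gamma_add gamma_mult)

text \<open>Lowering every power sum p_k by b^k multiplies the generating series of the h_r by 1 - b
  t; here this follows by induction from Newton's identity.\<close>

lemma gamma_hx: "gamma (hx r) = hx r - embed_qa (a_var 1) * hx (r - 1)"
proof (cases "0 \<le> r")
  case False
  interpret comm_ring_hom gamma by (rule gamma_hom)
  show ?thesis using False by (simp add: hx_neg)
next
  case True
  interpret comm_ring_hom gamma by (rule gamma_hom)
  let ?b = "embed_qa (a_var 1)"
  have "gamma (hx (int r)) = hx (int r) - ?b * hx (int r - 1)" for r
  proof (induction r rule: less_induct)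
    case (less r)
    show ?case
    proof (cases "r = 0")
      case True
      then show ?thesis by (simp add: hx_0 hx_neg gamma_one)
    next
      case False
      \<comment> \<open>The terms with b^k and no power sum telescope as
        \<open>?f k - ?f (k - 1)\<close>.\<close>
      let ?f = "\<lambda>k. ?b ^ Suc k * hx (int r - 1 - int k)"
      have "const_mps (of_nat r) * gamma (hx (int r)) = gamma (const_mps (of_nat r) * hx (int r))"
        by (simp add: hom_mult gamma_const)
      also have "\<dots> = (\<Sum>k = 1..r. (p_xa k - ?b ^ k) * (hx (int r - int k) - ?b * hx (int r - 1 - int k)))"
        unfolding newton_x hom_sum hom_mult
      proof (rule sum.cong)
        fix k assume k: "k \<in> {1..r}"
        then have "gamma (hx (int (r - k))) = hx (int (r - k)) - ?b * hx (int (r - k) - 1)"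
          using False by (intro less) auto
        moreover have "int (r - k) = int r - int k" "int r - int k - 1 = int r - 1 - int k" using k by auto
        ultimately have "gamma (hx (int r - int k)) = hx (int r - int k) - ?b * hx (int r - 1 - int k)"
          by (simp only:)
        then show "gamma (p_xa k) * gamma (hx (int r - int k)) =
            (p_xa k - ?b ^ k) * (hx (int r - int k) - ?b * hx (int r - 1 - int k))"
          using k by (simp add: gamma_p)
      qed simp
      also have "\<dots> = (\<Sum>k = 1..r. p_xa k * hx (int r - int k)) - ?b * (\<Sum>k = 1..r. p_xa k * hx (int r - 1 - int k))
          + (\<Sum>k = 1..r. ?f k - ?f (k - 1))"
      proof -
        have "(p_xa k - ?b ^ k) * (hx (int r - int k) - ?b * hx (int r - 1 - int k)) =
            p_xa k * hx (int r - int k) - ?b * (p_xa k * hx (int r - 1 - int k)) + (?f k - ?f (k - 1))"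
          if kr: "k \<in> {1..r}" for k
        proof -
          obtain l where "k = Suc l" using kr by (cases k) auto
          then show ?thesis by (simp add: algebra_simps)
        qed
        then show ?thesis by (simp add: sum.distrib sum_subtractf sum_distrib_left)
      qed
      also have "(\<Sum>k = 1..r. ?f k - ?f (k - 1)) = - ?b * hx (int r - 1)"
        using sum_telescope''[of 0 r ?f] by (simp add: hx_neg)
      also have "(\<Sum>k = 1..r. p_xa k * hx (int r - 1 - int k)) = const_mps (of_nat (r - 1)) * hx (int r - 1)"
      proof -
        have r: "int (r - 1) = int r - 1" using False by simp
        have "{1..r} = insert r {1..r - 1}" using False by auto
        then have "(\<Sum>k = 1..r. p_xa k * hx (int r - 1 - int k)) = (\<Sum>k = 1..r - 1. p_xa k * hx (int (r - 1) - int k))"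
          using False by (simp add: hx_neg r)
        then show ?thesis using newton_x[of "r - 1"] r by simp
      qed
      also have "(\<Sum>k = 1..r. p_xa k * hx (int r - int k)) = const_mps (of_nat r) * hx (int r)"
        by (rule newton_x[symmetric])
      also have "const_mps (of_nat r) * hx (int r) - ?b * (const_mps (of_nat (r - 1)) * hx (int r - 1)) + - ?b * hx (int r - 1)
          = const_mps (of_nat r) * hx (int r) - (const_mps (of_nat (r - 1)) + const_mps 1) * (?b * hx (int r - 1))"
        by (simp add: algebra_simps)
      also have "const_mps (of_nat (r - 1)) + const_mps 1 = (const_mps (of_nat r) :: (xa_var, rat) mps)"
        using False by (intro mps_eqI) (simp add: coeff_const_mps coeff_mps_one of_nat_diff)
      also have "const_mps (of_nat r) * hx (int r) - const_mps (of_nat r) * (?b * hx (int r - 1)) =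
          const_mps (of_nat r) * (hx (int r) - ?b * hx (int r - 1))"
        by (simp add: right_diff_distrib)
      finally show ?thesis using False by (rule const_mult_cancel)
    qed
  qed
  from this[of "nat r"] show ?thesis using True by simp
qed

lemma gamma_pow_0: "gamma_pow 0 f = f"
  by (simp add: gamma_pow_def)

lemma gamma_pow_succ: "gamma_pow (k + 1) f = gamma (gamma_pow k f)"
proof (cases "0 \<le> k")
  case True
  then show ?thesis by (simp add: gamma_pow_def nat_add_distrib)
next
  case False
  define j where "j = nat (- k) - 1"
  have j: "k = - int (Suc j)" using False by (simp add: j_def)
  have "nat (- k) = Suc j" by (simp add: j)
  then have "gamma (gamma_pow k f) = ((inv_into UNIV gamma) ^^ j) f"
    using False bij_gamma by (simp add: gamma_pow_def surj_f_inv_f bij_is_surj)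
  also have "\<dots> = gamma_pow (- int j) f"
    by (cases j) (simp_all add: gamma_pow_def nat_add_distrib)
  finally show ?thesis by (simp add: j)
qed

lemma gamma_inj: "gamma f = gamma g \<longleftrightarrow> f = g"
  using bij_gamma by (simp add: bij_is_inj inj_eq)

lemma gamma_pow_add: "gamma_pow k (gamma_pow l f) = gamma_pow (k + l) f"
proof (induction k rule: int_induct[of _ 0])
  case base
  then show ?case by (simp add: gamma_pow_0)
next
  case (step1 k)
  then show ?case
    using gamma_pow_succ[of k "gamma_pow l f"] gamma_pow_succ[of "k + l" f] by (simp add: ac_simps)
next
  case (step2 k)
  then show ?case
    using gamma_pow_succ[of "k - 1" "gamma_pow l f"] gamma_pow_succ[of "k - 1 + l" f]
    by (simp add: gamma_inj algebra_simps)
qed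

lemma gamma_pow_hom: "comm_ring_hom (gamma_pow k)"
proof (induction k rule: int_induct[of _ 0])
  case base
  show ?case by (rule comm_ring_homI) (simp_all add: gamma_pow_0)
next
  case (step1 k)
  interpret comm_ring_hom "gamma_pow k" by (rule step1)
  show ?case
    by (rule comm_ring_homI) (simp_all add: gamma_pow_succ hom_add hom_mult gamma_add gamma_mult gamma_one)
next
  case (step2 k)
  interpret comm_ring_hom "gamma_pow k" by (rule step2)
  have g: "gamma (gamma_pow (k - 1) f) = gamma_pow k f" for f
    using gamma_pow_succ[of "k - 1" f] by simp
  show ?case
    by (rule comm_ring_homI; subst gamma_inj[symmetric]) (simp_all add: g hom_add hom_mult gamma_add gamma_mult gamma_one)
qed

lemma gamma_pow_a: "gamma_pow k (embed_qa (a_var i)) = embed_qa (a_var (i + k))"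
proof (induction k rule: int_induct[of _ 0])
  case base
  then show ?case by (simp add: gamma_pow_0)
next
  case (step1 k)
  then show ?case by (simp add: gamma_pow_succ gamma_a add.assoc)
next
  case (step2 k)
  have "gamma (gamma_pow (k - 1) (embed_qa (a_var i))) = gamma (embed_qa (a_var (i + (k - 1))))"
    using gamma_pow_succ[of "k - 1" "embed_qa (a_var i)"] step2 gamma_a[of "i + (k - 1)"] by simp
  then show ?case by (simp only: gamma_inj)
qed

lemma embed_qa_hom: "comm_ring_hom embed_qa"
  unfolding embed_qa_def by (rule poly_eval_hom[OF const_mps_hom])

text \<open>Both sides gain the factor 1 - a_l t in the step from l - 1 to l. This factor is
  invertible, so agreement at l = 0 spreads to negative l as well.\<close>

lemma gamma_pow_hx_fps:
  "Abs_fps (\<lambda>r. gamma_pow l (hx (int r))) = map_fps embed_qa (rfac l) * Abs_fps (\<lambda>r. hx (int r))"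
proof -
  define G where "G l = Abs_fps (\<lambda>r. gamma_pow l (hx (int r)))" for l
  define E where "E l = map_fps embed_qa (rfac l)" for l
  define L where "L l = 1 - fps_const (embed_qa (a_var l)) * fps_X" for l
  interpret e: comm_ring_hom "map_fps embed_qa" by (rule map_fps_hom[OF embed_qa_hom])
  have Llin: "map_fps embed_qa (lin_fps l) = L l" for l
    by (simp add: L_def e.hom_minus e.hom_mult map_fps_const[OF embed_qa_hom] map_fps_X[OF embed_qa_hom])
  have Estep: "E l = E (l - 1) * L l" for l
    unfolding E_def by (subst rfac_step) (simp only: e.hom_mult Llin)
  have Gstep: "G l = G (l - 1) * L l" for l
  proof (rule fps_ext)
    fix r
    interpret g: comm_ring_hom "gamma_pow (l - 1)" by (rule gamma_pow_hom)
    have "gamma_pow l (hx (int r)) = gamma_pow (l - 1) (gamma_pow 1 (hx (int r)))"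
      by (simp add: gamma_pow_add)
    also have "gamma_pow 1 (hx (int r)) = gamma (hx (int r))"
      using gamma_pow_succ[of 0 "hx (int r)"] by (simp add: gamma_pow_0)
    also have "gamma_pow (l - 1) (gamma (hx (int r))) =
        gamma_pow (l - 1) (hx (int r)) - embed_qa (a_var l) * gamma_pow (l - 1) (hx (int r - 1))"
      by (simp add: gamma_hx g.hom_minus g.hom_mult gamma_pow_a)
    also have "\<dots> = fps_nth (G (l - 1) * L l) r"
    proof -
      have "G (l - 1) * L l = G (l - 1) - fps_const (embed_qa (a_var l)) * (G (l - 1) * fps_X)"
        unfolding L_def by (simp only: right_diff_distrib mult_1_left mult_1_right ac_simps)
      then show ?thesis by (cases r) (simp_all add: G_def hx_neg)
    qed
    finally show "fps_nth (G l) r = fps_nth (G (l - 1) * L l) r" by (simp add: G_def)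
  qed
  have inv: "L l * geo (embed_qa (a_var l)) = 1" for l
    unfolding L_def by (rule geo_mult)
  have GE: "G l = E l * G 0" for l
  proof (induction l rule: int_induct[of _ 0])
    case base
    then show ?case by (simp add: E_def rfac_0)
  next
    case (step1 k)
    then show ?case using Gstep[of "k + 1"] Estep[of "k + 1"] by (simp add: ac_simps)
  next
    case (step2 k)
    have "G (k - 1) = G (k - 1) * (L k * geo (embed_qa (a_var k)))" by (simp add: inv)
    also have "\<dots> = G k * geo (embed_qa (a_var k))" by (simp only: Gstep[of k] mult.assoc)
    also have "\<dots> = E (k - 1) * L k * G 0 * geo (embed_qa (a_var k))" by (simp only: step2 Estep[of k])
    also have "\<dots> = E (k - 1) * G 0 * (L k * geo (embed_qa (a_var k)))" by (simp only: ac_simps)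
    finally show ?case by (simp add: inv)
  qed
  show ?thesis
    using GE[of l] unfolding G_def E_def gamma_pow_0 .
qed

text \<open>The common bound N lets all entries of one matrix row be expanded over the same
  range.\<close>

lemma gamma_pow_hx:
  assumes "r \<le> int N"
  shows "gamma_pow l (hx r) = (\<Sum>s\<le>N. embed_qa (fps_nth (rfac l) s) * hx (r - int s))"
proof (cases "0 \<le> r")
  case False
  interpret g: comm_ring_hom "gamma_pow l" by (rule gamma_pow_hom)
  show ?thesis using False by (simp add: hx_neg)
next
  case True
  then obtain q where q: "r = int q" by (rule nonneg_int_cases)
  have "gamma_pow l (hx r) = fps_nth (Abs_fps (\<lambda>r. gamma_pow l (hx (int r)))) q" by (simp add: q)
  also have "\<dots> = (\<Sum>s\<le>q. embed_qa (fps_nth (rfac l) s) * hx (int (q - s)))"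
    unfolding gamma_pow_hx_fps by (simp add: fps_mult_nth map_fps_def atLeast0AtMost)
  also have "\<dots> = (\<Sum>s\<le>q. embed_qa (fps_nth (rfac l) s) * hx (r - int s))"
    by (rule sum.cong) (auto simp: q of_nat_diff)
  also have "\<dots> = (\<Sum>s\<le>N. embed_qa (fps_nth (rfac l) s) * hx (r - int s))"
    by (rule sum.mono_neutral_left) (use assms in \<open>auto simp: q hx_neg\<close>)
  finally show ?thesis .
qed

section \<open>Evaluation of the pairing\<close>

text \<open>For injective \<phi>, inverse to \<open>map_key \<phi>\<close> on vectors supported in
  the range; it serves the embeddings X and A, which are not surjective.\<close>

definition push :: "('v \<Rightarrow> 'w) \<Rightarrow> ('v \<Rightarrow>\<^sub>0 nat) \<Rightarrow> 'w \<Rightarrow>\<^sub>0 nat" where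
  "push \<phi> m = (\<Sum>i\<in>keys m. single (\<phi> i) (lookup m i))"

lemma lookup_push: "inj \<phi> \<Longrightarrow> lookup (push \<phi> m) (\<phi> i) = lookup m i"
proof -
  assume inj: "inj \<phi>"
  have "lookup (push \<phi> m) (\<phi> i) =
      (\<Sum>j\<in>keys m. if j = i then lookup m j else 0)"
    unfolding push_def lookup_sum
    by (rule sum.cong) (auto simp: lookup_single when_def inj_eq[OF inj])
  then show ?thesis by (simp add: sum.delta in_keys_iff)
qed

lemma lookup_push_outside: "j \<notin> range \<phi> \<Longrightarrow> lookup (push \<phi> m) j = 0"
  unfolding push_def lookup_sum by (rule sum.neutral) (auto simp: lookup_single when_def)

lemma keys_push: "keys (push \<phi> m) \<subseteq> range \<phi>"
proof
  fix j assume "j \<in> keys (push \<phi> m)"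
  then show "j \<in> range \<phi>" using lookup_push_outside[of j \<phi> m] in_keys_iff[of j "push \<phi> m"] by blast
qed

lemma map_key_push: "inj \<phi> \<Longrightarrow> map_key \<phi> (push \<phi> m) = m"
  by (rule poly_mapping_eqI) (simp add: map_key.rep_eq lookup_push)

lemma push_map_key:
  assumes "inj \<phi>" "keys p \<subseteq> range \<phi>"
  shows "push \<phi> (map_key \<phi> p) = p"
proof (rule poly_mapping_eqI)
  fix j
  show "lookup (push \<phi> (map_key \<phi> p)) j = lookup p j"
  proof (cases "j \<in> range \<phi>")
    case True
    then obtain i where "j = \<phi> i" by blast
    then show ?thesis by (simp add: lookup_push assms map_key.rep_eq)
  next
    case False
    then have "j \<notin> keys p" using assms(2) by blast
    then show ?thesis using False by (simp add: lookup_push_outside in_keys_iff)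
  qed
qed

lemma push_inj: "inj \<phi> \<Longrightarrow> push \<phi> m = push \<phi> n \<longleftrightarrow> m = n"
  using map_key_push[of \<phi> m] map_key_push[of \<phi> n] by metis

lemma push_add: "inj \<phi> \<Longrightarrow> push \<phi> (m + n) = push \<phi> m + push \<phi> n"
proof (rule poly_mapping_eqI)
  fix j assume inj: "inj \<phi>"
  show "lookup (push \<phi> (m + n)) j = lookup (push \<phi> m + push \<phi> n) j"
  proof (cases "j \<in> range \<phi>")
    case True
    then obtain i where "j = \<phi> i" by blast
    then show ?thesis by (simp add: lookup_push inj lookup_add)
  qed (simp add: lookup_push_outside lookup_add)
qed

lemma push_0 [simp]: "push \<phi> 0 = 0"
  by (simp add: push_def)

lemma push_single: "push \<phi> (single i k) = single (\<phi> i) k"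
  by (cases "k = 0") (simp_all add: push_def)

lemma mdeg_push: "mdeg (push \<phi> m) = mdeg m"
proof -
  have "mdeg (\<Sum>i\<in>I. single (\<phi> i) (f i)) = (\<Sum>i\<in>I. f i)" for I and f :: "_ \<Rightarrow> nat"
    by (induction I rule: infinite_finite_induct) (simp_all add: mdeg_add)
  then show ?thesis by (simp add: push_def mdeg_def)
qed

text \<open>For injective \<phi>, the variables outside the range are set to zero and the others
  renamed; \<open>restr X\<close> sets all a_i to zero.\<close>

definition restr :: "('v \<Rightarrow> 'w) \<Rightarrow> ('w, 'c :: comm_ring_1) mps \<Rightarrow> ('v, 'c) mps" where
  "restr \<phi> f = Abs_mps (\<lambda>m. coeff_mps f (push \<phi> m))"

lemma coeff_restr: "coeff_mps (restr \<phi> f) m = coeff_mps f (push \<phi> m)"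
  by (simp add: restr_def)

lemma push_eq_0_iff: "inj \<phi> \<Longrightarrow> push \<phi> m = 0 \<longleftrightarrow> m = 0"
  using push_inj[of \<phi> m 0] by simp

lemma restr_hom:
  fixes \<phi> :: "'v \<Rightarrow> 'w"
  assumes inj: "inj \<phi>"
  shows "comm_ring_hom (restr \<phi> :: ('w, 'c :: comm_ring_1) mps \<Rightarrow> _)"
proof (rule comm_ring_homI)
  show "restr \<phi> 1 = (1 :: ('v, 'c) mps)"
    by (rule mps_eqI) (simp add: coeff_restr coeff_mps_one push_eq_0_iff[OF inj])
  show "restr \<phi> (f + g) = restr \<phi> f + restr \<phi> g" for f g :: "('w, 'c) mps"
    by (rule mps_eqI) (simp add: coeff_restr)
  show "restr \<phi> (f * g) = restr \<phi> f * restr \<phi> g" for f g :: "('w, 'c) mps"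
  proof (rule mps_eqI)
    fix m
    let ?k = "map_key \<phi> :: ('w \<Rightarrow>\<^sub>0 nat) \<Rightarrow> _"
    have r: "push \<phi> (?k p) = p" "push \<phi> (?k q) = q" if "p + q = push \<phi> m" for p q
      using keys_add_nat[of p q] keys_push[of \<phi> m] by (simp_all add: that push_map_key[OF inj])
    have s: "?k p + ?k q = m" if "p + q = push \<phi> m" for p q
      using map_key_plus[OF inj, of p q] map_key_push[OF inj, of m] that by simp
    show "coeff_mps (restr \<phi> (f * g)) m = coeff_mps (restr \<phi> f * restr \<phi> g) m"
      unfolding coeff_restr coeff_mps_mult
      by (rule sum.reindex_bij_witness[of _ "map_prod (push \<phi>) (push \<phi>)" "map_prod ?k ?k"])
         (auto simp: r s map_key_push[OF inj] push_add[OF inj])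
  qed
qed

lemma inj_X: "inj X" and inj_A: "inj A"
  by (auto simp: inj_def)

lemma restr_const: "inj \<phi> \<Longrightarrow> restr \<phi> (const_mps c) = const_mps c"
  by (rule mps_eqI) (simp add: coeff_restr coeff_const_mps push_eq_0_iff)

lemma restr_p_xa:
  assumes "1 \<le> k"
  shows "restr X (p_xa k) = p_y k"
proof (rule mps_eqI)
  fix m
  have "push X m = single (X i) k \<longleftrightarrow> m = single i k" for i
    using push_inj[OF inj_X, of m "single i k"] by (simp add: push_single)
  moreover have "push X m \<noteq> single (A i) k" for i
  proof
    assume "push X m = single (A i) k"
    then have "k = lookup (push X m) (A i)" by simp
    also have "\<dots> = 0" by (rule lookup_push_outside) auto
    finally show False using assms by simp
  qed
  ultimately show "coeff_mps (restr X (p_xa k)) m = coeff_mps (p_y k) m"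
    by (simp add: coeff_restr coeff_p_xa[OF assms] coeff_p_y[OF assms])
qed

lemma restr_pev_x: "restr X (pev_x F) = pev_y F"
  unfolding pev_x_def pev_y_def
  by (rule hom_poly_eval[OF const_mps_hom restr_hom[OF inj_X] _ _ const_mps_hom])
    (simp_all add: restr_const inj_X restr_p_xa)

section \<open>Independence of the s_\<nu>(x/a) over Q[a]\<close>

definition sx :: "partition \<Rightarrow> (xa_var, rat) mps" where
  "sx nu = at_x_over_a (schur_y nu)"

lemma sx_eq: "sx lam = dt (len lam) (\<lambda>i j. hx (int (part lam (Suc i)) - int i + int j))"
  by (simp add: sx_def at_x_schur_y)

lemma restr_sx: "restr X (sx lam) = schur_gen lam"
proof -
  interpret comm_ring_hom "restr X :: (xa_var, rat) mps \<Rightarrow> _" by (rule restr_hom[OF inj_X])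
  show ?thesis
    unfolding sx_eq schur_gen_def dt_hom[OF restr_hom[OF inj_X]]
    by (simp add: hx_pev restr_pev_x pev_y_h_poly h_y_eq)
qed

lemma homog_p_xa: "1 \<le> k \<Longrightarrow> homog k (p_xa k)"
  by (auto simp: homog_def coeff_p_xa split: if_splits)

lemma homog_hx: "homog r (hx (int r))"
proof (induction r rule: less_induct)
  case (less r)
  show ?case
  proof (cases "r = 0")
    case True
    then show ?thesis by (simp add: hx_0 homog_1)
  next
    case False
    have "homog r (\<Sum>k = 1..r. p_xa k * hx (int r - int k))"
    proof (rule homog_sum)
      fix k assume k: "k \<in> {1..r}"
      have "homog (k + (r - k)) (p_xa k * hx (int (r - k)))"
        by (rule homog_mult[OF homog_p_xa less]) (use k False in auto)
      then show "homog r (p_xa k * hx (int r - int k))" using k by (simp add: of_nat_diff)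
    qed
    then have "homog r (const_mps (of_nat r) * hx (int r))" by (simp only: newton_x)
    then show ?thesis using False by (simp add: homog_def)
  qed
qed

lemma homog_sx: "homog (psize lam) (sx lam)"
  unfolding sx_eq
proof (rule homog_dt[where e = "\<lambda>i. int (part lam (Suc i)) - int i" and c = int])
  show "int (psize lam) = (\<Sum>i<len lam. int (part lam (Suc i)) - int i) + (\<Sum>j<len lam. int j)"
    by (simp add: psize_def sum_subtractf)
next
  fix i j
  let ?r = "int (part lam (Suc i)) - int i + int j"
  assume "hx ?r \<noteq> 0"
  then have "0 \<le> ?r" using hx_neg[of ?r] by linarith
  then show "0 \<le> ?r \<and> homog (nat ?r) (hx ?r)" using homog_hx[of "nat ?r"] by simp
qed

lemma coeff_embed_qa: "coeff_mps (embed_qa d) p =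
    (\<Sum>m\<in>keys d. if p = push A m then lookup d m else 0)"
proof -
  have "monom_eval (\<lambda>i. var_mps (A i)) m = (monom_mps (push A m) :: (xa_var, rat) mps)" for m
    by (simp add: monom_eval_def var_power prod_monom_mps push_def)
  then show ?thesis
    unfolding embed_qa_def poly_eval_superset[OF const_mps_hom finite_keys order_refl]
    by (simp add: coeff_monom_mps if_distrib cong: if_cong)
qed

lemma coeff_embed_push: "coeff_mps (embed_qa d) (push A m) = lookup d m"
  by (auto simp: coeff_embed_qa push_inj[OF inj_A] in_keys_iff)

lemma coeff_embed_outside: "p \<notin> range (push A) \<Longrightarrow> coeff_mps (embed_qa d) p = 0"
  unfolding coeff_embed_qa by (rule sum.neutral) auto

text \<open>The factor from Q[a] contains no x-variable, so f must supply all of \<mu>; its degree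
  is at most that of \<mu>, so it supplies nothing else.\<close>

lemma coeff_embed_mult:
  assumes f: "homog N f" and N: "N \<le> mdeg \<mu>"
  shows "coeff_mps (embed_qa d * f) (push X \<mu> + push A \<alpha>) = lookup d \<alpha> * coeff_mps f (push X \<mu>)"
proof -
  let ?m = "push X \<mu> + push A \<alpha>"
  have "coeff_mps (embed_qa d * f) ?m = (\<Sum>(p, q)\<in>{(push A \<alpha>, push X \<mu>)}. coeff_mps (embed_qa d) p * coeff_mps f q)"
    unfolding coeff_mps_mult
  proof (rule sum.mono_neutral_right[OF finite_splits], goal_cases)
    case 2
    show ?case
    proof
      fix x assume x: "x \<in> {(p, q). p + q = ?m} - {(push A \<alpha>, push X \<mu>)}"
      obtain p q where pq: "x = (p, q)" "p + q = ?m" using x by auto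
      show "(case x of (p, q) \<Rightarrow> coeff_mps (embed_qa d) p * coeff_mps f q) = 0"
      proof (cases "p \<in> range (push A)")
        case False
        then show ?thesis by (simp add: pq coeff_embed_outside)
      next
        case True
        then obtain \<beta> where p: "p = push A \<beta>" by blast
        have le: "lookup (push X \<mu>) v \<le> lookup q v" for v
        proof (cases v)
          case (X i)
          have "lookup p v = 0" "lookup (push A \<alpha>) v = 0"
            unfolding p by (rule lookup_push_outside, use X in auto)+
          then show ?thesis
            using arg_cong[OF pq(2), of "\<lambda>m. lookup m v"] by (simp add: lookup_add)
        next
          case (A i)
          have "lookup (push X \<mu>) v = 0"
            by (rule lookup_push_outside) (use A in auto)
          then show ?thesis by simp
        qed
        define r where "r = q - push X \<mu>"
        have q: "q = push X \<mu> + r"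
          by (rule poly_mapping_eqI) (simp add: r_def lookup_add lookup_minus le)
        have "q \<noteq> push X \<mu>"
        proof
          assume q: "q = push X \<mu>"
          then have "p = push A \<alpha>" using pq(2) by (simp add: add.commute[of "push X \<mu>"])
          then show False using x pq q by simp
        qed
        then have "r \<noteq> 0" using q by auto
        then have "mdeg q \<noteq> N" using N mdeg_eq_0_iff[of r] by (simp add: q mdeg_add mdeg_push)
        then have "coeff_mps f q = 0" using f by (auto simp: homog_def)
        then show ?thesis by (simp add: pq)
      qed
    qed
  qed (auto simp: add.commute)
  then show ?thesis by (simp add: coeff_embed_push)
qed

lemma coeff_sx_push: "coeff_mps (sx nu) (push X \<mu>) = coeff_mps (schur_gen nu) \<mu>"
  using arg_cong[OF restr_sx[of nu], of "\<lambda>f. coeff_mps f \<mu>"] by (simp add: coeff_restr)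

text \<open>The part of highest degree in \<open>x\<close> of \<open>s\<^sub>\<nu>(x/a)\<close> is the ordinary Schur function \<open>s\<^sub>\<nu>(x)\<close>.\<close>

lemma sx_independent:
  assumes S: "finite S" and z: "(\<Sum>nu\<in>S. embed_qa (d nu) * sx nu) = 0"
  shows "nu \<in> S \<Longrightarrow> d nu = 0"
proof (rule ccontr)
  assume "nu \<in> S" "d nu \<noteq> 0"
  define T where "T = {nu \<in> S. d nu \<noteq> 0}"
  have T: "finite T" "nu \<in> T" using S \<open>nu \<in> S\<close> \<open>d nu \<noteq> 0\<close> by (auto simp: T_def)
  interpret e: comm_ring_hom embed_qa by (rule embed_qa_hom)
  have zT: "(\<Sum>nu\<in>T. embed_qa (d nu) * sx nu) = 0"
    unfolding z[symmetric] T_def by (rule sum.mono_neutral_left) (use S in auto)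
  define N where "N = Max (psize ` T)"
  have N: "psize nu \<le> N" if "nu \<in> T" for nu
    unfolding N_def by (rule Max_ge) (use that T in auto)
  have "N \<in> psize ` T" unfolding N_def by (rule Max_in) (use T in auto)
  then obtain kap where kap: "kap \<in> T" "psize kap = N" by auto
  \<comment> \<open>A monomial in a occurring in the coordinate of a partition of maximal size N;
    \<open>G\<close> collects the coefficients of this monomial.\<close>
  obtain \<alpha> where \<alpha>: "lookup (d kap) \<alpha> \<noteq> 0"
    using kap(1) by (auto simp: T_def poly_mapping_eq_iff fun_eq_iff)
  define G :: "(int, rat) mps" where
    "G = (\<Sum>nu\<in>T. const_mps (lookup (d nu) \<alpha>) * schur_gen nu)"
  have G0: "coeff_mps G \<mu> = 0" if "mdeg \<mu> = N" for \<mu>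
  proof -
    have "coeff_mps G \<mu> = (\<Sum>nu\<in>T. coeff_mps (embed_qa (d nu) * sx nu) (push X \<mu> + push A \<alpha>))"
      unfolding G_def coeff_mps_sum
    proof (rule sum.cong)
      fix nu assume "nu \<in> T"
      then show "coeff_mps (const_mps (lookup (d nu) \<alpha>) * schur_gen nu) \<mu> =
          coeff_mps (embed_qa (d nu) * sx nu) (push X \<mu> + push A \<alpha>)"
        using coeff_embed_mult[OF homog_sx, of nu \<mu> "d nu" \<alpha>] N[of nu] that by (simp add: coeff_sx_push)
    qed simp
    also have "\<dots> = coeff_mps (\<Sum>nu\<in>T. embed_qa (d nu) * sx nu) (push X \<mu> + push A \<alpha>)" by simp
    finally show ?thesis by (simp add: zT)
  qed
  let ?m = "mon N (exps N kap)"
  have dm: "mdeg ?m = N + (\<Sum>k<N. N - 1 - k)"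
    using len_le_psize[of kap] kap(2) by (simp only: mdeg_mon sum_exps)
  \<comment> \<open>Homogeneity of the Vandermonde determinant leaves only the part of
    \<open>G\<close> in degree N, which is zero by \<open>G0\<close>.\<close>
  have "coeff_mps (vand N * G) ?m = 0"
    unfolding coeff_mps_mult
  proof (intro sum.neutral ballI)
    fix x assume "x \<in> {(p, q). p + q = ?m}"
    then obtain p q where pq: "x = (p, q)" "p + q = ?m" by auto
    show "(case x of (p, q) \<Rightarrow> coeff_mps (vand N) p * coeff_mps G q) = 0"
    proof (cases "coeff_mps (vand N) p = (0 :: rat)")
      case False
      then have "mdeg p = (\<Sum>k<N. N - 1 - k)" using homog_vand[of N] unfolding homog_def by blast
      then have "mdeg q = N" using dm arg_cong[OF pq(2), of mdeg] by (simp add: mdeg_add)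
      then show ?thesis by (simp add: pq G0)
    qed (simp add: pq)
  qed
  moreover have "coeff_mps (vand N * G) ?m = (\<Sum>nu\<in>T. if nu = kap then lookup (d kap) \<alpha> else 0)"
    unfolding G_def sum_distrib_left mult.left_commute[of "vand N"] coeff_mps_sum
    by (rule sum.cong) (auto simp: coeff_vand_schur_gen_any kap(2))
  ultimately show False using \<alpha> kap(1) T by simp
qed

text \<open>A relational form of the pairing with \<open>schur_series c\<close> that is visibly linear in \<open>f\<close>.\<close>

definition pairs :: "(partition \<Rightarrow> qa) \<Rightarrow> (xa_var, rat) mps \<Rightarrow> qa \<Rightarrow> bool" where
  "pairs c f v \<longleftrightarrow> (\<exists>S d. finite S \<and> f = (\<Sum>nu\<in>S. embed_qa (d nu) * sx nu) \<and> v = (\<Sum>nu\<in>S. d nu * c nu))"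

lemma pairs_0: "pairs c 0 0"
  unfolding pairs_def by (rule exI[of _ "{}"]) simp

lemma pairs_sx: "pairs c (sx nu) (c nu)"
proof -
  interpret e: comm_ring_hom embed_qa by (rule embed_qa_hom)
  show ?thesis unfolding pairs_def by (intro exI[of _ "{nu}"] exI[of _ "\<lambda>_. 1"]) simp
qed

lemma pairs_scale: "pairs c f v \<Longrightarrow> pairs c (embed_qa b * f) (b * v)"
proof -
  interpret e: comm_ring_hom embed_qa by (rule embed_qa_hom)
  assume "pairs c f v"
  then obtain S d where "finite S" "f = (\<Sum>nu\<in>S. embed_qa (d nu) * sx nu)" "v = (\<Sum>nu\<in>S. d nu * c nu)"
    unfolding pairs_def by blast
  then show ?thesis
    unfolding pairs_def
    by (intro exI[of _ S] exI[of _ "\<lambda>nu. b * d nu"]) (simp add: sum_distrib_left e.hom_mult mult.assoc)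
qed

lemma pairs_add: "pairs c f v \<Longrightarrow> pairs c g w \<Longrightarrow> pairs c (f + g) (v + w)"
proof -
  interpret e: comm_ring_hom embed_qa by (rule embed_qa_hom)
  assume "pairs c f v" "pairs c g w"
  then obtain S d T b where S: "finite S" "f = (\<Sum>nu\<in>S. embed_qa (d nu) * sx nu)" "v = (\<Sum>nu\<in>S. d nu * c nu)"
    and T: "finite T" "g = (\<Sum>nu\<in>T. embed_qa (b nu) * sx nu)" "w = (\<Sum>nu\<in>T. b nu * c nu)"
    unfolding pairs_def by blast
  let ?d = "\<lambda>nu. (if nu \<in> S then d nu else 0) + (if nu \<in> T then b nu else 0)"
  have ext: "(\<Sum>nu\<in>U. h nu) = (\<Sum>nu\<in>S \<union> T. if nu \<in> U then h nu else 0)" if "U \<subseteq> S \<union> T" for U and h :: "_ \<Rightarrow> 'z :: comm_monoid_add"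
    using that S(1) T(1) by (simp add: sum.If_cases Int_absorb1)
  have f: "f = (\<Sum>nu\<in>S \<union> T. embed_qa (if nu \<in> S then d nu else 0) * sx nu)"
    unfolding S(2) by (rule sum.mono_neutral_cong_left) (use S(1) T(1) in auto)
  have v: "v = (\<Sum>nu\<in>S \<union> T. (if nu \<in> S then d nu else 0) * c nu)"
    unfolding S(3) by (rule sum.mono_neutral_cong_left) (use S(1) T(1) in auto)
  have g: "g = (\<Sum>nu\<in>S \<union> T. embed_qa (if nu \<in> T then b nu else 0) * sx nu)"
    unfolding T(2) by (rule sum.mono_neutral_cong_left) (use S(1) T(1) in auto)
  have w: "w = (\<Sum>nu\<in>S \<union> T. (if nu \<in> T then b nu else 0) * c nu)"
    unfolding T(3) by (rule sum.mono_neutral_cong_left) (use S(1) T(1) in auto)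
  show ?thesis
    unfolding pairs_def f g v w
    using S(1) T(1) by (intro exI[of _ "S \<union> T"] exI[of _ ?d]) (simp add: sum.distrib e.hom_add distrib_right)
qed

lemma pairs_uminus: "pairs c f v \<Longrightarrow> pairs c (- f) (- v)"
proof -
  interpret e: comm_ring_hom embed_qa by (rule embed_qa_hom)
  assume "pairs c f v"
  then show ?thesis using pairs_scale[of c f v "- 1"] by (simp add: e.hom_uminus)
qed

lemma pairs_sum: "(\<And>i. i \<in> I \<Longrightarrow> pairs c (f i) (v i)) \<Longrightarrow> pairs c (sum f I) (sum v I)"
  by (induction I rule: infinite_finite_induct) (auto simp: pairs_0 pairs_add)

text \<open>By \<open>sx_independent\<close> the coordinates of f are unique, so any expansion
  computes the pairing.\<close>

lemma pairing_eq:
  assumes "pairs c f v"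
  shows "pairing f (schur_series c) = v"
proof -
  interpret e: comm_ring_hom embed_qa by (rule embed_qa_hom)
  obtain S b where S: "finite S" "f = (\<Sum>nu\<in>S. embed_qa (b nu) * sx nu)" "v = (\<Sum>nu\<in>S. b nu * c nu)"
    using assms unfolding pairs_def by blast
  define d where "d nu = (if nu \<in> S then b nu else 0)" for nu
  have fd: "finite {nu. d nu \<noteq> 0}" by (rule finite_subset[OF _ S(1)]) (auto simp: d_def)
  have f: "f = (\<Sum>nu | d nu \<noteq> 0. embed_qa (d nu) * sx nu)"
    unfolding S(2) by (rule sum.mono_neutral_cong_right) (use S(1) in \<open>auto simp: d_def split: if_splits\<close>)
  have "xa_coords f = d"
    unfolding xa_coords_def sx_def[symmetric]
  proof (rule the_equality)
    show "finite {nu. d nu \<noteq> 0} \<and> f = (\<Sum>nu | d nu \<noteq> 0. embed_qa (d nu) * sx nu)"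
      using fd f by simp
    fix d' assume d': "finite {nu. d' nu \<noteq> 0} \<and> f = (\<Sum>nu | d' nu \<noteq> 0. embed_qa (d' nu) * sx nu)"
    let ?U = "{nu. d nu \<noteq> 0} \<union> {nu. d' nu \<noteq> 0}"
    have fU: "finite ?U" using fd d' by simp
    have 1: "f = (\<Sum>nu\<in>?U. embed_qa (d nu) * sx nu)"
      by (subst f, rule sum.mono_neutral_left) (use fU in auto)
    have 2: "f = (\<Sum>nu\<in>?U. embed_qa (d' nu) * sx nu)"
      by (subst conjunct2[OF d'], rule sum.mono_neutral_left) (use fU in auto)
    have "(\<Sum>nu\<in>?U. embed_qa (d' nu - d nu) * sx nu) = 0"
      using 1 2 by (simp add: e.hom_minus left_diff_distrib sum_subtractf)
    then have "d' nu - d nu = 0" if "nu \<in> ?U" for nu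
      using sx_independent[OF fU, of "\<lambda>nu. d' nu - d nu"] that by blast
    then show "d' = d" by (intro ext) (metis (mono_tags, lifting) UnCI eq_iff_diff_eq_0 mem_Collect_eq)
  qed
  then have "pairing f (schur_series c) = (\<Sum>nu | d nu \<noteq> 0. d nu * c nu)"
    by (simp add: pairing_def hat_coords_schur_series)
  also have "\<dots> = v"
    unfolding S(3) by (rule sum.mono_neutral_cong_left) (use S(1) in \<open>auto simp: d_def split: if_splits\<close>)
  finally show ?thesis .
qed

text \<open>Interpolates, one row at a time, between \<open>s\<^sub>\<nu>(x/a)\<close> (\<open>k = 0\<close>) and \<open>s\<^sub>\<nu>(x\<parallel>a)\<close> (\<open>k = n\<close>).\<close>

definition xdet :: "nat \<Rightarrow> nat \<Rightarrow> (nat \<Rightarrow> nat) \<Rightarrow> (xa_var, rat) mps" where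
  "xdet n k e = dt n (\<lambda>i j. if i < k then gamma_pow (int (e i) - int n) (hx (int (e i) - int (n - 1) + int j))
     else hx (int (e i) - int (n - 1) + int j))"

lemma xdet_0_exps:
  assumes "len lam \<le> n"
  shows "xdet n 0 (exps n lam) = sx lam"
proof -
  have "xdet n 0 (exps n lam) = dt n (\<lambda>i j. hx (int (part lam (Suc i)) - int i + int j))"
    unfolding xdet_def by (rule dt_cong) (auto simp: exps_def of_nat_diff algebra_simps)
  also have "\<dots> = sx lam"
    unfolding sx_eq by (rule dt_stable[OF assms]) (auto simp: part_Suc hx_neg hx_0)
  finally show ?thesis .
qed

text \<open>The column shift -j and the shift r - 1 in h_r, where r = part - i + j, add up to part -
  i - 1, which is \<open>exps n lam i - n\<close>. The appended rows are unitriangular.\<close>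

lemma xdet_exps:
  assumes "len lam \<le> n"
  shows "xdet n n (exps n lam) = double_schur lam"
proof -
  let ?M = "\<lambda>i j. gamma_pow (int (part lam (Suc i)) - int i - 1) (hx (int (part lam (Suc i)) - int i + int j))"
  have "xdet n n (exps n lam) = dt n ?M"
    unfolding xdet_def by (rule dt_cong) (auto simp: exps_def of_nat_diff algebra_simps)
  also have "\<dots> = dt (len lam) ?M"
  proof (rule dt_stable[OF assms])
    fix i j assume "len lam \<le> i"
    interpret g: comm_ring_hom "gamma_pow k" for k by (rule gamma_pow_hom)
    show "j < i \<Longrightarrow> ?M i j = 0" "?M i i = 1"
      using \<open>len lam \<le> i\<close> by (simp_all add: part_Suc hx_neg hx_0)
  qed
  also have "\<dots> = double_schur lam"
    unfolding double_schur_def dt_def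
    by (rule arg_cong[of _ _ det]) (auto simp: h_xa_def hx_def gamma_pow_add algebra_simps)
  finally show ?thesis .
qed

text \<open>All entries of row k carry the same power of \<gamma>, so \<open>gamma_pow_hx\<close>
  writes the row as one combination of unshifted rows with lowered exponents.\<close>

lemma xdet_step:
  assumes k: "k < n"
  shows "xdet n (Suc k) e =
    (\<Sum>s\<le>e k. embed_qa (fps_nth (rfac (int (e k) - int n)) s) * xdet n k (e(k := e k - s)))"
proof -
  let ?l = "int (e k) - int n"
  let ?M = "\<lambda>i j. if i < k then gamma_pow (int (e i) - int n) (hx (int (e i) - int (n - 1) + int j))
     else hx (int (e i) - int (n - 1) + int j)"
  let ?N = "\<lambda>s j. hx (int (e k) - int (n - 1) + int j - int s)"
  have "xdet n (Suc k) e = dt n (?M(k := \<lambda>j. \<Sum>s\<le>e k. embed_qa (fps_nth (rfac ?l) s) * ?N s j))"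
    unfolding xdet_def
  proof (rule dt_cong)
    fix i j assume "i < n" "j < n"
    then have "int (e k) - int (n - 1) + int j \<le> int (e k)" by simp
    then show "(if i < Suc k then gamma_pow (int (e i) - int n) (hx (int (e i) - int (n - 1) + int j))
       else hx (int (e i) - int (n - 1) + int j)) =
      (?M(k := \<lambda>j. \<Sum>s\<le>e k. embed_qa (fps_nth (rfac ?l) s) * ?N s j)) i j"
      using gamma_pow_hx[of "int (e k) - int (n - 1) + int j" "e k" ?l] by auto
  qed
  also have "\<dots> = (\<Sum>s\<le>e k. embed_qa (fps_nth (rfac ?l) s) * dt n (?M(k := ?N s)))"
    by (rule dt_row_linear[OF k])
  also have "\<dots> = (\<Sum>s\<le>e k. embed_qa (fps_nth (rfac ?l) s) * xdet n k (e(k := e k - s)))"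
  proof (intro sum.cong refl arg_cong2[of _ _ _ _ "(*)"])
    fix s assume "s \<in> {..e k}"
    then show "dt n (?M(k := ?N s)) = xdet n k (e(k := e k - s))"
      unfolding xdet_def by (intro dt_cong) (auto simp: of_nat_diff algebra_simps)
  qed
  finally show ?thesis .
qed

text \<open>Both sides alternate in e, which leaves e = \<open>exps n lam\<close>; there the
  determinant is \<open>sx lam\<close> and the coefficient is \<open>c lam\<close>.\<close>

lemma pairs_xdet_0:
  assumes "(\<Sum>k<n. e k) \<le> n + (\<Sum>k<n. n - 1 - k)"
  shows "pairs c (xdet n 0 e) (coeff_mps (vand n * schur_series c) (mon n e))"
  using assms
proof (induction e rule: exps_induct[where n = n])
  case (1 e k)
  let ?t = "transpose k (Suc k)"
  have "(\<Sum>j<n. (e \<circ> ?t) j) = (\<Sum>j<n. e j)"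
    using sum_transpose_lessThan[of k n "Suc k" e] 1(1) by simp
  then have "pairs c (xdet n 0 (e \<circ> ?t)) (coeff_mps (vand n * schur_series c) (mon n (e \<circ> ?t)))"
    using 1(2,3) by (simp only:)
  moreover have "coeff_mps (vand n * schur_series c) (mon n (e \<circ> ?t)) = - coeff_mps (vand n * schur_series c) (mon n e)"
    by (rule coeff_vand_transpose[OF sym_schur_series]) (use 1(1) in auto)
  moreover have "xdet n 0 (e \<circ> ?t) = - xdet n 0 e"
  proof -
    have p: "?t permutes {0..<n}" by (rule permutes_swap_id) (use 1(1) in auto)
    show ?thesis
      using dt_permute_rows[OF p, of "\<lambda>i j. hx (int (e i) - int (n - 1) + int j)"]
      by (simp add: xdet_def sign_swap_id)
  qed
  ultimately show ?case using pairs_uminus by fastforce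
next
  case (2 e k)
  have "xdet n 0 e = 0"
    unfolding xdet_def by (rule dt_identical_rows[of k n "Suc k"]) (use 2 in auto)
  moreover have "coeff_mps (vand n * schur_series c) (mon n e) = 0"
  proof -
    have "e \<circ> transpose k (Suc k) = e" using 2(2) by (auto simp: transpose_def)
    then have "coeff_mps (vand n * schur_series c) (mon n e) = - coeff_mps (vand n * schur_series c) (mon n e)"
      using coeff_vand_transpose[OF sym_schur_series[of c], of k n "Suc k" e] 2(1) by simp
    then have "2 * coeff_mps (vand n * schur_series c) (mon n e) = 0" by (metis add_eq_0_iff2 mult_2)
    then show ?thesis by simp
  qed
  ultimately show ?case by (simp add: pairs_0)
next
  case (3 e lam)
  have "(\<Sum>k<n. e k) = (\<Sum>k<n. exps n lam k)" by (rule sum.cong) (use 3 in auto)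
  then have "psize lam \<le> n" using 3 by (simp add: sum_exps)
  moreover have "mon n e = mon n (exps n lam)" using 3(2) by (simp add: mon_eq_iff)
  moreover have "xdet n 0 e = xdet n 0 (exps n lam)"
    unfolding xdet_def by (rule dt_cong) (simp add: 3(2))
  ultimately show ?case
    using pairs_sx[of c lam] by (simp add: xdet_0_exps 3(1) coeff_vand_schur_series)
qed

text \<open>The factor \<open>rfac\<close> in the variable of row k expands in the coefficient
  exactly as row k does in \<open>xdet_step\<close>; exponents only drop, so the degree bound
  persists.\<close>

lemma pairs_xdet:
  assumes "k \<le> n" "(\<Sum>i<n. e i) \<le> n + (\<Sum>i<n. n - 1 - i)"
  shows "pairs c (xdet n k e) (coeff_mps (rprod n k e * (vand n * schur_series c)) (mon n e))"
  using assms
proof (induction k arbitrary: e)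
  case 0
  then show ?case using pairs_xdet_0[of e n c] by (simp add: rprod_def)
next
  case (Suc k)
  let ?F = "vand n * schur_series c" and ?R = "rfac (int (e k) - int n)"
  have kn: "k < n" using Suc.prems by simp
  have "coeff_mps (rprod n (Suc k) e * ?F) (mon n e) = coeff_mps (emb (- int k) ?R * (rprod n k e * ?F)) (mon n e)"
    by (simp add: rprod_def ac_simps)
  also have "\<dots> = (\<Sum>s\<le>e k. fps_nth ?R s * coeff_mps (rprod n k e * ?F) (mon n e - single (- int k) s))"
    by (simp add: coeff_emb_mult lookup_mon_nat[OF kn])
  also have "\<dots> = (\<Sum>s\<le>e k. fps_nth ?R s * coeff_mps (rprod n k (e(k := e k - s)) * ?F) (mon n (e(k := e k - s))))"
  proof (intro sum.cong refl)
    fix s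
    have "rprod n k (e(k := e k - s)) = rprod n k e" by (simp add: rprod_def)
    then show "fps_nth ?R s * coeff_mps (rprod n k e * ?F) (mon n e - single (- int k) s) =
        fps_nth ?R s * coeff_mps (rprod n k (e(k := e k - s)) * ?F) (mon n (e(k := e k - s)))"
      by (simp add: mon_minus_single[OF kn])
  qed
  finally have eq: "coeff_mps (rprod n (Suc k) e * ?F) (mon n e) =
      (\<Sum>s\<le>e k. fps_nth ?R s * coeff_mps (rprod n k (e(k := e k - s)) * ?F) (mon n (e(k := e k - s))))" .
  show ?case
    unfolding eq xdet_step[OF kn]
  proof (intro pairs_sum pairs_scale Suc.IH)
    fix s
    have "(\<Sum>i<n. (e(k := e k - s)) i) \<le> (\<Sum>i<n. e i)" by (rule sum_mono) simp
    then show "(\<Sum>i<n. (e(k := e k - s)) i) \<le> n + (\<Sum>i<n. n - 1 - i)" using Suc.prems by simp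
  qed (use kn in simp)
qed

lemma pairing_double_schur:
  assumes "psize kap \<le> n"
  shows "pairing (double_schur kap) (schur_series c) = Phi n (exps n kap) (schur_series c)"
proof -
  have l: "len kap \<le> n" using len_le_psize[of kap] assms by simp
  have "(\<Sum>i<n. exps n kap i) \<le> n + (\<Sum>i<n. n - 1 - i)" using assms by (simp only: sum_exps[OF l])
  from pairing_eq[OF pairs_xdet[OF order_refl this]] show ?thesis
    by (simp add: xdet_exps[OF l] Phi_def)
qed

section \<open>The dual Schur functions\<close>

lemma dual_schur_eq: "dual_schur mu = schur_series (dual_coeff mu)"
proof -
  let ?P = "\<lambda>g. g \<in> Lambda_hat \<and> (\<forall>lam. pairing (double_schur lam) g = (if lam = mu then 1 else 0))"
  have P: "?P (schur_series (dual_coeff mu))"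
    by (simp add: Lambda_hat_def pairing_double_schur[OF order_refl] Phi_dual_coeff)
  have u: "g = schur_series (dual_coeff mu)" if g: "?P g" for g
  proof -
    obtain c where c: "g = schur_series c" using g by (auto simp: Lambda_hat_def)
    have "g - schur_series (dual_coeff mu) = 0"
    proof (rule Phi_unique[of _ 0])
      show "sym_mps (g - schur_series (dual_coeff mu))"
        unfolding c by (intro sym_hom_closed sym_schur_series)
      fix n lam assume lam: "psize lam \<le> n"
      have "pairing (double_schur lam) (schur_series c) = pairing (double_schur lam) (schur_series (dual_coeff mu))"
        using g P c by simp
      then show "Phi n (exps n lam) (g - schur_series (dual_coeff mu)) = 0"
        unfolding c Phi_diff pairing_double_schur[OF lam] by simp
    qed
    then show ?thesis by simp
  qed
  show ?thesis unfolding dual_schur_def by (rule the_equality[of ?P, OF P u])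
qed

lemma sym_dual_schur: "sym_mps (dual_schur mu)"
  unfolding dual_schur_eq by (rule sym_schur_series)

text \<open>The pairing in \<open>pairing_double_schur\<close> does not depend on n, so the value
  built into \<open>dual_coeff\<close> at n = \<open>psize kap\<close> carries over to all larger
  n.\<close>

lemma Phi_dual_schur:
  assumes "psize kap \<le> n"
  shows "Phi n (exps n kap) (dual_schur mu) = (if kap = mu then 1 else 0)"
  using pairing_double_schur[OF assms, of "dual_coeff mu"]
    pairing_double_schur[OF order_refl, of kap "dual_coeff mu"]
  by (simp add: dual_schur_eq Phi_dual_coeff)

lemma dual_schur_empty:
  assumes "psize mu = 0"
  shows "dual_schur mu = 1"
proof -
  have "dual_schur mu - 1 = 0"
  proof (rule Phi_unique[of _ 0])
    show "sym_mps (dual_schur mu - 1)" by (intro sym_hom_closed sym_dual_schur sym_1)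
    fix n lam assume l: "psize lam \<le> n"
    have "psize lam = 0 \<longleftrightarrow> lam = mu" using assms psize_0_unique[of lam mu] by blast
    then show "Phi n (exps n lam) (dual_schur mu - 1) = 0"
      unfolding Phi_diff Phi_dual_schur[OF l] Phi_one[OF l] by simp
  qed
  then show ?thesis by simp
qed

lemma exps_content: "k < n \<Longrightarrow> int (exps n lam k) = int (part lam (Suc k)) - int k - 1 + int n"
  by (simp add: exps_def of_nat_diff)

text \<open>If no exponent of kap equals i + n, the value is that of \<open>dual_schur mu\<close>.
  Otherwise this exponent is lowered by 1: either two exponents coincide, or there remains a
  partition nu, which is kap without its box of content i, and nu = mu exactly if kap = lam. The
  minus sign comes from \<open>swap_alpha\<close>.\<close>

lemma Phi_twist_dual_schur:
  assumes ab: "add_box mu j lam" and i: "i = int (part mu (Suc j)) - int j"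
    and n: "psize lam + nat \<bar>i\<bar> < n" and kap: "psize kap \<le> n"
  shows "Phi n (exps n kap) (twist i * map_mps (swap_a i) (dual_schur mu)) =
    (if kap = mu then 1 else 0) - alpha i * (if kap = lam then 1 else 0)"
proof -
  let ?e = "exps n kap"
  interpret s: comm_ring_hom "swap_a i" by (rule swap_a_hom)
  have lam: "part lam (Suc k) = part mu (Suc k) + (if k = j then 1 else 0)" for k
    using ab by (simp add: add_box_def)
  have ls: "len lam \<le> n" "len mu \<le> n" "len kap \<le> n"
    using len_le_psize[of lam] len_le_psize[of mu] len_le_psize[of kap] add_box_psize[OF ab] n kap by auto
  have jn: "j < n"
  proof -
    have "part lam (Suc j) \<noteq> 0" by (simp add: lam)
    then show ?thesis using ls part_eq_0_iff[of lam j] by linarith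
  qed
  have lj: "int (exps n lam j) = i + int n" by (simp add: exps_content[OF jn] lam i)
  have e_lam: "exps n lam k = exps n mu k + (if k = j then 1 else 0)" for k
    by (simp add: exps_def lam)
  have inj: "exps n nu k = exps n nu l \<Longrightarrow> k < n \<Longrightarrow> l < n \<Longrightarrow> k = l" for nu k l
    using exps_strict[of k l n nu] exps_strict[of l k n nu] by (cases k l rule: linorder_cases) auto
  show ?thesis
  proof (cases "\<exists>k<n. int (?e k) = i + int n")
    case False
    then have "kap \<noteq> lam" using jn lj by blast
    then show ?thesis
      using Phi_twist_fixed[of n ?e i "dual_schur mu"] False by (simp add: Phi_dual_schur[OF kap])
  next
    case True
    then obtain k where k: "k < n" "int (?e k) = i + int n" by blast
    let ?f = "?e(k := ?e k - 1)"
    \<comment> \<open>The bound on n makes i + n positive.\<close>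
    have pos: "0 < ?e k" using k n by linarith
    have kj: "k = j" if "kap = lam"
      using inj[of lam k j] k lj jn that by simp
    have "Phi n ?f (dual_schur mu) = (if kap = lam then 1 else 0)"
    \<comment> \<open>In this case row k and the next row have equal length, so the last box of row
      k cannot be removed.\<close>
    proof (cases "Suc k < n \<and> ?e (Suc k) = ?e k - 1")
      case True
      have "kap \<noteq> lam"
      proof
        assume "kap = lam"
        then have "exps n mu (Suc j) = exps n mu j" using True kj e_lam[of j] e_lam[of "Suc j"] by simp
        then show False using inj[of mu "Suc j" j] jn True kj \<open>kap = lam\<close> by simp
      qed
      moreover have "Phi n ?f (dual_schur mu) = 0"
        by (rule Phi_repeat[OF sym_dual_schur, of k n "Suc k"]) (use True k in auto)
      ultimately show ?thesis by simp
    next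
      case False
      have "?f (Suc l) < ?f l" if "Suc l < n" for l
        using exps_strict[of l "Suc l" n kap] that False pos by auto
      then obtain nu where nu: "len nu \<le> n" "\<forall>l<n. ?f l = exps n nu l"
        using exps_exist by blast
      have "(\<Sum>l<n. exps n nu l) \<le> (\<Sum>l<n. ?e l)"
        by (rule sum_mono) (use nu(2) in \<open>auto split: if_splits simp flip: nu(2)[rule_format]\<close>)
      then have "psize nu \<le> n" using kap by (simp only: sum_exps[OF nu(1)] sum_exps[OF ls(3)])
      moreover have "Phi n ?f (dual_schur mu) = Phi n (exps n nu) (dual_schur mu)"
        by (rule Phi_cong) (use nu(2) in blast)
      moreover have "nu = mu \<longleftrightarrow> kap = lam"
      proof
        assume "nu = mu"
        have "exps n mu k = ?e k - 1" using nu(2)[rule_format, OF k(1)] \<open>nu = mu\<close> by simp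
        then have "int (exps n mu k) = i + int n - 1" using k pos by (simp add: of_nat_diff)
        \<comment> \<open>Rows of mu are distinguished by the content at which they grow, so k is
          the row j of the new box.\<close>
        then have "w_part mu (- int k) = w_part mu (- int j)"
          by (simp add: exps_content[OF k(1)] w_part_nonpos i)
        then have "k = j" by (simp only: w_part_inj_nonpos)
        show "kap = lam"
        proof (rule exps_inj[OF ls(3,1)])
          fix l assume "l < n"
          then have "?f l = exps n mu l" using nu(2) \<open>nu = mu\<close> by simp
          then show "?e l = exps n lam l" using pos \<open>k = j\<close> by (auto simp: e_lam split: if_splits)
        qed
      next
        assume "kap = lam"
        show "nu = mu"
        proof (rule exps_inj[OF nu(1) ls(2)])
          fix l assume "l < n"
          then have "exps n nu l = ?f l" using nu(2) by simp
          then show "exps n nu l = exps n mu l" using kj \<open>kap = lam\<close> by (simp add: e_lam)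
        qed
      qed
      ultimately show ?thesis by (simp add: Phi_dual_schur)
    qed
    moreover have "Phi n ?e (twist i * map_mps (swap_a i) (dual_schur mu)) =
        swap_a i (Phi n ?e (dual_schur mu) + alpha i * Phi n ?f (dual_schur mu))"
      by (rule Phi_twist_moved[of k n ?e, OF k pos]) (use inj k in blast)
    ultimately show ?thesis
      by (simp add: Phi_dual_schur[OF kap] s.hom_add s.hom_mult swap_alpha)
  qed
qed

text \<open>The undivided form of \<open>delta i\<close>, checked on the functionals
  \<open>Phi n\<close> beyond the threshold of \<open>Phi_twist_dual_schur\<close>.\<close>

lemma alpha_dual_schur:
  assumes ab: "add_box mu j lam" and i: "i = int (part mu (Suc j)) - int j"
  shows "const_mps (alpha i) * dual_schur lam = dual_schur mu - twist i * map_mps (swap_a i) (dual_schur mu)"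
proof -
  interpret s: comm_ring_hom "swap_a i" by (rule swap_a_hom)
  let ?T = "twist i * map_mps (swap_a i) (dual_schur mu)"
  have "const_mps (alpha i) * dual_schur lam - (dual_schur mu - ?T) = 0"
  proof (rule Phi_unique[of _ "psize lam + nat \<bar>i\<bar> + 1"])
    show "sym_mps (const_mps (alpha i) * dual_schur lam - (dual_schur mu - ?T))"
      by (intro sym_hom_closed sym_const sym_dual_schur sym_twist sym_map_mps) simp
    fix n kap assume "psize lam + nat \<bar>i\<bar> + 1 \<le> n" and kap: "psize kap \<le> n"
    then have n: "psize lam + nat \<bar>i\<bar> < n" by simp
    show "Phi n (exps n kap) (const_mps (alpha i) * dual_schur lam - (dual_schur mu - ?T)) = 0"
      by (simp only: Phi_diff Phi_const_mult Phi_dual_schur[OF kap] Phi_twist_dual_schur[OF ab i n kap]) simp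
  qed
  then show ?thesis by simp
qed

text \<open>\<open>alpha_dual_schur\<close> provides the quotient, and cancelling the nonzero
  \<alpha>_i coefficient by coefficient makes it unique; this settles both definite descriptions
  behind \<open>delta\<close>.\<close>

lemma delta_dual_schur:
  assumes ab: "add_box mu j lam" and i: "i = int (part mu (Suc j)) - int j"
  shows "delta i (dual_schur mu) = dual_schur lam"
proof (cases "i = 0")
  case True
  have eq: "const_mps (alpha 0) * dual_schur lam = dual_schur mu - Omega * map_mps (swap_a 0) (dual_schur mu)"
    using alpha_dual_schur[OF ab i] True by (simp add: twist_def)
  have "g = dual_schur lam" if "const_mps (alpha 0) * g = const_mps (alpha 0) * dual_schur lam" for g
  proof (rule mps_eqI)
    fix m
    show "coeff_mps g m = coeff_mps (dual_schur lam) m"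
      using arg_cong[OF that, of "\<lambda>f. coeff_mps f m"] alpha_nonzero[of 0] by simp
  qed
  then show ?thesis
    unfolding delta_def eq[symmetric] using True by (auto intro!: the_equality)
next
  case False
  show ?thesis
  proof (rule mps_eqI)
    fix m
    let ?c = "coeff_mps (dual_schur mu) m"
    have eq: "alpha i * coeff_mps (dual_schur lam) m = ?c - swap_a i ?c"
      using arg_cong[OF alpha_dual_schur[OF ab i], of "\<lambda>f. coeff_mps f m"] False by (simp add: twist_def)
    have "divdiff i ?c = coeff_mps (dual_schur lam) m"
      unfolding divdiff_def eq[symmetric] using alpha_nonzero[of i] by (intro the_equality) auto
    then show "coeff_mps (delta i (dual_schur mu)) m = coeff_mps (dual_schur lam) m"
      using False by (simp add: delta_def)
  qed
qed

lemma delta_word_dual_schur: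
  assumes "reduced_word js (w_part lam)"
  shows "delta_word js 1 = dual_schur lam"
  using assms
proof (rule reduced_word_induct[where Q = "\<lambda>js mu. delta_word js 1 = dual_schur mu"])
  show "delta_word [] 1 = dual_schur mu" if "psize mu = 0" for mu
    using dual_schur_empty[OF that] by (simp add: delta_word_def)
  show "delta_word (i # ks) 1 = dual_schur nu"
    if "delta_word ks 1 = dual_schur mu" "add_box mu j nu" "i = int (part mu (Suc j)) - int j" for i ks mu nu j
    using that delta_dual_schur[OF that(2,3)] by (simp add: delta_word_def)
qed

theorem theorem6p5:
  fixes lam :: partition
  shows "dual_schur lam = delta_perm (w_part lam) 1"
proof -
  obtain js where js: "reduced_word js (w_part lam)"
    using reduced_word_exists by blast
  \<comment> \<open>The existence of a reduced word keeps this set from being empty.\<close>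
  have "{delta_word is 1 | is. reduced_word is (w_part lam)} = {dual_schur lam}"
  proof (intro equalityI subsetI)
    fix g assume "g \<in> {dual_schur lam}"
    then have "g = delta_word js 1" using delta_word_dual_schur[OF js] by simp
    then show "g \<in> {delta_word is 1 | is. reduced_word is (w_part lam)}" using js by blast
  qed (use delta_word_dual_schur in blast)
  then show ?thesis by (simp add: delta_perm_def)
qed

end
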